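(* Let $\xi_1,\dots,\xi_n$ be independent real random variables with $\mathbf{E}\xi_i=0$, satisfying Bernstein's condition: there is a constant $\varepsilon>0$ such that $|\mathbf{E}\xi_i^k|\le \frac12 k!\,\varepsilon^{k-2}\mathbf{E}\xi_i^2$ for all $k\ge 3$ and $i=1,\dots,n$. Let $S_n=\sum_{i=1}^n\xi_i$ and $\sigma^2=\sum_{i=1}^n\mathbf{E}\xi_i^2>0$. Then for all $0\le x<\frac1{12}\frac{\sigma}{\varepsilon}$, \[ \mathbf{P}(S_n>x\sigma)=\inf_{\lambda\ge0}\mathbf{E}e^{\lambda(S_n-x\sigma)}\;\Big(M(x)+27.99\,\theta\,R(4x\varepsilon/\sigma)\frac{\varepsilon}{\sigma}\Big) \] for some $\theta=\theta(x)$ with $|\theta|\le1$. Moreover, $\inf_{\lambda\ge0}\mathbf{E}e^{\lambda(S_n-x\sigma)}\le B(x,\varepsilon/\sigma)$. In particular, in the i.i.d. case (the $\xi_i$ identically distributed, with $\varepsilon$ and the common distribution fixed and $n\to\infty$), for $0\le x=o(\sqrt n)$, \[ \Big|\mathbf{P}(S_n>x\sigma)-M(x)\inf_{\lambda\ge0}\mathbf{E}e^{\lambda(S_n-x\sigma)}\Big|=O\Big(\frac1{\sqrt n}B(x,\varepsilon/\sigma)\Big). \]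
   Context: $\Phi$ is the standard normal distribution function, $M(x)=(1-\Phi(x))e^{x^2/2}$. For $x\ge0$ and $r>0$, $B(x,r)=\exp\{-\widehat{x}^2/2\}$ with $\widehat{x}=\frac{2x}{1+\sqrt{1+2xr}}$. The function $R$ is defined by $R(t)=\frac{(1-t+6t^2)^3}{(1-3t)^{3/2}(1-t)^7}$ for $0\le t<\frac13$ and $R(t)=\infty$ for $t\ge\frac13$. *)

theory Defs
  imports "HOL-Probability.Probability" "HOL-Library.Landau_Symbols"
begin

definition Phi :: "real \<Rightarrow> real" where
  "Phi x = measure (density lborel std_normal_density) {..x}"

definition Mills :: "real \<Rightarrow> real" where
  "Mills x = (1 - Phi x) * exp (x\<^sup>2 / 2)"

definition Bfun :: "real \<Rightarrow> real \<Rightarrow> real" where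
  "Bfun x r = exp (- ((2 * x / (1 + sqrt (1 + 2 * x * r)))\<^sup>2) / 2)"

definition Rfun :: "real \<Rightarrow> ereal" where
  "Rfun t = (if t < 1/3
     then ereal ((1 - t + 6 * t\<^sup>2) ^ 3 / ((1 - 3 * t) powr (3/2) * (1 - t) ^ 7))
     else \<infinity>)"

(* inf_{\<lambda> \<ge> 0} E exp(\<lambda>(S - t)); computed in [0,\<infinity>] (so infinite exponential
   moments are handled correctly); it is \<le> 1 (take \<lambda> = 0), hence finite *)
definition chernoff_inf :: "'a measure \<Rightarrow> ('a \<Rightarrow> real) \<Rightarrow> real \<Rightarrow> real" where
  "chernoff_inf M S t =
     enn2real (INF l\<in>{0::real..}. \<integral>\<^sup>+ \<omega>. ennreal (exp (l * (S \<omega> - t))) \<partial>M)"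

(* Bernstein's condition for a single random variable X with parameter \<epsilon>;
   the moments are required to exist (as is implicit in the condition) *)
definition bernstein_cond :: "'a measure \<Rightarrow> ('a \<Rightarrow> real) \<Rightarrow> real \<Rightarrow> bool" where
  "bernstein_cond M X \<epsilon> \<longleftrightarrow>
     (\<forall>k. integrable M (\<lambda>\<omega>. X \<omega> ^ k)) \<and>
     (\<forall>k\<ge>3. \<bar>\<integral>\<omega>. X \<omega> ^ k \<partial>M\<bar> \<le> 1/2 * fact k * \<epsilon> ^ (k - 2) * (\<integral>\<omega>. X \<omega> ^ 2 \<partial>M))"

end

theory Submission
  imports Defs
begin

text \<open>Let \<open>\<lambda>\<close> be the saddle point, \<open>\<Psi>'(\<lambda>) = x\<sigma>\<close> with \<open>\<Psi>\<close> the cumulant generating function of \<open>S\<close>.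
  By convexity it attains the infimum, and tilting the law of \<open>S\<close> by \<open>exp (\<lambda>S)\<close> gives
  \<open>P(S > x\<sigma>) = inf * E exp (- \<lambda>cY) 1{Y > 0}\<close>, where \<open>Y\<close> is the tilted sum, centred and divided by its
  standard deviation \<open>c\<close>. For a Gaussian \<open>Y\<close> the last expectation is \<open>M(\<lambda>c)\<close>; the layer-cake formula
  bounds the error of replacing \<open>Y\<close> by a Gaussian by twice the Kolmogorov distance, and
  \<open>\<lambda>c\<close> differs from \<open>x\<close> by a relative error of order \<open>\<lambda>\<epsilon>\<close>. The Kolmogorov distance is controlled
  by Esseen smoothing with the Fejer kernel, in a version of the Berry-Esseen theorem adapted to
  summands with \<open>E Y^4 \<le> d^2 E Y^2\<close>: this makes every summand small compared to \<open>d\<close> and gives the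
  constant \<open>2.4 d\<close>. Bernstein's condition yields \<open>d = sqrt 12 * \<epsilon> / \<sigma>\<close> up to a factor \<open>1 + 57\<lambda>\<epsilon>\<close>, and
  \<open>2 * 2.4 * sqrt 12 < 27.99\<close>; all the factors depending on \<open>\<lambda>\<epsilon>\<close> are absorbed by the growth of \<open>R\<close>.\<close>

section \<open>The Fejer kernel\<close>

text \<open>Bernstein's condition bounds signed moments only, so odd absolute moments have to be
  reached through even ones. This is why smallness of a summand is expressed by a fourth moment:
  \<open>E Y^4 <= d^2 E Y^2\<close> gives, by Cauchy-Schwarz, both \<open>E |Y|^3 <= d E Y^2\<close>
  and \<open>E Y^2 <= d^2\<close>. Without tilt the condition for \<open>k = 4\<close> reads
  \<open>E X^4 <= 12 \<epsilon>^2 E X^2\<close>, whence \<open>sqrt 12\<close>. The difficulty is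
  uniformity in \<open>x\<close>. With \<open>t = \<lambda> * \<epsilon>\<close>, the bound on
  \<open>x\<close> keeps \<open>4 * x * \<epsilon> / \<sigma>\<close> below 1/3 and allows a saddle
  point with \<open>t <= 0.11\<close>; every tilted moment is then compared with a polynomial in
  \<open>t\<close>, and \<open>R >= 1 + 34 s + 456 s^2\<close> with \<open>s = t - 2.1 t^2\<close>
  has to outgrow \<open>1 + 57 t\<close>. At \<open>t = 0\<close> the smoothing error is about 16.63
  units of \<open>\<epsilon> / \<sigma>\<close>; the room up to 27.99 pays for replacing
  \<open>M(\<lambda> c)\<close> by \<open>M(x)\<close>, about 2.1 units, and for the growth in
  \<open>t\<close>. That replacement stays of order \<open>\<epsilon> / \<sigma>\<close> for large
  \<open>x\<close> because the slope of \<open>M\<close> at \<open>a\<close> is at most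
  \<open>0.399 / a^2\<close>.\<close>

definition fejer :: "real \<Rightarrow> real" where
  "fejer u = (1 - cos u) / (pi * u\<^sup>2)"

text \<open>The odd antiderivative of \<open>fejer\<close>, obtained from the sine integral by
  parts. The distribution function itself is \<open>1/2 + fejer_cdf\<close>. At 0 the convention
  \<open>x / 0 = 0\<close> yields the correct value 0.\<close>

definition fejer_cdf :: "real \<Rightarrow> real" where
  "fejer_cdf v = (Si v - (1 - cos v) / v) / pi"

lemma fejer_nonneg [simp]: "0 \<le> fejer u"
  by (simp add: fejer_def)

lemma fejer_minus [simp]: "fejer (- u) = fejer u"
  by (simp add: fejer_def)

lemma borel_measurable_fejer [measurable]: "fejer \<in> borel_measurable borel"
  unfolding fejer_def[abs_def] by measurable

lemma fejer_cdf_minus: "fejer_cdf (- v) = - fejer_cdf v"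
proof (cases "v \<ge> 0")
  case True then show ?thesis by (simp add: fejer_cdf_def Si_neg minus_divide_left)
next
  case False then show ?thesis using Si_neg[of "-v"]
    by (simp add: fejer_cdf_def minus_divide_left)
qed

lemma DERIV_fejer_cdf:
  assumes "x \<noteq> 0" shows "(fejer_cdf has_real_derivative fejer x) (at x)"
proof -
  have "((\<lambda>v. (Si v - (1 - cos v) / v) / pi) has_real_derivative
      (sinc x - (sin x * x - (1 - cos x)) / (x * x)) / pi) (at x)"
    using assms by (auto intro!: derivative_eq_intros DERIV_Si)
  moreover have "(sinc x - (sin x * x - (1 - cos x)) / (x * x)) / pi = fejer x"
    using assms by (simp add: fejer_def field_simps power2_eq_square)
  ultimately show ?thesis
    by (simp add: fejer_cdf_def[abs_def])
qed

lemma fejer_cdf_tendsto_0: "(fejer_cdf \<longlongrightarrow> 0) (at 0)"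
proof -
  have Si0: "(Si \<longlongrightarrow> 0) (at 0)"
    using isCont_Si[of 0] by (simp add: isCont_def Si_def zero_ereal_def)
  have "(cos has_real_derivative 0) (at 0)"
    by (auto intro!: derivative_eq_intros)
  then have "((\<lambda>v. (cos v - 1) / v) \<longlongrightarrow> 0) (at (0::real))"
    by (simp add: has_field_derivative_iff)
  then have "((\<lambda>v. - ((cos v - 1) / v)) \<longlongrightarrow> 0) (at (0::real))"
    using tendsto_minus by fastforce
  then have "((\<lambda>v. (1 - cos v) / v) \<longlongrightarrow> 0) (at (0::real))"
    by (simp add: minus_divide_left)
  then have "((\<lambda>v. (Si v - (1 - cos v) / v) / pi) \<longlongrightarrow> (0 - 0) / pi) (at 0)"
    using Si0 by (intro tendsto_intros) auto
  then show ?thesis by (simp add: fejer_cdf_def[abs_def])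
qed

lemma fejer_cdf_tendsto_half: "(fejer_cdf \<longlongrightarrow> 1/2) at_top"
proof -
  have "((\<lambda>v. (1 - cos v) / v) \<longlongrightarrow> 0) (at_top :: real filter)"
  proof (rule Lim_null_comparison)
    show "\<forall>\<^sub>F v in at_top. norm ((1 - cos v) / v) \<le> 2 / v"
      using eventually_gt_at_top[of 0]
      by eventually_elim (auto simp: divide_right_mono)
    show "((\<lambda>v::real. 2 / v) \<longlongrightarrow> 0) at_top"
      by (intro tendsto_divide_0[OF tendsto_const] filterlim_at_top_imp_at_infinity filterlim_ident)
  qed
  then have "((\<lambda>v. (Si v - (1 - cos v) / v) / pi) \<longlongrightarrow> (pi/2 - 0) / pi) at_top"
    using Si_at_top by (intro tendsto_intros) auto
  then show ?thesis by (simp add: fejer_cdf_def[abs_def])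
qed

text \<open>By the division convention \<open>fejer 0 = 0\<close>, whereas the limit there is
  \<open>1 / (2 * pi)\<close>, so the fundamental theorem is applied on an open interval with
  one-sided limits of the antiderivative. The extended real endpoint covers a finite interval and
  the whole half line at once.\<close>

lemma fejer_integral_FTC:
  fixes b :: ereal
  assumes "0 < b" and B: "((fejer_cdf \<circ> real_of_ereal) \<longlongrightarrow> B) (at_left b)"
  shows "set_integrable lborel (einterval 0 b) fejer" "(LBINT x=0..b. fejer x) = B"
proof -
  have A: "((fejer_cdf \<circ> real_of_ereal) \<longlongrightarrow> 0) (at_right 0)"
    unfolding zero_ereal_def ereal_tendsto_simps1
    by (rule tendsto_within_subset[OF fejer_cdf_tendsto_0]) simp
  have C: "isCont fejer x" if "0 < ereal x" for x
    unfolding fejer_def[abs_def] using that by (auto intro!: continuous_intros)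
  note ftc = interval_integral_FTC_nonneg[of 0 b fejer_cdf fejer, OF \<open>0 < b\<close> _ C _ A B]
  show "set_integrable lborel (einterval 0 b) fejer"
    by (rule ftc) (auto intro!: DERIV_fejer_cdf)
  show "(LBINT x=0..b. fejer x) = B"
    by (subst ftc(2)) (auto intro!: DERIV_fejer_cdf)
qed

abbreviation fejer_measure :: "real measure" where
  "fejer_measure \<equiv> density lborel fejer"

lemma emeasure_fejer_Ioo:
  fixes v :: real assumes "0 < v"
  shows "emeasure fejer_measure {0<..<v} = ennreal (fejer_cdf v)" and fejer_cdf_nonneg: "0 \<le> fejer_cdf v"
proof -
  have B: "((fejer_cdf \<circ> real_of_ereal) \<longlongrightarrow> fejer_cdf v) (at_left (ereal v))"
    unfolding ereal_tendsto_simps1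
    by (rule tendsto_within_subset[where S=UNIV])
      (use DERIV_fejer_cdf[of v, THEN DERIV_isCont] assms in \<open>auto simp: isCont_def\<close>)
  have e: "einterval 0 v = {0<..<v}"
    by (auto simp: einterval_def)
  note F = fejer_integral_FTC[OF _ B, unfolded e] 
  have "(\<integral>\<^sup>+ x. ennreal (fejer x) * indicator {0<..<v} x \<partial>lborel)
      = (\<integral>\<^sup>+ x. ennreal (indicator {0<..<v} x *\<^sub>R fejer x) \<partial>lborel)"
    by (intro nn_integral_cong) (auto simp: indicator_def)
  also have "\<dots> = ennreal (LBINT x:{0<..<v}. fejer x)"
    unfolding set_lebesgue_integral_def using F(1) assms
    by (intro nn_integral_eq_integral) (auto simp: set_integrable_def)
  also have *: "(LBINT x:{0<..<v}. fejer x) = fejer_cdf v"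
    using F(2) assms by (simp add: interval_lebesgue_integral_def e)
  finally show "emeasure fejer_measure {0<..<v} = ennreal (fejer_cdf v)"
    by (subst emeasure_density) auto
  show "0 \<le> fejer_cdf v"
    unfolding *[symmetric] set_lebesgue_integral_def by (rule integral_nonneg_AE) auto
qed

lemma emeasure_fejer_Ioi: "emeasure fejer_measure {0<..} = ennreal (1/2)"
proof -
  have B: "((fejer_cdf \<circ> real_of_ereal) \<longlongrightarrow> 1/2) (at_left \<infinity>)"
    using fejer_cdf_tendsto_half by (simp add: ereal_tendsto_simps)
  have e: "einterval 0 \<infinity> = {0<..}"
    by (auto simp: einterval_def)
  note F = fejer_integral_FTC[OF _ B, unfolded e] 
  have "(\<integral>\<^sup>+ x. ennreal (fejer x) * indicator {0<..} x \<partial>lborel)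
      = (\<integral>\<^sup>+ x. ennreal (indicator {0<..} x *\<^sub>R fejer x) \<partial>lborel)"
    by (intro nn_integral_cong) (auto simp: indicator_def)
  also have "\<dots> = ennreal (LBINT x:{0<..}. fejer x)"
    unfolding set_lebesgue_integral_def using F(1)
    by (intro nn_integral_eq_integral) (auto simp: set_integrable_def)
  also have "(LBINT x:{0<..}. fejer x) = 1/2"
    using F(2) by (simp add: interval_lebesgue_integral_def e)
  finally show ?thesis by (subst emeasure_density) auto
qed

lemma distr_fejer_uminus: "distr fejer_measure borel uminus = fejer_measure"
proof -
  have "density (distr lborel borel uminus) (\<lambda>x. ennreal (fejer x))
    = distr (density lborel (\<lambda>x. ennreal (fejer (- x)))) borel uminus"
    by (subst density_distr) auto
  then show ?thesis
    by (simp add: lborel_distr_uminus)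
qed

lemma emeasure_fejer_singleton: "emeasure fejer_measure {v} = 0"
proof -
  have "(\<integral>\<^sup>+ x. ennreal (fejer x) * indicator {v} x \<partial>lborel) = (\<integral>\<^sup>+ x. 0 \<partial>(lborel::real measure))"
    using AE_lborel_singleton[of v] by (intro nn_integral_cong_AE) (auto simp: indicator_def)
  then show ?thesis by (subst emeasure_density) auto
qed

lemma emeasure_fejer_uminus:
  assumes "A \<in> sets borel" shows "emeasure fejer_measure (uminus ` A) = emeasure fejer_measure A"
proof -
  have "uminus ` A = uminus -` A" for A :: "real set"
    by force
  then show ?thesis
    using assms distr_fejer_uminus emeasure_distr[of uminus fejer_measure borel A] by simp
qed

lemma prob_space_fejer: "prob_space fejer_measure"
proof
  have "emeasure fejer_measure UNIV = emeasure fejer_measure ({0<..} \<union> {..<0} \<union> {0})"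
    by (rule arg_cong[of _ _ "emeasure fejer_measure"]) auto
  also have "\<dots> = emeasure fejer_measure {0<..} + emeasure fejer_measure {..<0} + emeasure fejer_measure {0}"
    by (subst plus_emeasure, simp, simp, force, subst plus_emeasure, auto)
  also have "emeasure fejer_measure {..<0} = emeasure fejer_measure {0<..}"
    using emeasure_fejer_uminus[of "{0<..}"] by simp
  finally show "emeasure fejer_measure (space fejer_measure) = 1"
    by (simp add: emeasure_fejer_Ioi emeasure_fejer_singleton del: ennreal_half flip: ennreal_plus)
qed

interpretation fejer: prob_space fejer_measure
  by (rule prob_space_fejer)

text \<open>The law is symmetric and has no atoms: right tails come from subtracting
  \<open>{0<..<w}\<close> from the half mass, and negative arguments are reflected.\<close>

lemma measure_fejer_atMost: "measure fejer_measure {..w} = 1/2 + fejer_cdf w"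
proof -
  have pos: "emeasure fejer_measure {w<..} = ennreal (1/2 - fejer_cdf w)" "fejer_cdf w \<le> 1/2" if "0 < w" for w
  proof -
    have "emeasure fejer_measure {0<..} = emeasure fejer_measure ({0<..<w} \<union> {w} \<union> {w<..})"
      using that by (intro arg_cong[of _ _ "emeasure fejer_measure"]) auto
    also have "\<dots> = emeasure fejer_measure {0<..<w} + emeasure fejer_measure {w} + emeasure fejer_measure {w<..}"
      by (subst plus_emeasure, simp, simp, force, subst plus_emeasure, auto)
    finally have *: "ennreal (fejer_cdf w) + emeasure fejer_measure {w<..} = ennreal (1/2)"
      using that by (simp add: emeasure_fejer_Ioi emeasure_fejer_singleton emeasure_fejer_Ioo del: ennreal_half)
    then show "fejer_cdf w \<le> 1/2"
      by (metis ennreal_le_iff le_iff_add divide_nonneg_nonneg zero_le_one zero_le_numeral)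
    show "emeasure fejer_measure {w<..} = ennreal (1/2 - fejer_cdf w)"
      using * fejer_cdf_nonneg[OF that]
      by (metis ennreal_minus ennreal_add_diff_cancel_left ennreal_neq_top)
  qed
  have compl: "measure fejer_measure {..w} = 1 - measure fejer_measure {w<..}" for w
    using fejer.prob_compl[of "{w<..}"] by (simp add: Compl_eq_Diff_UNIV[symmetric])
  consider "w > 0" | "w = 0" | "w < 0" by linarith
  then show ?thesis
  proof cases
    case 1
    then show ?thesis using pos[of w] compl[of w] by (simp add: measure_def)
  next
    case 2
    have "measure fejer_measure {0<..} = 1/2"
      by (simp add: measure_def emeasure_fejer_Ioi del: ennreal_half)
    with 2 show ?thesis using compl[of 0]
      by (simp add: fejer_cdf_def Si_def zero_ereal_def)
  next
    case 3
    have "emeasure fejer_measure {..w} = emeasure fejer_measure ({..<w} \<union> {w})"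
      by (intro arg_cong[of _ _ "emeasure fejer_measure"]) auto
    also have "\<dots> = emeasure fejer_measure {..<w}"
      by (subst plus_emeasure[symmetric]) (auto simp: emeasure_fejer_singleton)
    also have "\<dots> = emeasure fejer_measure {-w<..}"
      using emeasure_fejer_uminus[of "{-w<..}"] by simp
    finally show ?thesis using pos[of "-w"] 3 by (simp add: measure_def fejer_cdf_minus)
  qed
qed

text \<open>The Fourier representation that makes the kernel useful: smoothing by it only sees the
  characteristic function on \<open>[-T, T]\<close>.\<close>

lemma fejer_cdf_Fourier:
  assumes "T > 0"
  shows "set_integrable lborel {0<..<T} (\<lambda>t. (1 - t / T) * (sin (t * w) / t))"
    "(LBINT t:{0<..<T}. (1 - t / T) * (sin (t * w) / t)) = pi * fejer_cdf (T * w)"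
proof -
  have bound: "\<bar>sin (t * w) / t\<bar> \<le> \<bar>w\<bar>" for t
    using abs_sin_x_le_abs_x[of "t * w"] by (cases "t = 0") (auto simp: abs_mult field_simps)
  have I1: "set_integrable lborel {0<..<T} (\<lambda>t. sin (t * w) / t)"
    unfolding set_integrable_def
  proof (rule Bochner_Integration.integrable_bound[of _ "\<lambda>t. indicator {0<..<T} t * \<bar>w\<bar>"])
    show "integrable lborel (\<lambda>t. indicator {0<..<T} t * \<bar>w\<bar>)"
      using assms by (intro integrable_mult_left integrable_real_indicator) auto
    show "AE t in lborel. norm (indicator {0<..<T} t *\<^sub>R (sin (t * w) / t)) \<le> norm (indicator {0<..<T} t * \<bar>w\<bar>)"
    proof (rule AE_I2)
      show "norm (indicator {0<..<T} t *\<^sub>R (sin (t * w) / t)) \<le> norm (indicator {0<..<T} t * \<bar>w\<bar>)" for t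
        using bound[of t] by (cases "t \<in> {0<..<T}") auto
    qed
  qed simp
  have I2: "set_integrable lborel {0<..<T} (\<lambda>t. sin (t * w) / T)"
    by (rule set_integrable_subset[of _ "{0..T}"])
       (use assms in \<open>auto intro!: borel_integrable_atLeastAtMost' continuous_intros\<close>)
  have e: "einterval 0 (ereal T) = {0<..<T}"
    by (auto simp: einterval_def)
  have L1: "(LBINT t:{0<..<T}. sin (t * w) / t) = sgn w * Si (T * \<bar>w\<bar>)"
    using LBINT_I0c_sin_scale_divide[of T w] assms
    by (simp add: interval_lebesgue_integral_def e)
  have L2: "(LBINT t:{0<..<T}. sin (t * w) / T) = (1 - cos (T * w)) / (T * w)"
  proof (cases "w = 0")
    case False
    have "(LBINT t=0..T. sin (t * w) / T) = - cos (T * w) / (T * w) - (- cos (0 * w) / (T * w))"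
      unfolding zero_ereal_def
      using assms False
      by (intro interval_integral_FTC_finite)
         (auto intro!: continuous_intros derivative_eq_intros simp flip: has_real_derivative_iff_has_vector_derivative)
    then have "(LBINT t:{0<..<T}. sin (t * w) / T) = - cos (T * w) / (T * w) - (- cos (0 * w) / (T * w))"
      unfolding interval_lebesgue_integral_def e using assms by (simp only: ereal_less_eq zero_ereal_def if_True less_imp_le)
    also have "\<dots> = (1 - cos (T * w)) / (T * w)"
      by (simp add: diff_divide_distrib)
    finally show ?thesis .
  qed (simp add: set_lebesgue_integral_def)
  have S: "sgn w * Si (T * \<bar>w\<bar>) = Si (T * w)"
    using Si_neg[of "T * \<bar>w\<bar>"] assms mult_nonneg_nonpos[of T w]
    by (cases "w \<ge> 0") (auto simp: sgn_if Si_def zero_ereal_def)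
  \<comment> \<open>The triangular weight splits the integral into \<open>L1\<close> and
    \<open>L2\<close>, which are exactly the two terms in the definition of
    \<open>fejer_cdf (T * w)\<close>.\<close>
  have eq: "(1 - t / T) * (sin (t * w) / t) = sin (t * w) / t - sin (t * w) / T" if "t \<in> {0<..<T}" for t
    using that assms by (simp add: field_simps)
  show "set_integrable lborel {0<..<T} (\<lambda>t. (1 - t / T) * (sin (t * w) / t))"
    by (rule set_integrable_cong[THEN iffD2, OF refl refl _ set_integral_diff(1)[OF I1 I2]]) (rule eq)
  have "(LBINT t:{0<..<T}. (1 - t / T) * (sin (t * w) / t))
    = (LBINT t:{0<..<T}. sin (t * w) / t - sin (t * w) / T)"
    by (rule set_lebesgue_integral_cong) (simp, intro allI impI, rule eq)
  also have "\<dots> = Si (T * w) - (1 - cos (T * w)) / (T * w)"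
    by (subst set_integral_diff(2)[OF I1 I2]) (simp only: L1 L2 S)
  finally show "(LBINT t:{0<..<T}. (1 - t / T) * (sin (t * w) / t)) = pi * fejer_cdf (T * w)"
    by (simp add: fejer_cdf_def)
qed

lemma one_minus_cos_ge: "x\<^sup>2 / 2 - x ^ 4 / 24 \<le> 1 - cos (x::real)"
proof -
  obtain t where "cos x = (\<Sum>m<4. cos_coeff m * x ^ m) + cos (t + 1/2 * real 4 * pi) / fact 4 * x ^ 4"
    using Maclaurin_cos_expansion[of x 4] by blast
  moreover have "cos (t + 1/2 * real 4 * pi) / fact 4 * x ^ 4 \<le> 1 / 24 * x ^ 4"
    by (intro mult_right_mono) (simp_all add: fact_numeral)
  moreover have "(\<Sum>m<4. cos_coeff m * x ^ m) = 1 - x\<^sup>2 / 2"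
    by (simp add: lessThan_nat_numeral cos_coeff_def power2_eq_square)
  ultimately show ?thesis by simp
qed

lemma integrable_fejer: "integrable lborel fejer"
  using fejer.integrable_const[of "1::real"] by (subst (asm) integrable_density) auto

text \<open>A mass above 1/2 in a bounded window is what allows the smoothing inequality to be
  solved for the supremum. The quartic bound on the cosine gives \<open>2.25 / pi\<close> for the
  window of radius 3.\<close>

lemma fejer_mass: "715/1000 \<le> measure fejer_measure {-3..3}"
proof -
  have "(LBINT u:{-3..3}. (1/2 - u\<^sup>2/24) / pi) \<le> (LBINT u:{-3..3}. fejer u)"
    unfolding set_lebesgue_integral_def
  proof (rule integral_mono_AE)
    have "set_integrable lborel {-3..3::real} (\<lambda>u. (1/2 - u\<^sup>2/24) / pi)"
      by (rule borel_integrable_atLeastAtMost') (auto intro!: continuous_intros)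
    then show "integrable lborel (\<lambda>u. indicator {-3..3::real} u *\<^sub>R ((1/2 - u\<^sup>2/24) / pi))"
      by (simp add: set_integrable_def)
    show "integrable lborel (\<lambda>u. indicator {-3..3::real} u *\<^sub>R fejer u)"
      by (rule integrable_mult_indicator) (auto simp: integrable_fejer)
    have "(1/2 - u\<^sup>2/24) / pi \<le> fejer u" if "u \<noteq> 0" for u
    proof -
      have "(1/2 - u\<^sup>2/24) * u\<^sup>2 \<le> 1 - cos u"
        using one_minus_cos_ge[of u] by (simp add: algebra_simps power2_eq_square power4_eq_xxxx)
      then have "1/2 - u\<^sup>2/24 \<le> (1 - cos u) / u\<^sup>2" using that
        by (subst pos_le_divide_eq) auto
      then have "(1/2 - u\<^sup>2/24) / pi \<le> (1 - cos u) / u\<^sup>2 / pi"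
        by (intro divide_right_mono) auto
      then show ?thesis
        by (simp only: fejer_def divide_divide_eq_left mult.commute)
    qed
    then show "AE u in lborel. indicator {-3..3::real} u *\<^sub>R ((1/2 - u\<^sup>2/24) / pi) \<le> indicator {-3..3} u *\<^sub>R fejer u"
      using AE_lborel_singleton[of 0] by (auto simp: indicator_def)
  qed
  also have "(LBINT u:{-3..3}. fejer u) = measure fejer_measure {-3..3}"
  proof -
    have "measure fejer_measure {-3..3} = (\<integral>u. indicator {-3..3} u \<partial>fejer_measure)"
      by simp
    also have "\<dots> = (LBINT u. fejer u *\<^sub>R indicator {-3..3} u)"
      by (subst integral_density) auto
    finally show ?thesis by (simp add: set_lebesgue_integral_def mult.commute)
  qed
  also have "(LBINT u:{-3..3}. (1/2 - u\<^sup>2/24) / pi) = (3/2 - 27/72) / pi - (-3/2 + 27/72) / pi"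
    unfolding set_lebesgue_integral_def
    by (subst integral_FTC_atLeastAtMost[where F = "\<lambda>u. (u/2 - u^3/72) / pi"])
       (auto intro!: continuous_intros derivative_eq_intros simp flip: has_real_derivative_iff_has_vector_derivative simp: power2_eq_square)
  also have "\<dots> = 2.25 / pi"
    by (simp add: field_simps)
  finally have "2.25 / pi \<le> measure fejer_measure {-3..3}" .
  moreover have "715/1000 \<le> 2.25 / pi"
    using pi_approx by (simp add: field_simps)
  ultimately show ?thesis by linarith
qed

section \<open>Smoothing inequality\<close>

lemma integral_fejer_uminus:
  assumes [measurable]: "f \<in> borel_measurable borel"
  shows "(\<integral>u. f (- u) \<partial>fejer_measure) = (\<integral>u. f u \<partial>fejer_measure :: real)"
proof -
  have "(\<integral>u. f u \<partial>fejer_measure) = (\<integral>u. f u \<partial>distr fejer_measure borel uminus)"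
    by (simp add: distr_fejer_uminus)
  then show ?thesis
    by (simp add: integral_distr)
qed

text \<open>Smoothing at a point \<open>3 / T\<close> to the right of \<open>x\<close> keeps the mass \<open>q\<close> of the kernel where the
  slope condition applies; the linear term integrates to zero by symmetry.\<close>

lemma smoothed_lower_bound:
  fixes D :: "real \<Rightarrow> real"
  defines "q \<equiv> measure fejer_measure {-3..3}"
  assumes [measurable]: "D \<in> borel_measurable borel"
    and bound: "\<And>x. \<bar>D x\<bar> \<le> \<eta>" and "T > 0"
    and slope: "\<And>x s. 0 \<le> s \<Longrightarrow> D x - m * s \<le> D (x + s)"
    and conv: "\<And>y. (\<integral>u. D (y - u / T) \<partial>fejer_measure) \<le> e"
  shows "q * D x \<le> e + 3 * m * q / T + \<eta> * (1 - q)"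
proof -
  define y where "y = x + 3 / T"
  let ?I = "indicator {-3..3::real} :: real \<Rightarrow> real"
  have int_I: "integrable fejer_measure ?I"
    by (rule integrable_real_indicator) (auto simp: fejer.emeasure_finite less_top[symmetric])
  have int_Iu: "integrable fejer_measure (\<lambda>u. ?I u * u)"
    by (rule fejer.integrable_const_bound[of _ 3]) (auto simp: indicator_def)
  have int_D: "integrable fejer_measure (\<lambda>u. D (y - u / T))"
    by (rule fejer.integrable_const_bound[of _ \<eta>]) (use bound in auto)
  have "(\<integral>u. ?I u * u \<partial>fejer_measure) = (\<integral>u. ?I (- u) * (- u) \<partial>fejer_measure)"
    by (subst integral_fejer_uminus[symmetric]) auto
  also have "(\<lambda>u. ?I (- u) * (- u)) = (\<lambda>u. - (?I u * u))"
    by (auto simp: indicator_def fun_eq_iff)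
  finally have zero: "(\<integral>u. ?I u * u \<partial>fejer_measure) = 0"
    by simp
  have "(D x - 3 * m / T) * q + m / T * 0 - \<eta> * (1 - q)
    = (\<integral>u. (D x - 3 * m / T) * ?I u + m / T * (?I u * u) - \<eta> * (1 - ?I u) \<partial>fejer_measure)"
    using int_I int_Iu zero fejer.prob_space by (simp add: q_def)
  also have "\<dots> \<le> (\<integral>u. D (y - u / T) \<partial>fejer_measure)"
  proof (rule integral_mono)
    show "integrable fejer_measure (\<lambda>u. (D x - 3 * m / T) * ?I u + m / T * (?I u * u) - \<eta> * (1 - ?I u))"
      using int_I int_Iu by (intro Bochner_Integration.integrable_diff Bochner_Integration.integrable_add integrable_mult_right) auto
    fix u
    show "(D x - 3 * m / T) * ?I u + m / T * (?I u * u) - \<eta> * (1 - ?I u) \<le> D (y - u / T)"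
    proof (cases "u \<in> {-3..3}")
      case True
      then have "D x - m * ((3 - u) / T) \<le> D (x + (3 - u) / T)"
        using \<open>T > 0\<close> by (intro slope) auto
      moreover have "x + (3 - u) / T = y - u / T" "m * ((3 - u) / T) = 3 * m / T - m / T * u"
        by (auto simp: y_def field_simps diff_divide_distrib)
      ultimately show ?thesis using True by simp
    next
      case False
      then show ?thesis using bound[of "y - u / T"] by (auto simp: abs_le_iff)
    qed
  qed (rule int_D)
  also have "\<dots> \<le> e" by (rule conv)
  finally show ?thesis by (simp add: algebra_simps)
qed

text \<open>Both sides are the probability of \<open>u + T * x \<le> T * y\<close> for independent
  \<open>u\<close> with the Fejer law and \<open>x\<close> with law \<open>M\<close>, integrated in
  the two possible orders.\<close>

lemma (in real_distribution) smoothed_cdf: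
  assumes T: "T > 0"
  shows "integrable fejer_measure (\<lambda>u. cdf M (y - u / T))"
    and "(\<integral>u. cdf M (y - u / T) \<partial>fejer_measure) = 1/2 + (\<integral>x. fejer_cdf (T * (y - x)) \<partial>M)"
    and "integrable M (\<lambda>x. fejer_cdf (T * (y - x)))"
proof -
  interpret P: pair_prob_space fejer_measure M ..
  have fm [measurable]: "cdf M \<in> borel_measurable borel"
    using cdf_nondecreasing by (intro borel_measurable_mono) (auto simp: mono_def)
  show "integrable fejer_measure (\<lambda>u. cdf M (y - u / T))"
    by (rule fejer.integrable_const_bound[of _ 1]) (auto simp: cdf_nonneg cdf_bounded_prob)
  have [measurable]: "fejer_cdf \<in> borel_measurable borel"
    unfolding fejer_cdf_def[abs_def] by measurable
  have fb: "\<bar>fejer_cdf w\<bar> \<le> 1" for w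
    using measure_fejer_atMost[of w] fejer.prob_le_1[of "{..w}"] measure_nonneg[of fejer_measure "{..w}"] by linarith
  show I: "integrable M (\<lambda>x. fejer_cdf (T * (y - x)))"
    by (rule integrable_const_bound[of _ 1]) (auto simp: fb)
  let ?f = "\<lambda>u x. if u + T * x \<le> T * y then 1 else 0 :: real"
  have int: "integrable (fejer_measure \<Otimes>\<^sub>M M) (case_prod ?f)"
    by (rule P.P.integrable_const_bound[of _ 1]) auto
  have "(\<integral>u. cdf M (y - u / T) \<partial>fejer_measure) = (\<integral>u. (\<integral>x. ?f u x \<partial>M) \<partial>fejer_measure)"
  proof (rule Bochner_Integration.integral_cong[OF refl])
    fix u
    have "?f u = indicator {.. y - u / T}"
      using T by (auto simp: indicator_def fun_eq_iff field_simps)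
    then show "cdf M (y - u / T) = (\<integral>x. ?f u x \<partial>M)"
      by (simp add: cdf_def)
  qed
  also have "\<dots> = (\<integral>x. (\<integral>u. ?f u x \<partial>fejer_measure) \<partial>M)"
    using P.Fubini_integral[OF int] by simp
  also have "\<dots> = (\<integral>x. 1/2 + fejer_cdf (T * (y - x)) \<partial>M)"
  proof (rule Bochner_Integration.integral_cong[OF refl])
    fix x
    have "(\<lambda>u. ?f u x) = indicator {.. T * (y - x)}"
      by (auto simp: indicator_def fun_eq_iff field_simps)
    then show "(\<integral>u. ?f u x \<partial>fejer_measure) = 1/2 + fejer_cdf (T * (y - x))"
      by (simp add: measure_fejer_atMost)
  qed
  also have "\<dots> = 1/2 + (\<integral>x. fejer_cdf (T * (y - x)) \<partial>M)"
    using I prob_space by simp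
  finally show "(\<integral>u. cdf M (y - u / T) \<partial>fejer_measure) = 1/2 + (\<integral>x. fejer_cdf (T * (y - x)) \<partial>M)" .
qed

text \<open>Fubini applied to the Fourier representation of \<open>fejer_cdf\<close>. The
  singularity \<open>1 / t\<close> is harmless because \<open>sin (t * (y - x)) / t\<close> is
  bounded by \<open>\<bar>y - x\<bar>\<close>; the first moment makes this dominating function
  integrable.\<close>

lemma (in real_distribution) expectation_fejer_cdf:
  assumes T: "T > 0" and int: "integrable M (\<lambda>x. x)"
  shows "integrable lborel (\<lambda>t. indicator {0<..<T} t * ((1 - t / T) / t * Im (iexp (- (t * y)) * char M t)))"
    and "(\<integral>x. fejer_cdf (T * (y - x)) \<partial>M) =
      - (\<integral>t. indicator {0<..<T} t * ((1 - t / T) / t * Im (iexp (- (t * y)) * char M t)) \<partial>lborel) / pi"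
proof -
  interpret P: pair_sigma_finite lborel M ..
  let ?f = "\<lambda>t x. indicator {0<..<T} t * ((1 - t / T) * (sin (t * (y - x)) / t))"
  have *: "\<bar>?f t x\<bar> \<le> indicator {0<..<T} t * \<bar>y - x\<bar>" for t x
  proof (cases "t \<in> {0<..<T}")
    case True
    have "\<bar>sin (t * (y - x))\<bar> \<le> t * \<bar>y - x\<bar>"
      using abs_sin_x_le_abs_x[of "t * (y - x)"] True by (simp add: abs_mult)
    then have "\<bar>sin (t * (y - x)) / t\<bar> \<le> \<bar>y - x\<bar>"
      using True by (simp add: pos_divide_le_eq mult.commute)
    then have "\<bar>1 - t / T\<bar> * \<bar>sin (t * (y - x)) / t\<bar> \<le> 1 * \<bar>y - x\<bar>"
      using True by (intro mult_mono) auto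
    with True show ?thesis by (simp add: abs_mult)
  qed auto
  have "integrable (lborel \<Otimes>\<^sub>M M) (\<lambda>(t, x). indicator {0<..<T} t * \<bar>y - x\<bar>)"
  proof (rule P.Fubini_integrable)
    show "integrable lborel (\<lambda>t. \<integral>x. norm (case (t, x) of (t, x) \<Rightarrow> indicator {0<..<T} t * \<bar>y - x\<bar>) \<partial>M)"
    proof -
      have "integrable lborel (\<lambda>t. indicator {0<..<T} t * (\<integral>x. \<bar>y - x\<bar> \<partial>M))"
        using T by (intro integrable_mult_left integrable_real_indicator) auto
      then show ?thesis by (simp add: abs_mult)
    qed
    show "AE t in lborel. integrable M (\<lambda>x. case (t, x) of (t, x) \<Rightarrow> indicator {0<..<T} t * \<bar>y - x\<bar>)"
      using int by auto
  qed simp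
  then have int2: "integrable (lborel \<Otimes>\<^sub>M M) (case_prod ?f)"
    by (rule Bochner_Integration.integrable_bound) (use * in \<open>auto intro!: AE_I2\<close>)
  have sin_char: "(\<integral>x. sin (t * (y - x)) \<partial>M) = - Im (iexp (- (t * y)) * char M t)" for t
  proof -
    have i: "integrable M (\<lambda>x. iexp (- (t * y)) * iexp (t * x))"
      by (intro integrable_mult_right integrable_iexp) auto
    have "iexp (- (t * y)) * char M t = (\<integral>x. iexp (- (t * y)) * iexp (t * x) \<partial>M)"
      by (simp add: char_def)
    also have "Im \<dots> = (\<integral>x. Im (iexp (- (t * y)) * iexp (t * x)) \<partial>M)"
      using integral_Im[OF i] by simp
    also have "(\<lambda>x. Im (iexp (- (t * y)) * iexp (t * x))) = (\<lambda>x. - sin (t * (y - x)))"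
      by (auto simp: fun_eq_iff Im_exp mult_exp_exp right_diff_distrib simp flip: sin_minus)
    finally show ?thesis by simp
  qed
  have inner: "(\<integral>x. ?f t x \<partial>M) = - (indicator {0<..<T} t * ((1 - t / T) / t * Im (iexp (- (t * y)) * char M t)))" for t
  proof -
    have "(\<integral>x. ?f t x \<partial>M) = (\<integral>x. indicator {0<..<T} t * ((1 - t / T) / t) * sin (t * (y - x)) \<partial>M)"
      by (intro Bochner_Integration.integral_cong) auto
    also have "\<dots> = indicator {0<..<T} t * ((1 - t / T) / t) * (\<integral>x. sin (t * (y - x)) \<partial>M)"
      by (rule integral_mult_right_zero)
    finally show ?thesis unfolding sin_char by (simp only: mult_minus_right mult.assoc)
  qed
  have "integrable lborel (\<lambda>t. \<integral>x. ?f t x \<partial>M)"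
    using P.integrable_fst[OF int2] by simp
  then show "integrable lborel (\<lambda>t. indicator {0<..<T} t * ((1 - t / T) / t * Im (iexp (- (t * y)) * char M t)))"
    unfolding inner by simp
  have "pi * (\<integral>x. fejer_cdf (T * (y - x)) \<partial>M) = (\<integral>x. pi * fejer_cdf (T * (y - x)) \<partial>M)"
    by simp
  also have "\<dots> = (\<integral>x. (\<integral>t. ?f t x \<partial>lborel) \<partial>M)"
    by (intro Bochner_Integration.integral_cong refl)
       (subst fejer_cdf_Fourier(2)[OF T, symmetric], simp add: set_lebesgue_integral_def)
  also have "\<dots> = (\<integral>t. (\<integral>x. ?f t x \<partial>M) \<partial>lborel)"
    using P.Fubini_integral[OF int2] by simp
  finally have "pi * (\<integral>x. fejer_cdf (T * (y - x)) \<partial>M) =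
      - (\<integral>t. indicator {0<..<T} t * ((1 - t / T) / t * Im (iexp (- (t * y)) * char M t)) \<partial>lborel)"
    unfolding inner by (simp only: integral_minus)
  moreover have "a = - c / pi" if "pi * a = - c" for a c
    using that by (simp add: field_simps)
  ultimately show "(\<integral>x. fejer_cdf (T * (y - x)) \<partial>M) =
      - (\<integral>t. indicator {0<..<T} t * ((1 - t / T) / t * Im (iexp (- (t * y)) * char M t)) \<partial>lborel) / pi"
    by blast
qed

text \<open>The constants 1/2 cancel. The factor \<open>t\<close> in the hypothesis on the
  characteristic functions is there to cancel the weight \<open>1 / t\<close>, and
  \<open>1 - t / T\<close> is bounded by 1.\<close>

lemma smoothed_cdf_diff:
  assumes M: "real_distribution M" "integrable M (\<lambda>x. x)"
    and N: "real_distribution N" "integrable N (\<lambda>x. x)"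
    and T: "T > 0"
    and b: "set_integrable lborel {0<..<T} b"
      "\<And>t. 0 < t \<Longrightarrow> t < T \<Longrightarrow> norm (char M t - char N t) \<le> t * b t"
  shows "\<bar>\<integral>u. cdf M (y - u / T) - cdf N (y - u / T) \<partial>fejer_measure\<bar> \<le> (LBINT t:{0<..<T}. b t) / pi"
proof -
  interpret M: real_distribution M by fact
  interpret N: real_distribution N by fact
  let ?g = "\<lambda>M t. indicator {0<..<T} t * ((1 - t / T) / t * Im (iexp (- (t * y)) * char M t))"
  have le: "\<bar>?g M t - ?g N t\<bar> \<le> indicator {0<..<T} t * b t" for t
  proof (cases "t \<in> {0<..<T}")
    case True
    have "\<bar>Im (iexp (- (t * y)) * char M t) - Im (iexp (- (t * y)) * char N t)\<bar>
      = \<bar>Im (iexp (- (t * y)) * (char M t - char N t))\<bar>"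
      by (simp add: algebra_simps)
    also have "\<dots> \<le> norm (iexp (- (t * y)) * (char M t - char N t))"
      by (rule abs_Im_le_cmod)
    also have "\<dots> = norm (char M t - char N t)"
      by (simp add: norm_mult)
    also have "\<dots> \<le> t * b t" using b(2) True by auto
    finally have *: "\<bar>Im (iexp (- (t * y)) * char M t) - Im (iexp (- (t * y)) * char N t)\<bar> / t \<le> b t"
      using True by (simp add: field_simps)
    have "\<bar>(1 - t / T) / t * a - (1 - t / T) / t * c\<bar> = (1 - t / T) * (\<bar>a - c\<bar> / t)" for a c
    proof -
      have "(1 - t / T) / t * a - (1 - t / T) / t * c = (1 - t / T) / t * (a - c)"
        by (simp only: right_diff_distrib)
      then show ?thesis using True by (simp add: abs_mult)
    qed
    then have "\<bar>?g M t - ?g N t\<bar> = (1 - t / T) * (\<bar>Im (iexp (- (t * y)) * char M t) - Im (iexp (- (t * y)) * char N t)\<bar> / t)"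
      using True by simp
    also have "\<dots> \<le> 1 * (\<bar>Im (iexp (- (t * y)) * char M t) - Im (iexp (- (t * y)) * char N t)\<bar> / t)"
      using True by (intro mult_right_mono) auto
    finally show ?thesis using * True by simp
  qed auto
  have "(\<integral>u. cdf M (y - u / T) - cdf N (y - u / T) \<partial>fejer_measure)
     = (1/2 + - (\<integral>t. ?g M t \<partial>lborel) / pi) - (1/2 + - (\<integral>t. ?g N t \<partial>lborel) / pi)"
    by (simp only: Bochner_Integration.integral_diff M.smoothed_cdf[OF T] N.smoothed_cdf[OF T]
      M.expectation_fejer_cdf(2)[OF T M(2)] N.expectation_fejer_cdf(2)[OF T N(2)])
  also have "\<dots> = - ((\<integral>t. ?g M t \<partial>lborel) - (\<integral>t. ?g N t \<partial>lborel)) / pi"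
    by (simp add: diff_divide_distrib)
  also have "(\<integral>t. ?g M t \<partial>lborel) - (\<integral>t. ?g N t \<partial>lborel) = (\<integral>t. ?g M t - ?g N t \<partial>lborel)"
    by (rule Bochner_Integration.integral_diff[symmetric])
      (rule M.expectation_fejer_cdf(1)[OF T M(2)] N.expectation_fejer_cdf(1)[OF T N(2)])+
  finally have "\<bar>\<integral>u. cdf M (y - u / T) - cdf N (y - u / T) \<partial>fejer_measure\<bar>
    = \<bar>\<integral>t. ?g M t - ?g N t \<partial>lborel\<bar> / pi"
    by (simp only: abs_divide abs_minus abs_of_pos[OF pi_gt_zero])
  also have "\<dots> \<le> (\<integral>t. \<bar>?g M t - ?g N t\<bar> \<partial>lborel) / pi"
    by (intro divide_right_mono integral_abs_bound) auto
  also have "\<dots> \<le> (LBINT t:{0<..<T}. b t) / pi"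
    unfolding set_lebesgue_integral_def
    using M.expectation_fejer_cdf(1)[OF T M(2)] N.expectation_fejer_cdf(1)[OF T N(2)] b(1) le
    by (intro divide_right_mono integral_mono) (auto simp: set_integrable_def)
  finally show ?thesis .
qed

text \<open>For the supremum \<open>\<eta>\<close> of the difference, smoothing yields
  \<open>q * \<eta> \<le> e + 3 * m * q / T + \<eta> * (1 - q)\<close>, which can be solved since
  \<open>q > 1/2\<close>. The constant 43/100 is \<open>2 * q - 1\<close> at the guaranteed mass
  \<open>q = 715/1000\<close>.\<close>

theorem Esseen_smoothing:
  assumes M: "real_distribution M" "integrable M (\<lambda>x. x)"
    and N: "real_distribution N" "integrable N (\<lambda>x. x)"
    and lip: "\<And>x s. 0 \<le> s \<Longrightarrow> cdf N (x + s) - cdf N x \<le> m * s" and m: "m \<ge> 0"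
    and T: "T > 0"
    and b: "set_integrable lborel {0<..<T} b"
      "\<And>t. 0 < t \<Longrightarrow> t < T \<Longrightarrow> norm (char M t - char N t) \<le> t * b t"
  shows "\<bar>cdf M x - cdf N x\<bar> \<le> ((LBINT t:{0<..<T}. b t) / pi + 3 * m / T * (715/1000)) / (43/100)"
proof -
  interpret M: real_distribution M by fact
  interpret N: real_distribution N by fact
  define q where "q = measure fejer_measure {-3..3}"
  define D where "D x = cdf M x - cdf N x" for x
  define e where "e = (LBINT t:{0<..<T}. b t) / pi"
  have [measurable]: "cdf M \<in> borel_measurable borel" "cdf N \<in> borel_measurable borel"
    using M.cdf_nondecreasing N.cdf_nondecreasing by (auto intro!: borel_measurable_mono simp: mono_def)
  then have D [measurable]: "D \<in> borel_measurable borel"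
    unfolding D_def[abs_def] by measurable
  have conv: "\<bar>\<integral>u. D (y - u / T) \<partial>fejer_measure\<bar> \<le> e" for y
    unfolding D_def e_def by (rule smoothed_cdf_diff[OF M N T b])
  have q: "715/1000 \<le> q" "q \<le> 1"
    using fejer_mass by (auto simp: q_def)
  have "\<bar>D x\<bar> \<le> 1" for x
    using M.cdf_nonneg[of x] M.cdf_bounded_prob[of x] N.cdf_nonneg[of x] N.cdf_bounded_prob[of x]
    unfolding D_def by linarith
  then have bdd: "bdd_above (range (\<lambda>x. \<bar>D x\<bar>))" by (auto intro!: bdd_aboveI)
  define \<eta> where "\<eta> = (SUP x. \<bar>D x\<bar>)"
  have \<eta>: "\<bar>D x\<bar> \<le> \<eta>" for x
    unfolding \<eta>_def by (rule cSUP_upper[OF UNIV_I bdd])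
  have slope: "D x - m * s \<le> D (x + s)" if "0 \<le> s" for x s
    using lip[OF that, of x] M.cdf_nondecreasing[of x "x + s"] that by (simp add: D_def)
  have up: "q * D x \<le> e + 3 * m * q / T + \<eta> * (1 - q)" for x
    unfolding q_def
    by (rule smoothed_lower_bound[OF D \<eta> T slope]) (use conv in \<open>auto simp: abs_le_iff\<close>)
  \<comment> \<open>The reflection \<open>- D (- x)\<close> satisfies the same one-sided slope
    condition, and symmetry of the kernel turns its smoothing into that of \<open>D\<close>; this
    handles negative values of \<open>D\<close>.\<close>
  have low: "q * (- D (- x)) \<le> e + 3 * m * q / T + \<eta> * (1 - q)" for x
    unfolding q_def
  proof (rule smoothed_lower_bound[where D = "\<lambda>x. - D (- x)"])
    fix x s :: real assume "0 \<le> s"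
    then show "- D (- x) - m * s \<le> - D (- (x + s))"
      using slope[of s "-x - s"] by simp
  next
    fix y
    have "(\<integral>u. - D (- (y - u / T)) \<partial>fejer_measure) = - (\<integral>u. D (- y - (- u) / T) \<partial>fejer_measure)"
      by simp
    also have "(\<integral>u. D (- y - (- u) / T) \<partial>fejer_measure) = (\<integral>u. D (- y - u / T) \<partial>fejer_measure)"
      by (rule integral_fejer_uminus) measurable
    finally show "(\<integral>u. - D (- (y - u / T)) \<partial>fejer_measure) \<le> e"
      using conv[of "- y"] by (simp add: abs_le_iff)
  qed (use \<eta> T in auto)
  have "q * \<bar>D x\<bar> \<le> e + 3 * m * q / T + \<eta> * (1 - q)" for x
    using up[of x] low[of "-x"] q by (simp add: abs_if)
  then have "\<bar>D x\<bar> \<le> (e + 3 * m * q / T + \<eta> * (1 - q)) / q" for x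
    using q by (simp add: field_simps)
  then have "\<eta> \<le> (e + 3 * m * q / T + \<eta> * (1 - q)) / q"
    unfolding \<eta>_def by (intro cSUP_least) auto
  then have 1: "\<eta> * (2 * q - 1) \<le> e + 3 * m * q / T"
    using q by (simp add: field_simps)
  have e0: "0 \<le> e" using conv[of 0] by linarith
  \<comment> \<open>The quotient \<open>q / (2 * q - 1)\<close> decreases for
    \<open>q > 1/2\<close>, so it may be replaced by its value at 715/1000; the chain below is this
    comparison with the denominators cleared.\<close>
  have "\<eta> * (2 * q - 1) * (43/100) \<le> (e + 3 * m / T * q) * (43/100)"
    using 1 by simp
  also have "\<dots> = e * (43/100) + 3 * m / T * (q * (43/100))"
    by (simp add: algebra_simps)
  also have "\<dots> \<le> e * (2 * q - 1) + 3 * m / T * (715/1000 * (2 * q - 1))"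
    using q e0 m T by (intro add_mono mult_left_mono) auto
  also have "\<dots> = (2 * q - 1) * (e + 3 * m / T * (715/1000))"
    by (simp only: distrib_left mult_ac)
  finally have "(2 * q - 1) * (\<eta> * (43/100)) \<le> (2 * q - 1) * (e + 3 * m / T * (715/1000))"
    by (simp only: mult_ac)
  then have "\<eta> * (43/100) \<le> e + 3 * m / T * (715/1000)"
    by (rule mult_left_le_imp_le) (use q in linarith)
  then have "\<bar>D x\<bar> * (43/100) \<le> e + 3 * m / T * (715/1000)"
    using \<eta>[of x] by linarith
  then show ?thesis unfolding D_def e_def by (subst pos_le_divide_eq) simp_all
qed

section \<open>A Berry-Esseen bound for small summands\<close>

text \<open>Telescoping, one factor exchanged at a time. Each term keeps the bounds \<open>c\<close>
  of all other factors, so the decay of the whole product survives up to one missing factor.\<close>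

lemma norm_prod_diff_weighted:
  fixes z w :: "'i \<Rightarrow> 'a::{real_normed_field}" and c :: "'i \<Rightarrow> real"
  assumes "finite I" "\<And>i. i \<in> I \<Longrightarrow> norm (z i) \<le> c i" "\<And>i. i \<in> I \<Longrightarrow> norm (w i) \<le> c i"
    "\<And>i. i \<in> I \<Longrightarrow> 0 < c i"
  shows "norm (prod z I - prod w I) \<le> prod c I * (\<Sum>i\<in>I. norm (z i - w i) / c i)"
  using assms
proof (induction I rule: finite_induct)
  case (insert j I)
  have nz: "norm (prod z I) \<le> prod c I"
    unfolding prod_norm[symmetric] using insert.prems by (intro prod_mono) auto
  have c0: "0 \<le> prod c I" "0 < c j"
    using insert.prems by (auto intro!: prod_nonneg simp: less_imp_le)
  have "prod z (insert j I) - prod w (insert j I) = (z j - w j) * prod z I + w j * (prod z I - prod w I)"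
    using insert.hyps by (simp add: algebra_simps)
  also have "norm \<dots> \<le> norm (z j - w j) * norm (prod z I) + norm (w j) * norm (prod z I - prod w I)"
    by (rule norm_triangle_le) (simp add: norm_mult)
  also have "\<dots> \<le> norm (z j - w j) * prod c I + c j * (prod c I * (\<Sum>i\<in>I. norm (z i - w i) / c i))"
    using insert nz c0 by (intro add_mono mult_mono) (auto intro: less_imp_le)
  also have "\<dots> = prod c (insert j I) * (\<Sum>i\<in>insert j I. norm (z i - w i) / c i)"
    using insert.hyps c0 by (simp add: field_simps)
  finally show ?case .
qed simp

lemma exp_minus_approx:
  fixes u :: real assumes "0 \<le> u" shows "\<bar>exp (- u) - (1 - u)\<bar> \<le> u\<^sup>2 / 2"
proof -
  \<comment> \<open>The product in the next line equals \<open>1 + u ^ 4 / 4\<close>; its second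
    factor is at most \<open>exp u\<close>.\<close>
  have "0 \<le> u * (u * (u * u))" using assms by simp
  then have "1 \<le> (1 - u + u\<^sup>2/2) * (1 + u + u\<^sup>2/2)"
    by (simp add: algebra_simps power2_eq_square)
  also have "\<dots> \<le> (1 - u + u\<^sup>2/2) * exp u"
    using exp_lower_Taylor_quadratic[OF assms] sum_power2_ge_zero[of "1 - u" 1]
    by (intro mult_left_mono) (auto simp: power2_diff)
  finally have "exp (- u) \<le> 1 - u + u\<^sup>2/2"
    by (simp add: exp_minus field_simps)
  moreover have "1 - u \<le> exp (- u)"
    using exp_ge_add_one_self[of "- u"] by simp
  ultimately show ?thesis by auto
qed

text \<open>The fourth moment replaces the usual third absolute moment because it is even and hence
  accessible from Bernstein's condition; \<open>third\<close> and \<open>v_le\<close> recover what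
  the characteristic function estimates use.\<close>

locale small_summand = real_distribution +
  fixes v d :: real
  assumes int4: "integrable M (\<lambda>x. x ^ 4)" and mean: "(\<integral>x. x \<partial>M) = 0"
    and var: "(\<integral>x. x\<^sup>2 \<partial>M) = v" and fourth: "(\<integral>x. x ^ 4 \<partial>M) \<le> d\<^sup>2 * v" and d_pos: "0 < d"
begin

lemma int1: "integrable M (\<lambda>x. x)" and int2: "integrable M (\<lambda>x. x\<^sup>2)" and int3: "integrable M (\<lambda>x. \<bar>x\<bar> ^ 3)"
proof -
  have "\<bar>x\<bar> ^ k \<le> 1 + x ^ 4" if "k \<le> 4" for x :: real and k
  proof (cases "\<bar>x\<bar> \<le> 1")
    case True then show ?thesis using power_le_one[of "\<bar>x\<bar>" k] by (simp add: add_increasing2)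
  next
    case False then show ?thesis using power_increasing[OF that, of "\<bar>x\<bar>"] by (simp add: power_even_abs_numeral)
  qed
  then have "integrable M (\<lambda>x. \<bar>x\<bar> ^ k)" if "k \<le> 4" for k
    using that int4 by (intro Bochner_Integration.integrable_bound[of M "\<lambda>x. 1 + x ^ 4" "\<lambda>x. \<bar>x\<bar> ^ k"]) auto
  from this[of 1] this[of 2] this[of 3]
  show "integrable M (\<lambda>x. x)" "integrable M (\<lambda>x. x\<^sup>2)" "integrable M (\<lambda>x. \<bar>x\<bar> ^ 3)"
    by (auto simp: integrable_abs_iff)
qed

text \<open>Cauchy-Schwarz between the second and fourth moments, in the pointwise form
  \<open>2 * d * \<bar>x\<bar> ^ 3 \<le> d^2 * x^2 + x ^ 4\<close>.\<close>

lemma third: "(\<integral>x. \<bar>x\<bar> ^ 3 \<partial>M) \<le> d * v"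
proof -
  have pt: "\<bar>x\<bar> ^ 3 \<le> (d / 2) * x\<^sup>2 + (1 / (2 * d)) * x ^ 4" for x
  proof -
    have "0 \<le> x\<^sup>2 * (d - \<bar>x\<bar>)\<^sup>2 / (2 * d)" using d_pos by simp
    also have "\<dots> = (d / 2) * x\<^sup>2 + (1 / (2 * d)) * x ^ 4 - \<bar>x\<bar> ^ 3"
      using d_pos by (simp add: field_simps power2_eq_square power4_eq_xxxx power3_eq_cube abs_if)
    finally show ?thesis by simp
  qed
  have "(\<integral>x. \<bar>x\<bar> ^ 3 \<partial>M) \<le> (\<integral>x. (d / 2) * x\<^sup>2 + (1 / (2 * d)) * x ^ 4 \<partial>M)"
    using int2 int3 int4 pt by (intro integral_mono) auto
  also have "\<dots> = (d / 2) * v + (1 / (2 * d)) * (\<integral>x. x ^ 4 \<partial>M)"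
    using int2 int4 var by simp
  also have "\<dots> \<le> (d / 2) * v + (1 / (2 * d)) * (d\<^sup>2 * v)"
    using fourth d_pos by (intro add_left_mono mult_left_mono) auto
  also have "\<dots> = d * v"
    using d_pos by (simp add: field_simps power2_eq_square)
  finally show ?thesis .
qed

lemma v_nonneg: "0 \<le> v"
  unfolding var[symmetric] by simp

text \<open>The variance of \<open>x^2\<close> is nonnegative, so \<open>v^2\<close> is at most the
  fourth moment.\<close>

lemma v_le: "v \<le> d\<^sup>2"
proof -
  have "0 \<le> (\<integral>x. (x\<^sup>2 - v)\<^sup>2 \<partial>M)" by simp
  also have "(\<lambda>x. (x\<^sup>2 - v)\<^sup>2) = (\<lambda>x. x ^ 4 - 2 * v * x\<^sup>2 + v\<^sup>2)"
    by (simp add: fun_eq_iff power2_eq_square power4_eq_xxxx algebra_simps)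
  also have "(\<integral>x. x ^ 4 - 2 * v * x\<^sup>2 + v\<^sup>2 \<partial>M) = (\<integral>x. x ^ 4 \<partial>M) - v\<^sup>2"
    using int2 int4 var prob_space by (simp add: power2_eq_square)
  finally have "v * v \<le> d\<^sup>2 * v" using fourth by (simp add: power2_eq_square)
  then show ?thesis using v_nonneg by (cases "v = 0") auto
qed

lemma char_quadratic_approx: 
  assumes "0 \<le> t" shows "norm (char M t - (1 - t\<^sup>2 * v / 2)) \<le> d * v * t ^ 3 / 6"
proof -
  have "norm (char M t - (1 - t\<^sup>2 * v / 2)) \<le> (t\<^sup>2 / 6) * expectation (\<lambda>x. min (6 * x\<^sup>2) (\<bar>t\<bar> * \<bar>x\<bar> ^ 3))"
    using int1 int2 mean var by (intro char_approx3) auto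
  also have "\<dots> \<le> (t\<^sup>2 / 6) * expectation (\<lambda>x. \<bar>t\<bar> * \<bar>x\<bar> ^ 3)"
    using int2 int3 by (intro mult_left_mono integral_mono) auto
  also have "\<dots> \<le> (t\<^sup>2 / 6) * (t * (d * v))"
    using third assms by (auto intro!: mult_left_mono)
  finally show ?thesis by (simp add: power2_eq_square power3_eq_cube field_simps)
qed

lemma norm_char_le:
  assumes "0 \<le> t" "t * d \<le> 1" shows "norm (char M t) \<le> exp (- (v * (t\<^sup>2 / 2 - d * t ^ 3 / 6)))"
proof -
  \<comment> \<open>Since \<open>v \<le> d^2\<close> and \<open>t * d \<le> 1\<close>, the number
    \<open>1 - t^2 * v / 2\<close> is nonnegative and equals its own norm.\<close>
  have "t\<^sup>2 * v \<le> t\<^sup>2 * d\<^sup>2" using v_le by (intro mult_left_mono) auto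
  also have "\<dots> = (t * d)\<^sup>2" by (simp add: power_mult_distrib)
  also have "\<dots> \<le> 1" using assms d_pos by (intro power_le_one) auto
  finally have "norm (complex_of_real (1 - t\<^sup>2 * v / 2)) = 1 - t\<^sup>2 * v / 2"
    by (simp only: norm_of_real)
  then have "norm (char M t) \<le> d * v * t ^ 3 / 6 + (1 - t\<^sup>2 * v / 2)"
    using char_quadratic_approx[OF assms(1)] norm_triangle_sub[of "char M t" "complex_of_real (1 - t\<^sup>2 * v / 2)"] by simp
  also have "\<dots> = 1 + - (v * (t\<^sup>2 / 2 - d * t ^ 3 / 6))"
    by (simp add: algebra_simps)
  also have "\<dots> \<le> exp (- (v * (t\<^sup>2 / 2 - d * t ^ 3 / 6)))"
    by (rule exp_ge_add_one_self)
  finally show ?thesis .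
qed

lemma char_diff_normal:
  assumes "0 \<le> t"
  shows "norm (char M t - exp (- (v * t\<^sup>2 / 2))) \<le> v * (d * t ^ 3 / 6 + d\<^sup>2 * t ^ 4 / 8)"
proof -
  have "norm (char M t - complex_of_real (exp (- (v * t\<^sup>2 / 2)))) \<le>
      norm (char M t - (1 - t\<^sup>2 * v / 2)) + norm (complex_of_real (1 - t\<^sup>2 * v / 2) - complex_of_real (exp (- (v * t\<^sup>2 / 2))))"
    by (rule order_trans[OF _ norm_triangle_ineq]) simp
  also have "\<dots> \<le> d * v * t ^ 3 / 6 + (v * t\<^sup>2 / 2)\<^sup>2 / 2"
    using exp_minus_approx[of "v * t\<^sup>2 / 2"] v_nonneg char_quadratic_approx[OF assms]
    by (intro add_mono) (simp_all only: norm_of_real of_real_diff[symmetric], simp_all add: abs_minus_commute mult.commute)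
  also have "(v * t\<^sup>2 / 2)\<^sup>2 / 2 = v * (v * t ^ 4 / 8)"
    by (simp add: power2_eq_square power4_eq_xxxx)
  also have "\<dots> \<le> v * (d\<^sup>2 * t ^ 4 / 8)"
    using v_le v_nonneg by (intro mult_left_mono divide_right_mono mult_right_mono) auto
  finally show ?thesis by (simp add: algebra_simps exp_of_real)
qed

end

section \<open>Gaussian half-line moments and the slope of the normal distribution function\<close>

lemma has_bochner_integral_scaled_gaussian_moments:
  fixes c :: real assumes "c > 0"
  shows "has_bochner_integral lborel (\<lambda>t. indicator {0..} t *\<^sub>R (exp (- (c * t)\<^sup>2) * t\<^sup>2)) (sqrt pi / 4 / c ^ 3)"
    and "has_bochner_integral lborel (\<lambda>t. indicator {0..} t *\<^sub>R (exp (- (c * t)\<^sup>2) * t ^ 3)) (1 / 2 / c ^ 4)"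
proof -
  have mult: "has_bochner_integral lborel f y \<Longrightarrow> has_bochner_integral lborel (\<lambda>x. f x * k) (y * k)"
    for f :: "real \<Rightarrow> real" and y k by (rule has_bochner_integral_mult_left)
  have I: "indicator {0..} (c * t) = (indicator {0..} t :: real)" for t
    using assms by (auto simp: indicator_def zero_le_mult_iff)
  have A: "has_bochner_integral lborel (\<lambda>t. indicator {0..} (0 + c * t) *\<^sub>R (exp (- (0 + c * t)\<^sup>2) * (0 + c * t) ^ (2 * 1))) ((sqrt pi / 2 * (fact (2 * 1) / (2 ^ (2 * 1) * fact 1))) /\<^sub>R \<bar>c\<bar>)"
    using assms by (subst lborel_has_bochner_integral_real_affine_iff[symmetric]) (auto intro!: gaussian_moment_even_pos[of 1, simplified])
  have B: "indicator {0..} (0 + c * t) *\<^sub>R (exp (- (0 + c * t)\<^sup>2) * (0 + c * t) ^ (2 * 1)) * (1 / c\<^sup>2)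
    = indicator {0..} t *\<^sub>R (exp (- (c * t)\<^sup>2) * t\<^sup>2)" for t
    using assms by (simp only: add_0_left I) (simp add: power_mult_distrib)
  have C: "((sqrt pi / 2 * (fact (2 * 1) / (2 ^ (2 * 1) * fact 1))) /\<^sub>R \<bar>c\<bar>) * (1 / c\<^sup>2) = sqrt pi / 4 / c ^ 3"
    using assms by (simp add: power2_eq_square power3_eq_cube field_simps)
  from mult[OF A, of "1 / c\<^sup>2"] show "has_bochner_integral lborel (\<lambda>t. indicator {0..} t *\<^sub>R (exp (- (c * t)\<^sup>2) * t\<^sup>2)) (sqrt pi / 4 / c ^ 3)"
    unfolding B C .
  have A: "has_bochner_integral lborel (\<lambda>t. indicator {0..} (0 + c * t) *\<^sub>R (exp (- (0 + c * t)\<^sup>2) * (0 + c * t) ^ (2 * 1 + 1))) ((fact 1 / 2) /\<^sub>R \<bar>c\<bar>)"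
    using assms by (subst lborel_has_bochner_integral_real_affine_iff[symmetric]) (auto intro!: gaussian_moment_odd_pos[of 1, simplified])
  have B: "indicator {0..} (0 + c * t) *\<^sub>R (exp (- (0 + c * t)\<^sup>2) * (0 + c * t) ^ (2 * 1 + 1)) * (1 / c ^ 3)
    = indicator {0..} t *\<^sub>R (exp (- (c * t)\<^sup>2) * t ^ 3)" for t
    using assms by (simp only: add_0_left I) (simp add: power_mult_distrib power3_eq_cube)
  have C: "((fact 1 / 2) /\<^sub>R \<bar>c\<bar>) * (1 / c ^ 3) = 1 / 2 / c ^ 4"
    using assms by (simp add: power4_eq_xxxx power3_eq_cube field_simps)
  from mult[OF A, of "1 / c ^ 3"] show "has_bochner_integral lborel (\<lambda>t. indicator {0..} t *\<^sub>R (exp (- (c * t)\<^sup>2) * t ^ 3)) (1 / 2 / c ^ 4)"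
    unfolding B C .
qed

lemma std_normal_density_le: "std_normal_density x \<le> 399/1000"
proof -
  have "1000/399 \<le> sqrt (2 * pi)"
    using pi_approx by (intro real_le_rsqrt) (simp add: power2_eq_square)
  then have "1 / sqrt (2 * pi) \<le> 399/1000"
    by (simp add: field_simps)
  moreover have "exp (- x\<^sup>2 / 2) \<le> 1" by simp
  ultimately have "1 / sqrt (2 * pi) * exp (- x\<^sup>2 / 2) \<le> 399/1000 * 1"
    by (intro mult_mono) auto
  then show ?thesis by (simp add: std_normal_density_def)
qed

lemma cdf_std_normal_lipschitz:
  assumes "0 \<le> s"
  shows "cdf std_normal_distribution (x + s) - cdf std_normal_distribution x \<le> 399/1000 * s"
proof -
  interpret real_distribution std_normal_distribution by (rule real_dist_normal_dist)
  have "emeasure std_normal_distribution {x<..x+s} = (\<integral>\<^sup>+ y. ennreal (std_normal_density y) * indicator {x<..x+s} y \<partial>lborel)"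
    by (simp add: emeasure_density)
  also have "\<dots> \<le> (\<integral>\<^sup>+ y. ennreal (399/1000) * indicator {x<..x+s} y \<partial>lborel)"
    using std_normal_density_le by (intro nn_integral_mono mult_right_mono ennreal_leI) auto
  also have "\<dots> = ennreal (399/1000 * s)"
    using assms by (subst nn_integral_cmult_indicator) (simp_all only: sets_lborel borel_measurable_indicator, simp_all add: ennreal_mult[symmetric])
  finally have "prob {x<..x+s} \<le> 399/1000 * s"
    using assms by (simp add: emeasure_eq_measure)
  moreover have "cdf std_normal_distribution (x + s) - cdf std_normal_distribution x = prob {x<..x+s}"
    using assms cdf_diff_eq[of x "x + s"] by (cases "s = 0") auto
  ultimately show ?thesis by simp
qed

text \<open>Smoothing with cutoff \<open>T = 1 / d\<close>, the range in which every factor has the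
  Gaussian bound of \<open>norm_char_le\<close>. The assumption \<open>d \<le> 1/6\<close> keeps the
  loss from the one missing factor of the telescoping small.\<close>

theorem Berry_Esseen_small_summands:
  assumes M: "real_distribution M" "integrable M (\<lambda>x. x)"
    and I: "finite I" "\<And>j. j \<in> I \<Longrightarrow> small_summand (N j) (v j) d"
    and char: "\<And>t. char M t = (\<Prod>j\<in>I. char (N j) t)"
    and v: "(\<Sum>j\<in>I. v j) = 1" and d: "0 < d" "d \<le> 1/6"
  shows "\<bar>cdf M x - cdf std_normal_distribution x\<bar> \<le> 12/5 * d"
proof -
  \<comment> \<open>The rate 56/100 satisfies \<open>0.56^2 \<le> (35/36) / 3\<close>: the factor
    1/3 is from \<open>h \<ge> t^2 / 3\<close>, and 35/36 bounds \<open>1 - d^2\<close> from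
    below.\<close>
  define b where "b t = (d * t\<^sup>2 / 6 + d\<^sup>2 * t ^ 3 / 8) * exp (- (56/100 * t)\<^sup>2)" for t :: real
  have diff: "norm (char M t - char std_normal_distribution t) \<le> t * b t" if t: "0 < t" "t < 1 / d" for t
  proof -
    define h where "h = t\<^sup>2 / 2 - d * t ^ 3 / 6"
    have td: "t * d \<le> 1" using t d by (simp add: field_simps)
    have "d * t ^ 3 = (t * d) * t\<^sup>2" by (simp add: power2_eq_square power3_eq_cube)
    also have "\<dots> \<le> 1 * t\<^sup>2" using td by (intro mult_right_mono) auto
    finally have h: "t\<^sup>2 / 3 \<le> h" by (simp add: h_def)
    then have h0: "0 \<le> h" by (rule order_trans[rotated]) simp
    have v0: "0 \<le> v j" "v j \<le> d\<^sup>2" if "j \<in> I" for j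
      using small_summand.v_nonneg[OF I(2)[OF that]] small_summand.v_le[OF I(2)[OF that]] by auto
    define K where "K = d * t ^ 3 / 6 + d\<^sup>2 * t ^ 4 / 8"
    have K: "0 \<le> K" using t d by (simp add: K_def)
    have "complex_of_real (exp (- (t\<^sup>2) / 2)) = (\<Prod>j\<in>I. complex_of_real (exp (- (v j * t\<^sup>2 / 2))))"
    proof -
      have "(\<Prod>j\<in>I. exp (- (v j * t\<^sup>2 / 2))) = exp (\<Sum>j\<in>I. - (v j * t\<^sup>2 / 2))"
        using I(1) by (rule exp_sum[symmetric])
      also have "(\<Sum>j\<in>I. - (v j * t\<^sup>2 / 2)) = - (t\<^sup>2) / 2"
        using v by (simp add: sum_negf flip: sum_distrib_right sum_divide_distrib)
      finally show ?thesis by (simp flip: of_real_prod)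
    qed
    then have "norm (char M t - char std_normal_distribution t)
      = norm ((\<Prod>j\<in>I. char (N j) t) - (\<Prod>j\<in>I. complex_of_real (exp (- (v j * t\<^sup>2 / 2)))))"
      by (simp only: char char_std_normal_distribution)
    also have "\<dots> \<le> (\<Prod>j\<in>I. exp (- (v j * h))) *
        (\<Sum>j\<in>I. norm (char (N j) t - complex_of_real (exp (- (v j * t\<^sup>2 / 2)))) / exp (- (v j * h)))"
    proof (rule norm_prod_diff_weighted[OF I(1)])
      fix j assume j: "j \<in> I"
      interpret small_summand "N j" "v j" d by (rule I(2)[OF j])
      show "norm (char (N j) t) \<le> exp (- (v j * h))"
        unfolding h_def using t td by (intro norm_char_le) auto
      have "v j * h \<le> v j * (t\<^sup>2 / 2)" 
        unfolding h_def using v0[OF j] t d by (intro mult_left_mono) auto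
      then show "norm (complex_of_real (exp (- (v j * t\<^sup>2 / 2)))) \<le> exp (- (v j * h))"
        by simp
    qed simp
    also have "(\<Prod>j\<in>I. exp (- (v j * h))) = exp (- h)"
      using I(1) v by (simp add: exp_sum[symmetric] sum_negf flip: sum_distrib_right)
    also have "exp (- h) * (\<Sum>j\<in>I. norm (char (N j) t - complex_of_real (exp (- (v j * t\<^sup>2 / 2)))) / exp (- (v j * h)))
       \<le> exp (- h) * (\<Sum>j\<in>I. v j * K * exp (d\<^sup>2 * h))"
    proof (intro mult_left_mono sum_mono)
      fix j assume j: "j \<in> I"
      interpret small_summand "N j" "v j" d by (rule I(2)[OF j])
      have "norm (char (N j) t - complex_of_real (exp (- (v j * t\<^sup>2 / 2)))) / exp (- (v j * h))
        = norm (char (N j) t - exp (- (v j * t\<^sup>2 / 2))) * exp (v j * h)"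
        by (simp add: exp_minus exp_of_real field_simps)
      \<comment> \<open>Dividing by the bound of one factor costs only \<open>exp (v j * h)\<close>,
        and \<open>v j \<le> d^2\<close> makes this uniform in \<open>j\<close>.\<close>
      also have "\<dots> \<le> v j * K * exp (d\<^sup>2 * h)"
        unfolding K_def using char_diff_normal[of t] t v0[OF j] h0 K
        by (intro mult_mono) (auto intro!: mult_right_mono simp: K_def)
      finally show "norm (char (N j) t - complex_of_real (exp (- (v j * t\<^sup>2 / 2)))) / exp (- (v j * h)) \<le> v j * K * exp (d\<^sup>2 * h)" .
    qed simp
    also have "(\<Sum>j\<in>I. v j * K * exp (d\<^sup>2 * h)) = K * exp (d\<^sup>2 * h)"
      using v by (simp flip: sum_distrib_right)
    also have "exp (- h) * (K * exp (d\<^sup>2 * h)) = K * exp (- ((1 - d\<^sup>2) * h))"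
      by (simp add: mult_exp_exp algebra_simps)
    also have "\<dots> \<le> K * exp (- (56/100 * t)\<^sup>2)"
    proof -
      have "d\<^sup>2 \<le> (1/6)\<^sup>2" using d by (intro power_mono) auto
      then have "(1 - d\<^sup>2) * h \<ge> (35/36) * (t\<^sup>2 / 3)"
        using h by (intro mult_mono) (auto simp: power2_eq_square)
      moreover have "(56/100 * t)\<^sup>2 \<le> (35/36) * (t\<^sup>2 / 3)"
        by (simp add: power2_eq_square)
      ultimately show ?thesis using K by (intro mult_left_mono) auto
    qed
    also have "\<dots> = t * b t"
      by (simp add: K_def b_def algebra_simps power2_eq_square power3_eq_cube power4_eq_xxxx)
    finally show ?thesis .
  qed
  let ?B = "\<lambda>t. indicator {0..} t *\<^sub>R b t"
  have "has_bochner_integral lborel (\<lambda>t. d / 6 * (indicator {0..} t *\<^sub>R (exp (- (56/100 * t)\<^sup>2) * t\<^sup>2))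
    + d\<^sup>2 / 8 * (indicator {0..} t *\<^sub>R (exp (- (56/100 * t)\<^sup>2) * t ^ 3))) (d / 6 * (sqrt pi / 4 / (56/100) ^ 3) + d\<^sup>2 / 8 * (1 / 2 / (56/100) ^ 4))"
    by (intro has_bochner_integral_add has_bochner_integral_mult_right has_bochner_integral_scaled_gaussian_moments) auto
  moreover have "(\<lambda>t. d / 6 * (indicator {0..} t *\<^sub>R (exp (- (56/100 * t)\<^sup>2) * t\<^sup>2))
    + d\<^sup>2 / 8 * (indicator {0..} t *\<^sub>R (exp (- (56/100 * t)\<^sup>2) * t ^ 3))) = ?B"
    by (simp add: b_def fun_eq_iff algebra_simps)
  ultimately have B: "has_bochner_integral lborel ?B (d / 6 * (sqrt pi / 4 / (56/100) ^ 3) + d\<^sup>2 / 8 * (1 / 2 / (56/100) ^ 4))"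
    by simp
  have b0: "0 \<le> b t" if "0 \<le> t" for t
    using that d by (simp add: b_def)
  have bint0: "set_integrable lborel {0..} b"
    using B by (auto simp: set_integrable_def has_bochner_integral_iff)
  then have bint: "set_integrable lborel {0<..<1/d} b"
    by (rule set_integrable_subset) auto
  have "(LBINT t:{0<..<1/d}. b t) \<le> (LBINT t. ?B t)"
    unfolding set_lebesgue_integral_def
    using bint bint0 b0 by (intro integral_mono) (auto simp: set_integrable_def indicator_def)
  also have "\<dots> = d / 6 * (sqrt pi / 4 / (56/100) ^ 3) + d\<^sup>2 / 8 * (1 / 2 / (56/100) ^ 4)"
    using B by (rule has_bochner_integral_integral_eq)
  also have "\<dots> \<le> d * (53/100)"
  proof -
    have "sqrt pi \<le> 1773/1000"
      using pi_approx by (intro real_le_lsqrt) (auto simp: power2_eq_square)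
    moreover have "d\<^sup>2 \<le> d * (1/6)"
      unfolding power2_eq_square using d by (intro mult_left_mono) auto
    ultimately have "d / 6 * (sqrt pi / 4 / (56/100) ^ 3) + d\<^sup>2 / 8 * (1 / 2 / (56/100) ^ 4)
      \<le> d / 6 * (1773/1000 / 4 / (56/100) ^ 3) + (d * (1/6)) / 8 * (1 / 2 / (56/100) ^ 4)"
      using d by (intro add_mono mult_left_mono mult_right_mono divide_right_mono) auto
    also have "\<dots> \<le> d * (53/100)"
      using d by (simp add: power3_eq_cube power4_eq_xxxx)
    finally show ?thesis .
  qed
  finally have bI: "(LBINT t:{0<..<1/d}. b t) \<le> d * (53/100)" .
  have "\<bar>cdf M x - cdf std_normal_distribution x\<bar> \<le>
    ((LBINT t:{0<..<1/d}. b t) / pi + 3 * (399/1000) / (1 / d) * (715/1000)) / (43/100)"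
    using integrable_std_normal_distribution_moment[of 1] d
    by (intro Esseen_smoothing[OF M real_dist_normal_dist _ cdf_std_normal_lipschitz _ _ bint diff]) auto
  \<comment> \<open>Numerically the coefficient of \<open>d\<close> is about
    \<open>(0.169 + 0.856) / 0.43 = 2.383\<close>: the first part is the Fourier integral, the
    larger second part the smoothing window.\<close>
  also have "\<dots> \<le> ((d * (53/100)) / (314/100) + 3 * (399/1000) / (1 / d) * (715/1000)) / (43/100)"
    using bI pi_approx d by (intro divide_right_mono add_right_mono frac_le) auto
  also have "\<dots> \<le> 12/5 * d" using d by simp
  finally show ?thesis .
qed

section \<open>Gaussian and perturbed Laplace tails\<close>

text \<open>The integrand is the length of the set of \<open>u\<close> in (0,1) with
  \<open>u \<le> exp (- (a * y))\<close>, for \<open>y > 0\<close>. At fixed \<open>u\<close> the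
  level set is the interval from 0 (excluded) to \<open>- ln u / a\<close>; for \<open>a = 0\<close>
  it is the whole half line, while the division would return 0, hence the separate case.\<close>

lemma (in real_distribution) exp_tail_layer_cake:
  assumes a: "0 \<le> a"
  defines "g \<equiv> \<lambda>u. if a = 0 then 1 - cdf M 0 else cdf M (- ln u / a) - cdf M 0"
  shows "integrable lborel (\<lambda>u. indicator {0<..<1} u * g u)"
    and "(\<integral>y. indicator {0<..} y * exp (- (a * y)) \<partial>M) = (\<integral>u. indicator {0<..<1} u * g u \<partial>lborel)"
proof -
  interpret P: pair_sigma_finite lborel M ..
  let ?f = "\<lambda>u y. indicator {0<..<1} u * (if 0 < y \<and> u \<le> exp (- (a * y)) then 1 else 0) :: real"
  have "integrable (lborel \<Otimes>\<^sub>M M) (\<lambda>(u, y). indicator {0<..<1::real} u :: real)"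
  proof (rule P.Fubini_integrable)
    show "integrable lborel (\<lambda>u. \<integral>y. norm (case (u, y) of (u, y) \<Rightarrow> (indicator {0<..<1::real} u :: real)) \<partial>M)"
      using prob_space integrable_real_indicator[of "{0<..<1::real}" lborel] by simp
  qed auto
  then have int: "integrable (lborel \<Otimes>\<^sub>M M) (case_prod ?f)"
    by (rule Bochner_Integration.integrable_bound) (auto intro!: AE_I2 simp: indicator_def)
  have inner_u: "(\<integral>u. ?f u y \<partial>lborel) = indicator {0<..} y * exp (- (a * y))" for y
  proof (cases "0 < y")
    case True
    then have e: "exp (- (a * y)) \<le> 1" using a by simp
    have "(\<integral>u. ?f u y \<partial>lborel) = (\<integral>u. indicator {0<..exp (- (a * y))} u \<partial>lborel)"
    proof (rule integral_cong_AE)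
      show "AE u in lborel. ?f u y = indicator {0<..exp (- (a * y))} u"
        using AE_lborel_singleton[of 1] 
      proof eventually_elim
        fix u :: real assume "u \<noteq> 1"
        moreover have "u \<le> exp (- (a * y)) \<Longrightarrow> u \<le> 1" using e by linarith
        ultimately show "?f u y = indicator {0<..exp (- (a * y))} u"
          using True by (auto simp: indicator_def less_le)
      qed
    qed auto
    then show ?thesis using True by simp
  qed simp
  have inner_y: "(\<integral>y. ?f u y \<partial>M) = indicator {0<..<1} u * g u" for u
  proof (cases "u \<in> {0<..<1}")
    case u: True
    show ?thesis
    proof (cases "a = 0")
      case True
      have "(\<lambda>y. ?f u y) = indicator {0<..}" using True u by (auto simp: fun_eq_iff indicator_def)
      moreover have "prob {0<..} = 1 - prob {..0}"
        using prob_compl[of "{..0}"] by (simp add: Compl_eq_Diff_UNIV[symmetric])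
      ultimately show ?thesis using True u by (simp add: g_def cdf_def)
    next
      case False
      then have a': "0 < a" using a by simp
      have z: "0 < - ln u / a" using u a' by (simp add: field_simps)
      have "u \<le> exp (- (a * y)) \<longleftrightarrow> y \<le> - ln u / a" for y
      proof -
        have "u \<le> exp (- (a * y)) \<longleftrightarrow> ln u \<le> - (a * y)"
          using u by (metis exp_gt_zero exp_le_cancel_iff exp_ln greaterThanLessThan_iff)
        also have "\<dots> \<longleftrightarrow> a * y \<le> - ln u" by linarith
        also have "\<dots> \<longleftrightarrow> y \<le> - ln u / a" using a' by (subst pos_le_divide_eq) (simp_all add: mult.commute)
        finally show ?thesis .
      qed
      then have "(\<lambda>y. ?f u y) = indicator {0<..- ln u / a}" using u by (auto simp: fun_eq_iff indicator_def)
      then show ?thesis using False u z cdf_diff_eq[OF z] by (simp add: g_def)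
    qed
  qed simp
  show "integrable lborel (\<lambda>u. indicator {0<..<1} u * g u)"
    using P.integrable_fst[OF int] unfolding inner_y .
  show "(\<integral>y. indicator {0<..} y * exp (- (a * y)) \<partial>M) = (\<integral>u. indicator {0<..<1} u * g u \<partial>lborel)"
    using P.Fubini_integral[OF int] unfolding inner_u inner_y .
qed

text \<open>The mass of a level set is a difference of two values of the distribution function, with
  1 as one of them when \<open>a = 0\<close>. This gives the factor 2 and a bound uniform in
  \<open>a\<close>.\<close>

lemma exp_tail_diff_le:
  assumes M: "real_distribution M" and N: "real_distribution N"
    and \<eta>: "\<And>x. \<bar>cdf M x - cdf N x\<bar> \<le> \<eta>" and a: "0 \<le> a"
  shows "\<bar>(\<integral>y. indicator {0<..} y * exp (- (a * y)) \<partial>M) - (\<integral>y. indicator {0<..} y * exp (- (a * y)) \<partial>N)\<bar> \<le> 2 * \<eta>"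
proof -
  interpret M: real_distribution M by fact
  interpret N: real_distribution N by fact
  define g where "g M u = (if a = 0 then 1 - cdf M 0 else cdf M (- ln u / a) - cdf M 0)" for M u
  note IM = M.exp_tail_layer_cake[OF a, folded g_def]
  note IN = N.exp_tail_layer_cake[OF a, folded g_def]
  have le: "\<bar>g M u - g N u\<bar> \<le> 2 * \<eta>" for u
    using \<eta>[of 0] \<eta>[of "- ln u / a"] by (auto simp: g_def)
  have "(\<integral>y. indicator {0<..} y * exp (- (a * y)) \<partial>M) - (\<integral>y. indicator {0<..} y * exp (- (a * y)) \<partial>N)
    = (\<integral>u. indicator {0<..<1} u * g M u - indicator {0<..<1} u * g N u \<partial>lborel)"
    unfolding IM(2) IN(2) by (rule Bochner_Integration.integral_diff[OF IM(1) IN(1), symmetric])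
  also have "\<bar>\<dots>\<bar> \<le> (\<integral>u. \<bar>indicator {0<..<1} u * g M u - indicator {0<..<1} u * g N u\<bar> \<partial>lborel)"
    by (rule integral_abs_bound)
  also have "\<dots> \<le> (\<integral>u. indicator {0<..<1::real} u * (2 * \<eta>) \<partial>lborel)"
  proof (rule integral_mono)
    show "integrable lborel (\<lambda>u. \<bar>indicator {0<..<1} u * g M u - indicator {0<..<1} u * g N u\<bar>)"
      using IM(1) IN(1) by (intro integrable_abs Bochner_Integration.integrable_diff)
    show "\<bar>indicator {0<..<1} u * g M u - indicator {0<..<1} u * g N u\<bar> \<le> indicator {0<..<1} u * (2 * \<eta>)" for u
      using le[of u] by (auto simp: indicator_def)
  qed (auto intro!: integrable_mult_left integrable_real_indicator)
  also have "\<dots> = 2 * \<eta>" by simp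
  finally show ?thesis .
qed

text \<open>Shift by \<open>a\<close> and complete the square: the Mills ratio is the Gaussian
  instance of the tail integral appearing after tilting.\<close>

lemma Mills_eq_integral: "Mills a = (\<integral>y. indicator {0<..} y * exp (- (a * y)) \<partial>std_normal_distribution)"
proof -
  interpret real_distribution std_normal_distribution by (rule real_dist_normal_dist)
  have "1 - Phi a = prob {a<..}"
    using prob_compl[of "{..a}"] by (simp add: Phi_def Compl_eq_Diff_UNIV[symmetric])
  also have "\<dots> = (\<integral>z. indicator {a<..} z \<partial>std_normal_distribution)"
    by simp
  also have "\<dots> = (\<integral>z. std_normal_density z * indicator {a<..} z \<partial>lborel)"
    by (subst integral_density) auto
  also have "\<dots> = (\<integral>y. std_normal_density (a + y) * indicator {a<..} (a + y) \<partial>lborel)"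
    by (subst lborel_integral_real_affine[of 1 _ a]) auto
  also have "\<dots> = (\<integral>y. exp (- (a\<^sup>2 / 2)) * (std_normal_density y * (indicator {0<..} y * exp (- (a * y)))) \<partial>lborel)"
  proof (intro Bochner_Integration.integral_cong refl)
    fix y
    have "exp (- (a + y)\<^sup>2 / 2) = exp (- (a\<^sup>2 / 2)) * exp (- y\<^sup>2 / 2) * exp (- (a * y))"
      unfolding exp_add[symmetric] by (simp add: power2_eq_square field_simps)
    then show "std_normal_density (a + y) * indicator {a<..} (a + y)
      = exp (- (a\<^sup>2 / 2)) * (std_normal_density y * (indicator {0<..} y * exp (- (a * y))))"
      by (simp add: std_normal_density_def indicator_def)
  qed
  also have "\<dots> = exp (- (a\<^sup>2 / 2)) * (\<integral>y. indicator {0<..} y * exp (- (a * y)) \<partial>std_normal_distribution)"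
    by (subst integral_density) auto
  finally show ?thesis
    by (simp add: Mills_def exp_minus field_simps)
qed

lemma exp_tail_bounded: "0 \<le> a \<Longrightarrow> 0 \<le> indicator {0<..} y * exp (- (a * y))"
  "0 \<le> a \<Longrightarrow> indicator {0<..} y * exp (- (a * y)) \<le> (1::real)"
  by (auto simp: indicator_def)

lemma (in real_distribution) exp_tail_integrable:
  "0 \<le> a \<Longrightarrow> integrable M (\<lambda>y. indicator {0<..} y * exp (- (a * y)))"
  by (rule integrable_const_bound[of _ 1]) (auto simp: indicator_def)

lemma (in real_distribution) exp_tail_integral_bounds:
  assumes "0 \<le> a"
  shows "0 \<le> (\<integral>y. indicator {0<..} y * exp (- (a * y)) \<partial>M)" "(\<integral>y. indicator {0<..} y * exp (- (a * y)) \<partial>M) \<le> 1"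
proof -
  show "0 \<le> (\<integral>y. indicator {0<..} y * exp (- (a * y)) \<partial>M)"
    by (rule Bochner_Integration.integral_nonneg) (use exp_tail_bounded assms in auto)
  have "(\<integral>y. indicator {0<..} y * exp (- (a * y)) \<partial>M) \<le> (\<integral>y. 1 \<partial>M)"
    using exp_tail_integrable[OF assms] exp_tail_bounded(2)[OF assms] by (intro integral_mono) auto
  then show "(\<integral>y. indicator {0<..} y * exp (- (a * y)) \<partial>M) \<le> 1"
    using prob_space by simp
qed

lemma Mills_bounds: assumes "0 \<le> a" shows "0 \<le> Mills a" "Mills a \<le> 1"
  unfolding Mills_eq_integral using real_distribution.exp_tail_integral_bounds[OF real_dist_normal_dist assms] by auto

text \<open>The factor \<open>1 / m^2\<close> is the integral of \<open>y * exp (- (m * y))\<close>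
  over the half line. The quadratic decay is essential: the exponents to be compared are of size
  \<open>w = l * \<sigma>\<close> and differ by a multiple of \<open>w * l * \<epsilon>\<close>, so
  the error is of order \<open>l * \<epsilon> / w = \<epsilon> / \<sigma>\<close>.\<close>

lemma Mills_diff_le:
  assumes m: "0 < m" "m \<le> a" "m \<le> b"
  shows "\<bar>Mills a - Mills b\<bar> \<le> 399/1000 * \<bar>a - b\<bar> / m\<^sup>2"
proof -
  interpret real_distribution std_normal_distribution by (rule real_dist_normal_dist)
  let ?G = "\<lambda>y. indicator {0..} y *\<^sub>R (y * exp (- (m * y)))"
  have pt: "\<bar>exp (- (a * y)) - exp (- (b * y))\<bar> \<le> \<bar>a - b\<bar> * (y * exp (- (m * y)))"
    if "0 < y" "m \<le> a" "m \<le> b" for a b y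
  proof -
    have *: "\<bar>exp (- (a * y)) - exp (- (b * y))\<bar> \<le> \<bar>a - b\<bar> * (y * exp (- (m * y)))" if "a \<le> b" "m \<le> a" for a b
    proof -
      have "\<bar>exp (- (a * y)) - exp (- (b * y))\<bar> = exp (- (a * y)) * (1 - exp (- ((b - a) * y)))"
        using that \<open>0 < y\<close> by (simp add: algebra_simps flip: exp_add)
      also have "\<dots> \<le> exp (- (m * y)) * ((b - a) * y)"
        using that \<open>0 < y\<close> exp_ge_add_one_self[of "- ((b - a) * y)"]
        by (intro mult_mono) auto
      finally show ?thesis using that by (simp add: mult_ac)
    qed
    show ?thesis
      using *[of a b] *[of b a] that by (cases "a \<le> b") (auto simp: abs_minus_commute)
  qed
  have mult: "has_bochner_integral lborel f y \<Longrightarrow> has_bochner_integral lborel (\<lambda>x. f x * k) (y * k)"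
    for f :: "real \<Rightarrow> real" and y k by (rule has_bochner_integral_mult_left)
  have A: "has_bochner_integral lborel (\<lambda>y. (0 + m * y) ^ 1 * exp (- (0 + m * y)) * indicator {0..} (0 + m * y)) (fact 1 /\<^sub>R \<bar>m\<bar>)"
    using m by (subst lborel_has_bochner_integral_real_affine_iff[symmetric]) (auto intro!: has_bochner_integral_I0i_power_exp_m'[of 1, simplified])
  have B: "(0 + m * y) ^ 1 * exp (- (0 + m * y)) * indicator {0..} (0 + m * y) * (1 / m) = ?G y" for y
    using m by (auto simp: indicator_def zero_le_mult_iff)
  have C: "(fact 1 /\<^sub>R \<bar>m\<bar>) * (1 / m) = 1 / m\<^sup>2"
    using m by (simp add: power2_eq_square field_simps)
  have G: "has_bochner_integral lborel ?G (1 / m\<^sup>2)"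
    using mult[OF A, of "1 / m"] unfolding B C .
  have "\<bar>Mills a - Mills b\<bar> = \<bar>\<integral>y. indicator {0<..} y * exp (- (a * y)) - indicator {0<..} y * exp (- (b * y)) \<partial>std_normal_distribution\<bar>"
    unfolding Mills_eq_integral using m exp_tail_integrable[of a] exp_tail_integrable[of b] by simp
  also have "\<dots> \<le> (\<integral>y. \<bar>indicator {0<..} y * exp (- (a * y)) - indicator {0<..} y * exp (- (b * y))\<bar> \<partial>std_normal_distribution)"
    by (rule integral_abs_bound)
  also have "\<dots> = (\<integral>y. std_normal_density y * \<bar>indicator {0<..} y * exp (- (a * y)) - indicator {0<..} y * exp (- (b * y))\<bar> \<partial>lborel)"
    by (subst integral_density) auto
  also have "\<dots> \<le> (\<integral>y. 399/1000 * (\<bar>a - b\<bar> * ?G y) \<partial>lborel)"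
  proof (rule integral_mono)
    have "integrable std_normal_distribution (\<lambda>y. \<bar>indicator {0<..} y * exp (- (a * y)) - indicator {0<..} y * exp (- (b * y))\<bar>)"
      using m exp_tail_integrable[of a] exp_tail_integrable[of b] by simp
    then show "integrable lborel (\<lambda>y. std_normal_density y * \<bar>indicator {0<..} y * exp (- (a * y)) - indicator {0<..} y * exp (- (b * y))\<bar>)"
      by (subst (asm) integrable_density) auto
    show "integrable lborel (\<lambda>y. 399/1000 * (\<bar>a - b\<bar> * ?G y))"
      using G by (intro integrable_mult_right) (auto simp: has_bochner_integral_iff)
    fix y
    show "std_normal_density y * \<bar>indicator {0<..} y * exp (- (a * y)) - indicator {0<..} y * exp (- (b * y))\<bar> \<le> 399/1000 * (\<bar>a - b\<bar> * ?G y)"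
    proof (cases "0 < y")
      case True
      then show ?thesis
        using pt[OF True m(2,3)] std_normal_density_le[of y]
        by (intro mult_mono) auto
    qed (auto simp: indicator_def)
  qed
  also have "\<dots> = 399/1000 * (\<bar>a - b\<bar> * (1 / m\<^sup>2))"
    using G by (simp only: integral_mult_right_zero has_bochner_integral_integral_eq)
  finally show ?thesis by simp
qed

section \<open>Exponential moments under Bernstein's condition\<close>

text \<open>The \<open>p\<close>-th derivative of the geometric series, read off from the binomial
  series with exponent \<open>- (p + 1)\<close>.\<close>

lemma fact_quotient_power_sums:
  fixes t :: real assumes "0 \<le> t" "t < 1"
  shows "(\<lambda>j. fact (p + j) / fact j * t ^ j) sums (fact p / (1 - t) ^ (p + 1))"
proof -
  have "(\<lambda>n. fact p * ((- real (p + 1) gchoose n) * (- t) ^ n)) sums (fact p * (1 + - t) powr (- real (p + 1)))"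
    using assms by (intro sums_mult gen_binomial_real) auto
  moreover have "fact p * ((- real (p + 1) gchoose j) * (- t) ^ j) = fact (p + j) / fact j * t ^ j" for j
  proof -
    have g: "(- real (p + 1) gchoose j) = (-1) ^ j * real ((p + j) choose j)"
      unfolding gbinomial_minus by (simp add: binomial_gbinomial)
    have "(- real (p + 1) gchoose j) * (- t) ^ j = ((-1) ^ j * (-1) ^ j) * (real ((p + j) choose j) * t ^ j)"
      unfolding g power_minus[of t] by (simp only: mult_ac)
    also have "(-1) ^ j * (-1) ^ j = (1::real)"
      by (simp flip: power_mult_distrib)
    finally have "(- real (p + 1) gchoose j) * (- t) ^ j = real ((p + j) choose j) * t ^ j"
      by simp
    then show ?thesis
      by (simp add: binomial_fact)
  qed
  moreover have "(1 + - t) powr (- real (p + 1)) = 1 / (1 - t) ^ (p + 1)"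
    using assms by (simp only: powr_minus_divide powr_realpow) simp
  ultimately show ?thesis by simp
qed

text \<open>The quadratic Taylor remainder of \<open>exp\<close> has the sign of its argument. It
  gives a pointwise lower bound for \<open>X * exp (l * X)\<close> valid for both signs of
  \<open>X\<close>.\<close>

lemma exp_cubic_sign:
  fixes u :: real shows "0 \<le> u * (exp u - 1 - u - u\<^sup>2 / 2)"
proof (cases "0 \<le> u")
  case True
  then show ?thesis using exp_lower_Taylor_quadratic[OF True] by simp
next
  case False
  then show ?thesis using exp_minus_approx[of "- u"] by (intro mult_nonpos_nonpos) auto
qed

text \<open>Convexity of the fourth power, with free weight \<open>u\<close>; it is used with \<open>u = 3\<lambda>\<epsilon>\<close>, so that
  the loss disappears as the tilt tends to zero.\<close>

lemma power4_diff_le: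
  fixes x b u :: real assumes u: "0 < u" "u < 1"
  shows "(x - b) ^ 4 \<le> x ^ 4 / (1 - u) ^ 3 + b ^ 4 / u ^ 3"
proof -
  have c: "convex_on UNIV (\<lambda>x::real. x ^ 4)"
    by (rule convex_power_even) simp
  have "((1 - u) *\<^sub>R (x / (1 - u)) + u *\<^sub>R (- b / u)) ^ 4 \<le> (1 - u) * (x / (1 - u)) ^ 4 + u * (- b / u) ^ 4"
    using u by (intro convex_onD[OF c]) auto
  moreover have "(1 - u) *\<^sub>R (x / (1 - u)) + u *\<^sub>R (- b / u) = x - b"
    using u by simp
  moreover have "(1 - u) * (x / (1 - u)) ^ 4 = x ^ 4 / (1 - u) ^ 3" "u * (- b / u) ^ 4 = b ^ 4 / u ^ 3"
    using u by (simp_all add: power_divide eval_nat_numeral)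
  ultimately show ?thesis by simp
qed

locale bernstein_variable = prob_space +
  fixes X :: "'a \<Rightarrow> real" and \<epsilon> :: real
  assumes X [measurable]: "X \<in> borel_measurable M" and \<epsilon>_pos: "0 < \<epsilon>"
    and bernstein: "bernstein_cond M X \<epsilon>" and mean_zero: "(\<integral>\<omega>. X \<omega> \<partial>M) = 0"
begin

definition s2 where "s2 = (\<integral>\<omega>. (X \<omega>)\<^sup>2 \<partial>M)"

lemma int_power: "integrable M (\<lambda>\<omega>. X \<omega> ^ k)"
  using bernstein by (simp add: bernstein_cond_def)

lemma s2_nonneg: "0 \<le> s2"
  by (simp add: s2_def)

lemma moment_bound:
  assumes "2 \<le> k" shows "\<bar>\<integral>\<omega>. X \<omega> ^ k \<partial>M\<bar> \<le> 1/2 * fact k * \<epsilon> ^ (k - 2) * s2"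
proof (cases "k = 2")
  case True then show ?thesis using s2_nonneg by (simp add: s2_def)
next
  case False then show ?thesis using bernstein assms by (simp add: bernstein_cond_def s2_def)
qed

text \<open>Nonnegativity of the variance of \<open>X^2\<close>, with fourth moment at most
  \<open>1/2 * fact 4 = 12\<close> times \<open>\<epsilon>^2 * s2\<close>.\<close>

lemma s2_le: "s2 \<le> 12 * \<epsilon>\<^sup>2"
proof -
  have "0 \<le> (\<integral>\<omega>. ((X \<omega>)\<^sup>2 - s2)\<^sup>2 \<partial>M)" by simp
  also have "(\<lambda>\<omega>. ((X \<omega>)\<^sup>2 - s2)\<^sup>2) = (\<lambda>\<omega>. X \<omega> ^ 4 - 2 * s2 * (X \<omega>)\<^sup>2 + s2\<^sup>2)"
    by (simp add: fun_eq_iff power2_eq_square power4_eq_xxxx algebra_simps)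
  also have "(\<integral>\<omega>. X \<omega> ^ 4 - 2 * s2 * (X \<omega>)\<^sup>2 + s2\<^sup>2 \<partial>M) = (\<integral>\<omega>. X \<omega> ^ 4 \<partial>M) - s2\<^sup>2"
    using int_power[of 2] int_power[of 4] prob_space by (simp add: power2_eq_square flip: s2_def[unfolded power2_eq_square])
  finally have "s2 * s2 \<le> 12 * \<epsilon>\<^sup>2 * s2"
    using moment_bound[of 4] by (simp add: power2_eq_square fact_numeral)
  then show ?thesis using s2_nonneg by (cases "s2 = 0") auto
qed

text \<open>Only even moments are absolute moments, so the series integrated is that of
  \<open>cosh (l * X)\<close>, whose nonzero terms are even powers; twice \<open>cosh\<close>
  dominates the exponential of the absolute value.\<close>

lemma integrable_exp_abs:
  assumes "0 \<le> l" "l * \<epsilon> < 1" shows "integrable M (\<lambda>\<omega>. exp (l * \<bar>X \<omega>\<bar>))"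
proof -
  let ?f = "\<lambda>n \<omega>. if even n then (l * X \<omega>) ^ n /\<^sub>R fact n else 0"
  have int: "integrable M (?f n)" for n
    using int_power[of n] by (cases "even n") (simp_all add: power_mult_distrib)
  define K where "K = 1 + s2 / (2 * \<epsilon>\<^sup>2)"
  have K: "(\<integral>\<omega>. norm (?f n \<omega>) \<partial>M) \<le> K * (l * \<epsilon>) ^ n" for n
  proof (cases "even n \<and> 2 \<le> n")
    case False
    then have "n = 0 \<or> odd n" by (cases n; cases "n - 1") auto
    then show ?thesis using prob_space s2_nonneg \<epsilon>_pos assms
      by (auto simp: K_def)
  next
    case True
    have "(\<integral>\<omega>. norm (?f n \<omega>) \<partial>M) = l ^ n / fact n * (\<integral>\<omega>. X \<omega> ^ n \<partial>M)"
    proof -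
      have "norm (?f n \<omega>) = l ^ n / fact n * X \<omega> ^ n" for \<omega>
        using True zero_le_even_power[of n l] zero_le_even_power[of n "X \<omega>"]
        by (simp add: power_mult_distrib abs_mult divide_inverse)
      then show ?thesis by simp
    qed
    also have "\<dots> \<le> l ^ n / fact n * (1/2 * fact n * \<epsilon> ^ (n - 2) * s2)"
      using moment_bound[of n] True assms by (intro mult_left_mono) auto
    also have "\<epsilon> ^ (n - 2) = \<epsilon> ^ n / \<epsilon>\<^sup>2"
      using True \<epsilon>_pos by (simp add: power_diff)
    also have "l ^ n / fact n * (1/2 * fact n * (\<epsilon> ^ n / \<epsilon>\<^sup>2) * s2) = s2 / (2 * \<epsilon>\<^sup>2) * (l * \<epsilon>) ^ n"
      by (simp add: power_mult_distrib mult_ac)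
    also have "\<dots> \<le> K * (l * \<epsilon>) ^ n"
      using assms \<epsilon>_pos by (intro mult_right_mono) (auto simp: K_def)
    finally show ?thesis .
  qed
  have "summable (\<lambda>n. \<integral>\<omega>. norm (?f n \<omega>) \<partial>M)"
    by (rule summable_comparison_test_ev[of _ "\<lambda>n. K * (l * \<epsilon>) ^ n"])
       (use K assms \<epsilon>_pos in \<open>auto intro!: summable_mult summable_geometric\<close>)
  moreover have "summable (\<lambda>n. norm (?f n \<omega>))" for \<omega>
    using sums_summable[OF cosh_converges[of "l * X \<omega>"]]
    by (rule summable_cong[THEN iffD1, rotated]) (auto simp: zero_le_even_power)
  ultimately have "integrable M (\<lambda>\<omega>. \<Sum>n. ?f n \<omega>)"
    by (intro integrable_suminf int) auto
  moreover have "(\<lambda>\<omega>. \<Sum>n. ?f n \<omega>) = (\<lambda>\<omega>. cosh (l * X \<omega>))"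
    by (simp only: sums_unique[OF cosh_converges, symmetric])
  ultimately have "integrable M (\<lambda>\<omega>. 2 * cosh (l * X \<omega>))"
    by simp
  then show ?thesis
  proof (rule Bochner_Integration.integrable_bound)
    have "exp (l * \<bar>x\<bar>) \<le> 2 * cosh (l * x)" for x
      by (cases "0 \<le> x") (simp_all add: cosh_def)
    then show "AE \<omega> in M. norm (exp (l * \<bar>X \<omega>\<bar>)) \<le> norm (2 * cosh (l * X \<omega>))"
      by (intro AE_I2) (simp add: cosh_real_nonneg)
  qed simp
qed

lemma integrable_abs_power_exp:
  assumes "0 \<le> l" "l * \<epsilon> < 1" shows "integrable M (\<lambda>\<omega>. \<bar>X \<omega>\<bar> ^ p * exp (l * \<bar>X \<omega>\<bar>))"
proof -
  \<comment> \<open>Half of the gap to the radius \<open>1 / \<epsilon>\<close>: the power of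
    \<open>\<bar>X\<bar>\<close> is absorbed by the extra factor
    \<open>exp (d * \<bar>X\<bar>)\<close>, using \<open>z \<le> exp z\<close> raised to the power
    \<open>p\<close>.\<close>
  define d where "d = (1 / \<epsilon> - l) / 2"
  have d: "0 < d" "(l + d) * \<epsilon> < 1" using assms \<epsilon>_pos by (auto simp: d_def field_simps)
  have le: "\<bar>X \<omega>\<bar> ^ p * exp (l * \<bar>X \<omega>\<bar>) \<le> (real p / d) ^ p * exp ((l + d) * \<bar>X \<omega>\<bar>)" for \<omega>
  proof -
    have "\<bar>X \<omega>\<bar> ^ p \<le> (real p / d) ^ p * exp (d * \<bar>X \<omega>\<bar>)"
    proof (cases "p = 0")
      case False
      have "d * \<bar>X \<omega>\<bar> / real p \<le> exp (d * \<bar>X \<omega>\<bar> / real p)"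
        using exp_ge_add_one_self[of "d * \<bar>X \<omega>\<bar> / real p"] by linarith
      then have "(real p / d * (d * \<bar>X \<omega>\<bar> / real p)) ^ p \<le> (real p / d * exp (d * \<bar>X \<omega>\<bar> / real p)) ^ p"
        using d by (intro power_mono mult_left_mono) auto
      also have "real p / d * (d * \<bar>X \<omega>\<bar> / real p) = \<bar>X \<omega>\<bar>"
        using False d by simp
      also have "(real p / d * exp (d * \<bar>X \<omega>\<bar> / real p)) ^ p = (real p / d) ^ p * exp (d * \<bar>X \<omega>\<bar>)"
        using False unfolding power_mult_distrib exp_of_nat_mult[symmetric] by simp
      finally show ?thesis .
    qed (use d in simp)
    then show ?thesis
      by (auto simp: algebra_simps exp_add mult_right_mono)
  qed
  have "integrable M (\<lambda>\<omega>. (real p / d) ^ p * exp ((l + d) * \<bar>X \<omega>\<bar>))"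
    using integrable_exp_abs[of "l + d"] d assms by simp
  then show ?thesis
    by (rule Bochner_Integration.integrable_bound) (use le d in \<open>auto intro!: AE_I2 simp: abs_mult\<close>)
qed

lemma integrable_power_exp:
  assumes "0 \<le> l" "l * \<epsilon> < 1" shows "integrable M (\<lambda>\<omega>. X \<omega> ^ p * exp (l * X \<omega>))"
  by (rule Bochner_Integration.integrable_bound[OF integrable_abs_power_exp[OF assms, of p]])
     (use assms in \<open>auto intro!: AE_I2 mult_left_mono simp: abs_mult power_abs\<close>)

text \<open>The \<open>p\<close>-th derivative of the moment generating function, that is, the
  \<open>p\<close>-th tilted moment before normalisation.\<close>

definition mexp :: "nat \<Rightarrow> real \<Rightarrow> real" where
  "mexp p l = (\<integral>\<omega>. X \<omega> ^ p * exp (l * X \<omega>) \<partial>M)"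

text \<open>The norms of the terms sum pointwise to
  \<open>\<bar>X\<bar> ^ p * exp (l * \<bar>X\<bar>)\<close>. Its integral bounds all partial sums
  of integrated norms, so sum and integral may be exchanged.\<close>

lemma mexp_sums:
  assumes l: "0 \<le> l" "l * \<epsilon> < 1"
  shows "(\<lambda>j. l ^ j / fact j * (\<integral>\<omega>. X \<omega> ^ (p + j) \<partial>M)) sums mexp p l"
proof -
  let ?f = "\<lambda>j \<omega>. X \<omega> ^ p * ((l * X \<omega>) ^ j /\<^sub>R fact j)"
  have eq: "?f j \<omega> = l ^ j / fact j * X \<omega> ^ (p + j)" for j \<omega>
    by (simp add: power_mult_distrib power_add divide_inverse mult_ac)
  have int: "integrable M (?f j)" for j
    unfolding eq using int_power by simp
  have ex: "(\<lambda>j. ?f j \<omega>) sums (X \<omega> ^ p * exp (l * X \<omega>))" for \<omega>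
    by (intro sums_mult exp_converges)
  have nrm: "(\<lambda>j. norm (?f j \<omega>)) sums (\<bar>X \<omega>\<bar> ^ p * exp (l * \<bar>X \<omega>\<bar>))" for \<omega>
  proof -
    have "norm (?f j \<omega>) = \<bar>X \<omega>\<bar> ^ p * ((l * \<bar>X \<omega>\<bar>) ^ j /\<^sub>R fact j)" for j
      using l by (simp add: abs_mult power_abs power_mult_distrib)
    then show ?thesis using sums_mult[OF exp_converges[of "l * \<bar>X \<omega>\<bar>"], of "\<bar>X \<omega>\<bar> ^ p"] by simp
  qed
  have "summable (\<lambda>j. \<integral>\<omega>. norm (?f j \<omega>) \<partial>M)"
  proof (rule summableI_nonneg_bounded)
    fix n
    have "(\<Sum>j<n. \<integral>\<omega>. norm (?f j \<omega>) \<partial>M) = (\<integral>\<omega>. (\<Sum>j<n. norm (?f j \<omega>)) \<partial>M)"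
      by (rule Bochner_Integration.integral_sum[symmetric]) (intro integrable_norm int)
    also have "\<dots> \<le> (\<integral>\<omega>. \<bar>X \<omega>\<bar> ^ p * exp (l * \<bar>X \<omega>\<bar>) \<partial>M)"
    proof (rule integral_mono)
      show "integrable M (\<lambda>\<omega>. \<Sum>j<n. norm (?f j \<omega>))"
        by (intro Bochner_Integration.integrable_sum integrable_norm int)
      show "(\<Sum>j<n. norm (?f j \<omega>)) \<le> \<bar>X \<omega>\<bar> ^ p * exp (l * \<bar>X \<omega>\<bar>)" for \<omega>
        using sum_le_suminf[OF sums_summable[OF nrm], of "{..<n}" \<omega>] sums_unique[OF nrm, of \<omega>] by simp
    qed (rule integrable_abs_power_exp[OF l])
    finally show "(\<Sum>j<n. \<integral>\<omega>. norm (?f j \<omega>) \<partial>M) \<le> (\<integral>\<omega>. \<bar>X \<omega>\<bar> ^ p * exp (l * \<bar>X \<omega>\<bar>) \<partial>M)" .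
  qed simp
  then have "(\<lambda>j. \<integral>\<omega>. ?f j \<omega> \<partial>M) sums (\<integral>\<omega>. (\<Sum>j. ?f j \<omega>) \<partial>M)"
    by (intro sums_integral int AE_I2 sums_summable[OF nrm])
  then show ?thesis
    unfolding sums_unique[OF ex, symmetric] unfolding eq by (simp add: mexp_def)
qed

text \<open>The right side is arranged as a term of \<open>fact_quotient_power_sums\<close>. Moments
  of order 0 and 1 are exceptional and are corrected by hand in \<open>mexp0_le\<close> and
  \<open>mexp1_le\<close>.\<close>

lemma series_term_bound:
  assumes l: "0 \<le> l" and "2 \<le> p + j"
  shows "l ^ j / fact j * (\<integral>\<omega>. X \<omega> ^ (p + j) \<partial>M) \<le> 1/2 * s2 / \<epsilon>\<^sup>2 * \<epsilon> ^ p * (fact (p + j) / fact j * (l * \<epsilon>) ^ j)"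
proof -
  have e: "\<epsilon> ^ (p + j - 2) = \<epsilon> ^ (p + j) / \<epsilon>\<^sup>2"
    using \<epsilon>_pos assms(2) by (simp add: power_diff)
  have "l ^ j / fact j * (1/2 * fact (p + j) * \<epsilon> ^ (p + j - 2) * s2) = 1/2 * s2 / \<epsilon>\<^sup>2 * \<epsilon> ^ p * (fact (p + j) / fact j * (l * \<epsilon>) ^ j)"
    unfolding e by (simp add: power_add power_mult_distrib mult_ac)
  moreover have "l ^ j / fact j * (\<integral>\<omega>. X \<omega> ^ (p + j) \<partial>M) \<le> l ^ j / fact j * (1/2 * fact (p + j) * \<epsilon> ^ (p + j - 2) * s2)"
    using moment_bound[OF assms(2)] l by (intro mult_left_mono) (auto simp: abs_le_iff)
  ultimately show ?thesis by simp
qed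

lemma mexp_bound:
  assumes l: "0 \<le> l" "l * \<epsilon> < 1" and p: "2 \<le> p"
  shows "mexp p l \<le> 1/2 * s2 / \<epsilon>\<^sup>2 * \<epsilon> ^ p * (fact p / (1 - l * \<epsilon>) ^ (p + 1))"
proof (rule sums_le[OF _ mexp_sums[OF l] sums_mult[OF fact_quotient_power_sums]])
  show "l ^ j / fact j * (\<integral>\<omega>. X \<omega> ^ (p + j) \<partial>M) \<le> 1/2 * s2 / \<epsilon>\<^sup>2 * \<epsilon> ^ p * (fact (p + j) / fact j * (l * \<epsilon>) ^ j)" for j
    using series_term_bound[of l p j] l p by auto
qed (use l \<epsilon>_pos in auto)

lemma mexp2_le:
  assumes l: "0 \<le> l" "l * \<epsilon> < 1" shows "mexp 2 l \<le> s2 / (1 - l * \<epsilon>) ^ 3"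
  using mexp_bound[OF l, of 2] \<epsilon>_pos by simp

lemma mexp4_le:
  assumes l: "0 \<le> l" "l * \<epsilon> < 1" shows "mexp 4 l \<le> 12 * s2 * \<epsilon>\<^sup>2 / (1 - l * \<epsilon>) ^ 5"
  using mexp_bound[OF l, of 4] \<epsilon>_pos by (simp add: fact_numeral power2_eq_square power4_eq_xxxx mult_ac)

lemma mexp0_le:
  assumes l: "0 \<le> l" "l * \<epsilon> < 1" shows "mexp 0 l \<le> 1 + l\<^sup>2 * s2 / (2 * (1 - l * \<epsilon>))"
proof -
  define t K where "t = l * \<epsilon>" and "K = 1/2 * s2 / \<epsilon>\<^sup>2"
  have t: "0 \<le> t" "t < 1" using l \<epsilon>_pos by (auto simp: t_def)
  \<comment> \<open>The geometric majorant has terms \<open>K\<close> and \<open>K * t\<close> at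
    \<open>j = 0\<close> and \<open>j = 1\<close>; the two single terms replace them by the true
    values 1 and 0.\<close>
  have "(\<lambda>j. K * t ^ j + (if j = 0 then 1 - K else 0) + (if j = 1 then - (K * t) else 0)) sums
    (K * (1 / (1 - t)) + (1 - K) + - (K * t))"
    using t by (intro sums_add sums_mult geometric_sums sums_single[of 0 "\<lambda>_. 1 - K"] sums_single[of 1 "\<lambda>_. - (K * t)"]) auto
  moreover have "l ^ j / fact j * (\<integral>\<omega>. X \<omega> ^ (0 + j) \<partial>M) \<le>
     K * t ^ j + (if j = 0 then 1 - K else 0) + (if j = 1 then - (K * t) else 0)" for j
  proof -
    consider "j = 0" | "j = 1" | "2 \<le> j" by linarith
    then show ?thesis
    proof cases
      case 3
      then show ?thesis using series_term_bound[of l 0 j] l by (simp add: K_def t_def)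
    qed (use mean_zero prob_space in auto)
  qed
  ultimately have "mexp 0 l \<le> K * (1 / (1 - t)) + (1 - K) + - (K * t)"
    using mexp_sums[OF l, of 0] by (rule sums_le[rotated 2])
  also have "\<dots> = 1 + K * (1 / (1 - t) - 1 - t)" by (simp add: algebra_simps)
  also have "1 / (1 - t) - 1 - t = t\<^sup>2 / (1 - t)" using t by (simp add: field_simps power2_eq_square)
  also have "K * (t\<^sup>2 / (1 - t)) = l\<^sup>2 * s2 / (2 * (1 - l * \<epsilon>))"
    using \<epsilon>_pos by (simp add: K_def t_def power_mult_distrib)
  finally show ?thesis .
qed

lemma mexp0_ge: assumes l: "0 \<le> l" "l * \<epsilon> < 1" shows "1 \<le> mexp 0 l"
proof -
  have "(\<integral>\<omega>. 1 + l * X \<omega> \<partial>M) \<le> (\<integral>\<omega>. X \<omega> ^ 0 * exp (l * X \<omega>) \<partial>M)"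
    using int_power[of 1] integrable_power_exp[OF l, of 0] by (intro integral_mono) (auto simp: exp_ge_add_one_self)
  then show ?thesis using int_power[of 1] mean_zero prob_space by (simp add: mexp_def)
qed

lemma mexp1_le:
  assumes l: "0 \<le> l" "l * \<epsilon> < 1" shows "mexp 1 l \<le> l * s2 * ((1 - l * \<epsilon> / 2) / (1 - l * \<epsilon>)\<^sup>2)"
proof -
  define t K where "t = l * \<epsilon>" and "K = 1/2 * s2 / \<epsilon>\<^sup>2 * \<epsilon> ^ 1"
  have t: "0 \<le> t" "t < 1" using l \<epsilon>_pos by (auto simp: t_def)
  \<comment> \<open>The single term at \<open>j = 0\<close> replaces the majorant \<open>K\<close>
    by 0, since the mean vanishes.\<close>
  have "(\<lambda>j. K * (fact (1 + j) / fact j * t ^ j) + (if j = 0 then - K else 0)) sums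
    (K * (fact 1 / (1 - t) ^ (1 + 1)) + - K)"
    using t by (intro sums_add sums_mult fact_quotient_power_sums sums_single[of 0 "\<lambda>_. - K"]) auto
  moreover have "l ^ j / fact j * (\<integral>\<omega>. X \<omega> ^ (1 + j) \<partial>M) \<le>
     K * (fact (1 + j) / fact j * t ^ j) + (if j = 0 then - K else 0)" for j
  proof (cases "j = 0")
    case False
    then show ?thesis using series_term_bound[of l 1 j] l by (simp add: K_def t_def)
  qed (use mean_zero in auto)
  ultimately have "mexp 1 l \<le> K * (fact 1 / (1 - t) ^ (1 + 1)) + - K"
    using mexp_sums[OF l, of 1] by (rule sums_le[rotated 2])
  also have "\<dots> = K * (1 / (1 - t)\<^sup>2 - 1)" by (simp add: algebra_simps power2_eq_square)
  also have "1 / (1 - t)\<^sup>2 - 1 = 2 * t * ((1 - t / 2) / (1 - t)\<^sup>2)"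
  proof -
    have "1 / (1 - t)\<^sup>2 - 1 = (1 - (1 - t)\<^sup>2) / (1 - t)\<^sup>2"
      using t by (simp add: diff_divide_distrib)
    also have "1 - (1 - t)\<^sup>2 = 2 * t * (1 - t / 2)"
      by (simp add: power2_eq_square algebra_simps)
    finally show ?thesis by simp
  qed
  also have "K * (2 * t * ((1 - t / 2) / (1 - t)\<^sup>2)) = l * s2 * ((1 - t / 2) / (1 - t)\<^sup>2)"
    using \<epsilon>_pos by (simp add: K_def t_def power2_eq_square)
  finally show ?thesis by (simp add: t_def)
qed

lemma mexp1_ge:
  assumes l: "0 \<le> l" "l * \<epsilon> < 1" shows "l * s2 * (1 - 3/2 * (l * \<epsilon>)) \<le> mexp 1 l"
proof -
  have pt: "X \<omega> + l * (X \<omega>)\<^sup>2 + l\<^sup>2 / 2 * X \<omega> ^ 3 \<le> X \<omega> ^ 1 * exp (l * X \<omega>)" for \<omega>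
  proof (cases "l = 0")
    case False
    have "0 \<le> l * X \<omega> * (exp (l * X \<omega>) - 1 - l * X \<omega> - (l * X \<omega>)\<^sup>2 / 2)" by (rule exp_cubic_sign)
    then have "l * 0 \<le> l * (X \<omega> * (exp (l * X \<omega>) - 1 - l * X \<omega> - (l * X \<omega>)\<^sup>2 / 2))"
      by (simp only: mult.assoc mult_zero_right)
    then have "0 \<le> X \<omega> * (exp (l * X \<omega>) - 1 - l * X \<omega> - (l * X \<omega>)\<^sup>2 / 2)"
      by (rule mult_left_le_imp_le) (use False l in simp)
    then show ?thesis by (simp add: algebra_simps power2_eq_square power3_eq_cube)
  qed simp
  have "(\<integral>\<omega>. X \<omega> + l * (X \<omega>)\<^sup>2 + l\<^sup>2 / 2 * X \<omega> ^ 3 \<partial>M) \<le> mexp 1 l"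
    unfolding mexp_def using int_power[of 1] int_power[of 2] int_power[of 3] integrable_power_exp[OF l, of 1] pt
    by (intro integral_mono) auto
  moreover have "(\<integral>\<omega>. X \<omega> + l * (X \<omega>)\<^sup>2 + l\<^sup>2 / 2 * X \<omega> ^ 3 \<partial>M) = l * s2 + l\<^sup>2 / 2 * (\<integral>\<omega>. X \<omega> ^ 3 \<partial>M)"
    using int_power[of 1] int_power[of 2] int_power[of 3] mean_zero by (simp add: s2_def)
  moreover have "l\<^sup>2 / 2 * (- (3 * \<epsilon> * s2)) \<le> l\<^sup>2 / 2 * (\<integral>\<omega>. X \<omega> ^ 3 \<partial>M)"
    using moment_bound[of 3] by (intro mult_left_mono) (auto simp: fact_numeral)
  ultimately show ?thesis by (simp add: algebra_simps power2_eq_square)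
qed

lemma mexp2_ge:
  assumes l: "0 \<le> l" "l * \<epsilon> < 1" shows "s2 * (1 - 3 * (l * \<epsilon>)) \<le> mexp 2 l"
proof -
  have pt: "(X \<omega>)\<^sup>2 + l * X \<omega> ^ 3 \<le> X \<omega> ^ 2 * exp (l * X \<omega>)" for \<omega>
    using mult_left_mono[OF exp_ge_add_one_self[of "l * X \<omega>"], of "(X \<omega>)\<^sup>2"]
    by (simp add: algebra_simps power2_eq_square power3_eq_cube)
  have "(\<integral>\<omega>. (X \<omega>)\<^sup>2 + l * X \<omega> ^ 3 \<partial>M) \<le> mexp 2 l"
    unfolding mexp_def using int_power[of 2] int_power[of 3] integrable_power_exp[OF l, of 2] pt
    by (intro integral_mono) auto
  moreover have "(\<integral>\<omega>. (X \<omega>)\<^sup>2 + l * X \<omega> ^ 3 \<partial>M) = s2 + l * (\<integral>\<omega>. X \<omega> ^ 3 \<partial>M)"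
    using int_power[of 2] int_power[of 3] by (simp add: s2_def)
  moreover have "l * (- (3 * \<epsilon> * s2)) \<le> l * (\<integral>\<omega>. X \<omega> ^ 3 \<partial>M)"
    using moment_bound[of 3] l by (intro mult_left_mono) (auto simp: fact_numeral)
  ultimately show ?thesis by (simp add: algebra_simps)
qed

end

section \<open>Exponentially tilted laws\<close>

text \<open>The Esscher transform, recentred at \<open>b\<close> and rescaled by \<open>c\<close>.
  With one common \<open>c\<close> it serves the sum and its summands alike, so that their
  characteristic functions match.\<close>

definition tilt_law :: "'a measure \<Rightarrow> ('a \<Rightarrow> real) \<Rightarrow> real \<Rightarrow> real \<Rightarrow> real \<Rightarrow> real measure" where
  "tilt_law M X l b c =
    distr (density M (\<lambda>\<omega>. ennreal (exp (l * X \<omega>) / (\<integral>\<omega>. exp (l * X \<omega>) \<partial>M)))) borel (\<lambda>\<omega>. (X \<omega> - b) / c)"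

context prob_space
begin

lemma expectation_exp_pos:
  assumes "integrable M (\<lambda>\<omega>. exp (l * X \<omega>))" shows "0 < (\<integral>\<omega>. exp (l * X \<omega>) \<partial>M :: real)"
  using integral_less_AE_space[of "\<lambda>_. 0" "\<lambda>\<omega>. exp (l * X \<omega>)"] assms emeasure_space_1 by simp

lemma real_distribution_tilt_law:
  assumes [measurable]: "X \<in> borel_measurable M" and int: "integrable M (\<lambda>\<omega>. exp (l * X \<omega>))"
  shows "real_distribution (tilt_law M X l b c)"
proof -
  let ?m = "\<integral>\<omega>. exp (l * X \<omega>) \<partial>M"
  have m: "0 < ?m" by (rule expectation_exp_pos[OF int])
  have "emeasure (density M (\<lambda>\<omega>. ennreal (exp (l * X \<omega>) / ?m))) (space M) = (\<integral>\<^sup>+ \<omega>. ennreal (exp (l * X \<omega>) / ?m) \<partial>M)"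
    by (subst emeasure_density) (auto intro!: nn_integral_cong simp: indicator_def)
  also have "\<dots> = ennreal (\<integral>\<omega>. exp (l * X \<omega>) / ?m \<partial>M)"
    using int m by (intro nn_integral_eq_integral) auto
  finally interpret T: prob_space "density M (\<lambda>\<omega>. ennreal (exp (l * X \<omega>) / ?m))"
    using m by (intro prob_spaceI) simp
  show ?thesis unfolding tilt_law_def
    by (rule T.real_distribution_distr) simp
qed

text \<open>Vector-valued \<open>f\<close> lets the same change of measure compute real moments and
  complex characteristic functions.\<close>

lemma
  fixes f :: "real \<Rightarrow> 'b::{banach, second_countable_topology}"
  assumes [measurable]: "X \<in> borel_measurable M" "f \<in> borel_measurable borel"
    and int: "integrable M (\<lambda>\<omega>. exp (l * X \<omega>))"
  shows integral_tilt_law: "(\<integral>y. f y \<partial>tilt_law M X l b c) =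
      (\<integral>\<omega>. exp (l * X \<omega>) *\<^sub>R f ((X \<omega> - b) / c) \<partial>M) /\<^sub>R (\<integral>\<omega>. exp (l * X \<omega>) \<partial>M)"
    and integrable_tilt_law: "integrable (tilt_law M X l b c) f \<longleftrightarrow>
      integrable M (\<lambda>\<omega>. exp (l * X \<omega>) *\<^sub>R f ((X \<omega> - b) / c))"
proof -
  let ?m = "\<integral>\<omega>. exp (l * X \<omega>) \<partial>M"
  have m: "0 < ?m" by (rule expectation_exp_pos[OF int])
  have eq: "(exp (l * X \<omega>) / ?m) *\<^sub>R f ((X \<omega> - b) / c) = (1 / ?m) *\<^sub>R (exp (l * X \<omega>) *\<^sub>R f ((X \<omega> - b) / c))" for \<omega>
    by simp
  have sc: "integrable M (\<lambda>\<omega>. k *\<^sub>R g \<omega>) \<longleftrightarrow> integrable M g" if "k \<noteq> 0" for k :: real and g :: "'a \<Rightarrow> 'b"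
  proof
    assume "integrable M (\<lambda>\<omega>. k *\<^sub>R g \<omega>)"
    then show "integrable M g"
      using integrable_scaleR_right[of "1 / k" M "\<lambda>\<omega>. k *\<^sub>R g \<omega>"] that by simp
  qed simp
  have "(\<integral>y. f y \<partial>tilt_law M X l b c) = (\<integral>\<omega>. (exp (l * X \<omega>) / ?m) *\<^sub>R f ((X \<omega> - b) / c) \<partial>M)"
    unfolding tilt_law_def using m by (subst integral_distr; (subst integral_density)?) auto
  then show "(\<integral>y. f y \<partial>tilt_law M X l b c) = (\<integral>\<omega>. exp (l * X \<omega>) *\<^sub>R f ((X \<omega> - b) / c) \<partial>M) /\<^sub>R ?m"
    unfolding eq by (simp only: integral_scaleR_right inverse_eq_divide)
  have "integrable (tilt_law M X l b c) f \<longleftrightarrow> integrable M (\<lambda>\<omega>. (exp (l * X \<omega>) / ?m) *\<^sub>R f ((X \<omega> - b) / c))"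
    unfolding tilt_law_def using m by (subst integrable_distr_eq; (subst integrable_density)?) auto
  then show "integrable (tilt_law M X l b c) f \<longleftrightarrow> integrable M (\<lambda>\<omega>. exp (l * X \<omega>) *\<^sub>R f ((X \<omega> - b) / c))"
    unfolding eq using m by (subst (asm) sc) auto
qed

end

text \<open>Here \<open>t = \<lambda>\<epsilon>\<close>; the range is what \<open>x < \<sigma> / (12\<epsilon>)\<close> allows at the saddle point.\<close>

context
  fixes t :: real assumes t: "0 \<le> t" "t \<le> 11/100"
begin

text \<open>Tangent to the parabola at the right endpoint 11/100, where the polynomials to be shown
  nonnegative below are smallest; it makes these inequalities linear or nearly so.\<close>

lemma quadratic_tangent: "22/100 * t - 121/10000 \<le> t\<^sup>2"
  using sum_squares_ge_zero[of "t - 11/100" 0] by (simp add: power2_eq_square algebra_simps)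

text \<open>The slope at 0 is 3/2; 176/100 slightly exceeds the slope of the chord to
  \<open>t = 11/100\<close>.\<close>

lemma mean_upper_numeric: "(1 - t / 2) / (1 - t)\<^sup>2 \<le> 1 + 176/100 * t"
proof -
  have "0 \<le> t * (26 - 252 * t + 176 * t\<^sup>2) / 100"
    using quadratic_tangent t by (intro divide_nonneg_nonneg mult_nonneg_nonneg) auto
  moreover have "(1 + 176/100 * t) * (1 - t)\<^sup>2 - (1 - t / 2) = t * (26 - 252 * t + 176 * t\<^sup>2) / 100"
    by (simp add: power2_eq_square field_simps)
  ultimately have "1 - t / 2 \<le> (1 + 176/100 * t) * (1 - t)\<^sup>2" by linarith
  then show ?thesis using t by (simp add: pos_divide_le_eq)
qed

text \<open>Stated as the square of the factor in \<open>mean_upper_numeric\<close>, so that after a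
  square root the standard deviation and the mean share one upper factor.\<close>

lemma variance_upper_numeric: "1 / (1 - t) ^ 3 \<le> (1 + 176/100 * t)\<^sup>2"
proof -
  have 1: "0 \<le> t * (52/100 - 44624/10000 * t)" using t by (intro mult_nonneg_nonneg) auto
  have "t * t \<le> 11/100 * t" using t by (intro mult_right_mono) auto
  then have 2: "0 \<le> t * (t * (t * (2672/10000 + 57728/10000 * t - 30976/10000 * (t * t))))" using t by (intro mult_nonneg_nonneg) auto
  have "1 \<le> 1 + t * (52/100 - 44624/10000 * t) + t * (t * (t * (2672/10000 + 57728/10000 * t - 30976/10000 * (t * t))))"
    using 1 2 by linarith
  also have "\<dots> = (1 + 176/100 * t)\<^sup>2 * (1 - t) ^ 3"
    by (simp add: power2_eq_square power3_eq_cube field_simps)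
  finally show ?thesis using t by (simp add: pos_divide_le_eq)
qed

lemma mgf_numeric: "1 + 6 * t\<^sup>2 / (1 - t) = (1 - t + 6 * t\<^sup>2) / (1 - t)" "0 < 1 - t + 6 * t\<^sup>2"
proof -
  show "1 + 6 * t\<^sup>2 / (1 - t) = (1 - t + 6 * t\<^sup>2) / (1 - t)" using t by (simp add: field_simps)
  show "0 < 1 - t + 6 * t\<^sup>2" using t zero_le_power2[of t] by linarith
qed

lemma mean_lower_numeric: "1 - 21/10 * t \<le> (1 - 3/2 * t) / (1 + 6 * t\<^sup>2 / (1 - t))"
proof -
  have "0 \<le> t * (6 - 66 * t + 126 * t\<^sup>2) / 10"
    using quadratic_tangent t by (intro divide_nonneg_nonneg mult_nonneg_nonneg) auto
  moreover have "(1 - 3/2 * t) * (1 - t) - (1 - 21/10 * t) * (1 - t + 6 * t\<^sup>2) = t * (6 - 66 * t + 126 * t\<^sup>2) / 10"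
    by (simp add: power2_eq_square field_simps)
  ultimately have "(1 - 21/10 * t) * (1 - t + 6 * t\<^sup>2) \<le> (1 - 3/2 * t) * (1 - t)" by linarith
  then show ?thesis
    unfolding mgf_numeric(1) using t mgf_numeric(2) by (simp add: pos_le_divide_eq)
qed

lemma variance_lower_numeric:
  "1 - 56/10 * t \<le> (1 - 3 * t) / (1 + 6 * t\<^sup>2 / (1 - t)) - 12 * t\<^sup>2 * (1 + 176/100 * t)\<^sup>2"
proof -
  \<comment> \<open>This is the difference of the two sides of the next inequality.\<close>
  have "0 \<le> 12 * t ^ 3 * (1 + 3 * t)" using t by (intro mult_nonneg_nonneg) auto
  then have "(1 - 3 * t - 6 * t\<^sup>2) * (1 - t + 6 * t\<^sup>2) \<le> (1 - 3 * t) * (1 - t)"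
    by (simp add: power2_eq_square power3_eq_cube algebra_simps)
  then have "1 - 3 * t - 6 * t\<^sup>2 \<le> (1 - 3 * t) / (1 + 6 * t\<^sup>2 / (1 - t))"
    unfolding mgf_numeric(1) using t mgf_numeric(2) by (simp add: pos_le_divide_eq)
  moreover have "12 * t\<^sup>2 * (1 + 176/100 * t)\<^sup>2 \<le> 12 * t\<^sup>2 * (12/10)\<^sup>2"
    using t by (intro mult_left_mono power_mono) auto
  then have "12 * t\<^sup>2 * (1 + 176/100 * t)\<^sup>2 \<le> 1728/100 * t\<^sup>2"
    by (rule order_trans) (simp add: power2_eq_square)
  moreover have "t\<^sup>2 \<le> 11/100 * t" unfolding power2_eq_square using t by (intro mult_right_mono) auto
  ultimately show ?thesis using t by linarith
qed

text \<open>The first summand combines \<open>mexp4_le\<close> with the convexity loss at weight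
  \<open>3 * t\<close>. The second is the fourth power of the tilted mean over
  \<open>(3 * t) ^ 3\<close>, where \<open>16/3 = 12 ^ 3 / (27 * 12)\<close>.\<close>

lemma fourth_numeric:
  "1 / ((1 - t) ^ 5 * (1 - 3 * t) ^ 3) + 16/3 * t * (1 + 176/100 * t) ^ 4 \<le> 1 + 575/10 * t"
proof -
  have tt: "t * t \<le> 11/100 * t" using t by (intro mult_right_mono) auto
  have "1 \<le> (1 + 74/10 * t) * (1 - 5 * t + 10 * t\<^sup>2 - 10 * t ^ 3)"
  proof -
    have "74 * t * (t * t) \<le> 814/100 * (t * t)"
      using t by (intro mult_right_mono) auto
    then have "0 \<le> 24/10 - 27 * t + 64 * t\<^sup>2 - 74 * t ^ 3"
      using quadratic_tangent t by (simp add: power2_eq_square power3_eq_cube)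
    then have "0 \<le> t * (24/10 - 27 * t + 64 * t\<^sup>2 - 74 * t ^ 3)" using t by simp
    then show ?thesis by (simp add: algebra_simps power2_eq_square power3_eq_cube)
  qed
  also have "\<dots> \<le> (1 + 74/10 * t) * (1 - t) ^ 5"
  proof (intro mult_left_mono)
    have "0 \<le> t ^ 4 * (5 - t)" using t by (intro mult_nonneg_nonneg) auto
    then show "1 - 5 * t + 10 * t\<^sup>2 - 10 * t ^ 3 \<le> (1 - t) ^ 5"
      by (simp add: algebra_simps eval_nat_numeral)
  qed (use t in auto)
  finally have A: "1 / (1 - t) ^ 5 \<le> 1 + 74/10 * t"
    using t by (simp add: pos_divide_le_eq)
  have "1 \<le> (1 + 216/10 * t) * (1 - 3 * t) ^ 3"
  proof -
    have "5832 * t * (t * t) \<le> 642 * (t * t)"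
      using t by (intro mult_right_mono) auto
    then have "0 \<le> 126 - 1674 * t + 5562 * t\<^sup>2 - 5832 * t ^ 3"
      using quadratic_tangent t by (simp add: power2_eq_square power3_eq_cube)
    then have "0 \<le> t * (126 - 1674 * t + 5562 * t\<^sup>2 - 5832 * t ^ 3)" using t by simp
    then show ?thesis by (simp add: algebra_simps power2_eq_square power3_eq_cube)
  qed
  then have B: "1 / (1 - 3 * t) ^ 3 \<le> 1 + 216/10 * t"
    using t by (simp add: pos_divide_le_eq)
  have "1 / ((1 - t) ^ 5 * (1 - 3 * t) ^ 3) \<le> (1 + 74/10 * t) * (1 + 216/10 * t)"
    using mult_mono[OF A B] t by simp
  also have "\<dots> \<le> 1 + 466/10 * t"
    using tt t by (simp add: algebra_simps)
  finally have "1 / ((1 - t) ^ 5 * (1 - 3 * t) ^ 3) \<le> 1 + 466/10 * t" .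
  moreover have "(1 + 176/100 * t) ^ 4 \<le> (11936/10000) ^ 4"
    using t by (intro power_mono) auto
  then have "16/3 * t * (1 + 176/100 * t) ^ 4 \<le> 16/3 * t * (11936/10000) ^ 4"
    using t by (intro mult_left_mono) auto
  moreover have "16/3 * t * (11936/10000) ^ 4 \<le> 109/10 * t"
    using t by (simp add: power4_eq_xxxx)
  ultimately show ?thesis using t by linarith
qed

text \<open>Converts the fourth moment bound, proportional to \<open>s2\<close>, into the form of
  \<open>small_summand\<close>: one factor \<open>1 - 56/10 * t\<close> turns \<open>s2\<close> into
  the tilted variance, the other is kept to cancel against the lower bound for the total variance,
  and \<open>1 + 57 * t\<close> remains in \<open>d\<close>.\<close>

lemma fourth_variance_numeric: "1 + 575/10 * t \<le> ((1 - 56/10 * t) * (1 + 57 * t))\<^sup>2"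
proof -
  define k where "k = 514/10 - 3192/10 * t"
  have k0: "0 \<le> k" using t by (simp add: k_def)
  have "575/10 \<le> 2 * k + k * k * t"
  proof -
    \<comment> \<open>Since \<open>k\<close> decreases from about 51 to about 16,
      \<open>2 * k\<close> alone suffices for small \<open>t\<close>. Further right
      \<open>k * k * t\<close> has to help, estimated by the smallest \<open>k\<close> and the
      smallest \<open>t\<close> of each subrange.\<close>
    consider "t \<le> 6/100" | "6/100 \<le> t" "t \<le> 1/10" | "1/10 \<le> t" by linarith
    then show ?thesis
    proof cases
      case 1
      have "0 \<le> k * k * t" using k0 t by simp
      then show ?thesis using 1 by (simp add: k_def)
    next
      case 2
      have k: "1948/100 \<le> k" using 2 by (simp add: k_def)
      have "1948/100 * (1948/100) * (6/100) \<le> k * k * t" using k 2 by (intro mult_mono) auto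
      then show ?thesis using k by simp
    next
      case 3
      have k: "16288/1000 \<le> k" using t by (simp add: k_def)
      have "16288/1000 * (16288/1000) * (1/10) \<le> k * k * t" using k 3 by (intro mult_mono) auto
      then show ?thesis using k by simp
    qed
  qed
  then have "t * (575/10) \<le> t * (2 * k + k * k * t)" using t by (intro mult_left_mono) auto
  moreover have "(1 - 56/10 * t) * (1 + 57 * t) = 1 + t * k"
    by (simp add: k_def field_simps)
  moreover have "(1 + t * k)\<^sup>2 = 1 + t * (2 * k + k * k * t)"
    by (simp add: algebra_simps power2_eq_square)
  ultimately show ?thesis by (simp add: mult.commute)
qed

lemma sqrt_variance_numeric: "1 - 35/10 * t \<le> sqrt (1 - 56/10 * t)"
proof (rule real_le_rsqrt)
  have "t * (1225/100 * t) \<le> t * (14/10)" using t by (intro mult_left_mono) auto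
  then show "(1 - 35/10 * t)\<^sup>2 \<le> 1 - 56/10 * t" by (simp add: power2_eq_square algebra_simps)
qed

end

section \<open>Mean, variance and fourth moment of a tilted Bernstein variable\<close>

context bernstein_variable
begin

lemma integrable_exp: "0 \<le> l \<Longrightarrow> l * \<epsilon> < 1 \<Longrightarrow> integrable M (\<lambda>\<omega>. exp (l * X \<omega>))"
  using integrable_power_exp[of l 0] by simp

text \<open>The first derivative of the cumulant generating function, as \<open>tvar\<close> is the
  second; the saddle point equation therefore asks for a prescribed sum of the \<open>tmean\<close>
  values.\<close>

definition tmean where "tmean l = mexp 1 l / mexp 0 l"
definition tvar where "tvar l = mexp 2 l / mexp 0 l - (tmean l)\<^sup>2"

context
  fixes l :: real assumes l: "0 \<le> l" and le: "l * \<epsilon> \<le> 11/100"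
begin

private lemma t: "0 \<le> l * \<epsilon>" "l * \<epsilon> \<le> 11/100" and l1: "l * \<epsilon> < 1"
  using l le \<epsilon>_pos by auto

private lemma l2s2: "l\<^sup>2 * s2 \<le> 12 * (l * \<epsilon>)\<^sup>2"
  using mult_left_mono[OF s2_le, of "l\<^sup>2"] by (simp add: power_mult_distrib)

lemma mexp0_bounds: "1 \<le> mexp 0 l" "mexp 0 l \<le> 1 + 6 * (l * \<epsilon>)\<^sup>2 / (1 - l * \<epsilon>)"
proof -
  show "1 \<le> mexp 0 l" by (rule mexp0_ge[OF l l1])
  have "l\<^sup>2 * s2 / (2 * (1 - l * \<epsilon>)) \<le> 12 * (l * \<epsilon>)\<^sup>2 / (2 * (1 - l * \<epsilon>))"
    using l2s2 l1 by (intro divide_right_mono) auto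
  also have "12 * z / (2 * w) = 6 * z / w" for z w :: real by simp
  finally show "mexp 0 l \<le> 1 + 6 * (l * \<epsilon>)\<^sup>2 / (1 - l * \<epsilon>)"
    using mexp0_le[OF l l1] by linarith
qed

lemma mexp1_bounds: "0 \<le> mexp 1 l" "mexp 1 l \<le> l * s2 * (1 + 176/100 * (l * \<epsilon>))"
proof -
  show "mexp 1 l \<le> l * s2 * (1 + 176/100 * (l * \<epsilon>))"
    by (rule order_trans[OF mexp1_le[OF l l1] mult_left_mono[OF mean_upper_numeric[OF t]]]) (use l s2_nonneg in auto)
  have "0 \<le> l * s2 * (1 - 3/2 * (l * \<epsilon>))" using l s2_nonneg t by (intro mult_nonneg_nonneg) auto
  then show "0 \<le> mexp 1 l" using mexp1_ge[OF l l1] by linarith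
qed

lemma tmean_upper: "tmean l \<le> l * s2 * (1 + 176/100 * (l * \<epsilon>))" and tmean_nonneg: "0 \<le> tmean l"
proof -
  have "tmean l \<le> mexp 1 l"
    unfolding tmean_def using mexp0_bounds mexp1_bounds by (simp add: divide_le_eq mult_left_le mult_le_cancel_left1)
  then show "tmean l \<le> l * s2 * (1 + 176/100 * (l * \<epsilon>))" using mexp1_bounds by linarith
  show "0 \<le> tmean l" unfolding tmean_def using mexp0_bounds mexp1_bounds by simp
qed

lemma tmean_lower: "l * s2 * (1 - 21/10 * (l * \<epsilon>)) \<le> tmean l"
proof -
  have "l * s2 * (1 - 21/10 * (l * \<epsilon>)) \<le> l * s2 * ((1 - 3/2 * (l * \<epsilon>)) / (1 + 6 * (l * \<epsilon>)\<^sup>2 / (1 - l * \<epsilon>)))"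
    using mean_lower_numeric[OF t] l s2_nonneg by (intro mult_left_mono) auto
  also have "\<dots> = (l * s2 * (1 - 3/2 * (l * \<epsilon>))) / (1 + 6 * (l * \<epsilon>)\<^sup>2 / (1 - l * \<epsilon>))" by simp
  also have "\<dots> \<le> mexp 1 l / mexp 0 l"
    using mexp1_ge[OF l l1] mexp0_bounds mexp1_bounds by (intro frac_le) auto
  finally show ?thesis by (simp add: tmean_def)
qed

lemma tvar_upper: "tvar l \<le> s2 * (1 + 176/100 * (l * \<epsilon>))\<^sup>2"
proof -
  have m2: "0 \<le> mexp 2 l" by (simp add: mexp_def)
  have "tvar l \<le> mexp 2 l / mexp 0 l" by (simp add: tvar_def)
  also have "\<dots> \<le> mexp 2 l" using mexp0_bounds m2 by (simp add: divide_le_eq mult_left_le mult_le_cancel_left1)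
  also have "\<dots> \<le> s2 * (1 / (1 - l * \<epsilon>) ^ 3)" using mexp2_le[OF l l1] by simp
  also have "\<dots> \<le> s2 * (1 + 176/100 * (l * \<epsilon>))\<^sup>2" by (intro mult_left_mono variance_upper_numeric t s2_nonneg)
  finally show ?thesis .
qed

lemma tvar_lower: "s2 * (1 - 56/10 * (l * \<epsilon>)) \<le> tvar l"
proof -
  have "(tmean l)\<^sup>2 \<le> (l * s2 * (1 + 176/100 * (l * \<epsilon>)))\<^sup>2"
    using tmean_upper tmean_nonneg by (intro power_mono) auto
  also have "\<dots> = s2 * (l\<^sup>2 * s2 * (1 + 176/100 * (l * \<epsilon>))\<^sup>2)" by (simp add: power_mult_distrib power2_eq_square)
  also have "\<dots> \<le> s2 * (12 * (l * \<epsilon>)\<^sup>2 * (1 + 176/100 * (l * \<epsilon>))\<^sup>2)"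
    using l2s2 s2_nonneg by (intro mult_left_mono mult_right_mono) auto
  finally have 1: "(tmean l)\<^sup>2 \<le> s2 * (12 * (l * \<epsilon>)\<^sup>2 * (1 + 176/100 * (l * \<epsilon>))\<^sup>2)" .
  have "s2 * ((1 - 3 * (l * \<epsilon>)) / (1 + 6 * (l * \<epsilon>)\<^sup>2 / (1 - l * \<epsilon>))) = (s2 * (1 - 3 * (l * \<epsilon>))) / (1 + 6 * (l * \<epsilon>)\<^sup>2 / (1 - l * \<epsilon>))"
    by simp
  also have "\<dots> \<le> mexp 2 l / mexp 0 l"
    using mexp2_ge[OF l l1] mexp0_bounds by (intro frac_le) (auto simp: mexp_def)
  finally have 2: "s2 * ((1 - 3 * (l * \<epsilon>)) / (1 + 6 * (l * \<epsilon>)\<^sup>2 / (1 - l * \<epsilon>))) \<le> mexp 2 l / mexp 0 l" .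
  have "s2 * (1 - 56/10 * (l * \<epsilon>)) \<le> s2 * ((1 - 3 * (l * \<epsilon>)) / (1 + 6 * (l * \<epsilon>)\<^sup>2 / (1 - l * \<epsilon>)) - 12 * (l * \<epsilon>)\<^sup>2 * (1 + 176/100 * (l * \<epsilon>))\<^sup>2)"
    by (intro mult_left_mono variance_lower_numeric t s2_nonneg)
  also have "\<dots> \<le> tvar l"
    unfolding tvar_def right_diff_distrib using 1 2 by (intro diff_mono)
  finally show ?thesis .
qed

lemma integrable_centred4: "integrable M (\<lambda>\<omega>. exp (l * X \<omega>) * (X \<omega> - b) ^ 4)"
proof -
  have "exp (l * X \<omega>) * (X \<omega> - b) ^ 4 = X \<omega> ^ 4 * exp (l * X \<omega>) - 4 * b * (X \<omega> ^ 3 * exp (l * X \<omega>))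
     + 6 * b\<^sup>2 * (X \<omega> ^ 2 * exp (l * X \<omega>)) - 4 * b ^ 3 * (X \<omega> ^ 1 * exp (l * X \<omega>)) + b ^ 4 * (X \<omega> ^ 0 * exp (l * X \<omega>))" for \<omega>
    by (simp add: algebra_simps power2_eq_square power3_eq_cube power4_eq_xxxx)
  then show ?thesis
    using integrable_power_exp[OF l l1]
    by (simp only:) (intro Bochner_Integration.integrable_add Bochner_Integration.integrable_diff integrable_mult_right)
qed

lemma centred4_le: "(\<integral>\<omega>. exp (l * X \<omega>) * (X \<omega> - tmean l) ^ 4 \<partial>M) / mexp 0 l \<le> 12 * \<epsilon>\<^sup>2 * (1 + 575/10 * (l * \<epsilon>)) * s2"
proof (cases "l = 0")
  \<comment> \<open>The convexity weight \<open>3 * l * \<epsilon>\<close> used below must be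
    positive, so zero tilt is handled directly by the untilted fourth moment.\<close>
  case True
  have "tmean 0 = 0" using mean_zero by (simp add: tmean_def mexp_def)
  then show ?thesis using True moment_bound[of 4] prob_space by (simp add: mexp_def fact_numeral)
next
  case False
  define u where "u = 3 * (l * \<epsilon>)"
  have tp: "0 < l * \<epsilon>" using False l \<epsilon>_pos by simp
  then have u: "0 < u" "u < 1" using t by (auto simp: u_def)
  have m0: "0 < mexp 0 l" "1 \<le> mexp 0 l" using mexp0_bounds by auto
  have i: "integrable M (\<lambda>\<omega>. X \<omega> ^ 4 * exp (l * X \<omega>) * (1 / (1 - u) ^ 3) + X \<omega> ^ 0 * exp (l * X \<omega>) * (tmean l ^ 4 / u ^ 3))"
    using integrable_power_exp[OF l l1] by (intro Bochner_Integration.integrable_add integrable_mult_left)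
  have m4: "0 \<le> mexp 4 l" by (simp add: mexp_def)
  have "(\<integral>\<omega>. exp (l * X \<omega>) * (X \<omega> - tmean l) ^ 4 \<partial>M)
    \<le> (\<integral>\<omega>. X \<omega> ^ 4 * exp (l * X \<omega>) * (1 / (1 - u) ^ 3) + X \<omega> ^ 0 * exp (l * X \<omega>) * (tmean l ^ 4 / u ^ 3) \<partial>M)"
  proof (rule integral_mono[OF integrable_centred4 i])
    fix \<omega>
    show "exp (l * X \<omega>) * (X \<omega> - tmean l) ^ 4 \<le> X \<omega> ^ 4 * exp (l * X \<omega>) * (1 / (1 - u) ^ 3) + X \<omega> ^ 0 * exp (l * X \<omega>) * (tmean l ^ 4 / u ^ 3)"
      using mult_left_mono[OF power4_diff_le[OF u, of "X \<omega>" "tmean l"], of "exp (l * X \<omega>)"]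
      by (simp add: algebra_simps)
  qed
  also have "\<dots> = mexp 4 l * (1 / (1 - u) ^ 3) + mexp 0 l * (tmean l ^ 4 / u ^ 3)"
    using integrable_power_exp[OF l l1, of 4] integrable_power_exp[OF l l1, of 0]
    unfolding mexp_def by (subst Bochner_Integration.integral_add) (auto intro!: integrable_divide)
  finally have "(\<integral>\<omega>. exp (l * X \<omega>) * (X \<omega> - tmean l) ^ 4 \<partial>M) / mexp 0 l \<le> (mexp 4 l * (1 / (1 - u) ^ 3) + mexp 0 l * (tmean l ^ 4 / u ^ 3)) / mexp 0 l"
    using m0 by (intro divide_right_mono) auto
  also have "\<dots> = mexp 4 l / mexp 0 l * (1 / (1 - u) ^ 3) + tmean l ^ 4 / u ^ 3"
    using m0 by (simp add: add_divide_distrib)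
  also have "\<dots> \<le> 12 * s2 * \<epsilon>\<^sup>2 / (1 - l * \<epsilon>) ^ 5 * (1 / (1 - u) ^ 3) + 12 * s2 * \<epsilon>\<^sup>2 * (16/3 * (l * \<epsilon>) * (1 + 176/100 * (l * \<epsilon>)) ^ 4)"
  proof (intro add_mono mult_right_mono)
    have "mexp 4 l / mexp 0 l \<le> mexp 4 l"
      using m0 m4 by (simp add: divide_le_eq mult_le_cancel_left1)
    then show "mexp 4 l / mexp 0 l \<le> 12 * s2 * \<epsilon>\<^sup>2 / (1 - l * \<epsilon>) ^ 5"
      using mexp4_le[OF l l1] by linarith
    \<comment> \<open>Three of the four factors \<open>s2\<close> are traded for powers of
      \<open>\<epsilon>\<close>; the last is kept so that the bound remains proportional to the
      variance.\<close>
    have s23: "s2 ^ 3 \<le> (12 * \<epsilon>\<^sup>2) ^ 3" using s2_le s2_nonneg by (intro power_mono)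
    have "tmean l ^ 4 \<le> (l * s2 * (1 + 176/100 * (l * \<epsilon>))) ^ 4"
      using tmean_upper tmean_nonneg by (intro power_mono) auto
    also have "\<dots> = l ^ 4 * s2 * (1 + 176/100 * (l * \<epsilon>)) ^ 4 * s2 ^ 3"
      by (simp add: power_mult_distrib eval_nat_numeral)
    also have "\<dots> \<le> l ^ 4 * s2 * (1 + 176/100 * (l * \<epsilon>)) ^ 4 * (12 * \<epsilon>\<^sup>2) ^ 3"
      using s23 s2_nonneg by (intro mult_left_mono) auto
    also have "\<dots> = 12 * s2 * \<epsilon>\<^sup>2 * (16/3 * (l * \<epsilon>) * (1 + 176/100 * (l * \<epsilon>)) ^ 4) * u ^ 3"
      by (simp add: u_def power_mult_distrib eval_nat_numeral)
    finally show "tmean l ^ 4 / u ^ 3 \<le> 12 * s2 * \<epsilon>\<^sup>2 * (16/3 * (l * \<epsilon>) * (1 + 176/100 * (l * \<epsilon>)) ^ 4)"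
      using u by (simp add: pos_divide_le_eq)
  qed (use u in auto)
  also have "\<dots> = 12 * s2 * \<epsilon>\<^sup>2 * (1 / ((1 - l * \<epsilon>) ^ 5 * (1 - 3 * (l * \<epsilon>)) ^ 3) + 16/3 * (l * \<epsilon>) * (1 + 176/100 * (l * \<epsilon>)) ^ 4)"
    by (simp add: u_def distrib_left)
  also have "\<dots> \<le> 12 * s2 * \<epsilon>\<^sup>2 * (1 + 575/10 * (l * \<epsilon>))"
    using s2_nonneg by (intro mult_left_mono fourth_numeric t) auto
  finally show ?thesis by (simp add: mult_ac)
qed

text \<open>The parameter depends on the tilt, \<open>\<epsilon>\<close> and \<open>c\<close> only,
  hence is common to all summands. Its factor \<open>sqrt (1 - 56/10 * (l * \<epsilon>))\<close>
  cancels later, because \<open>c\<close> is at least \<open>\<sigma>\<close> times the same square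
  root.\<close>

lemma small_summand_tilt:
  assumes c: "0 < c"
  shows "small_summand (tilt_law M X l (tmean l) c) (tvar l / c\<^sup>2)
    (sqrt 12 * \<epsilon> * (1 + 57 * (l * \<epsilon>)) * sqrt (1 - 56/10 * (l * \<epsilon>)) / c)"
proof -
  let ?T = "tilt_law M X l (tmean l) c"
  interpret T: real_distribution ?T
    by (rule real_distribution_tilt_law[OF X integrable_exp[OF l l1]])
  have m0: "0 < mexp 0 l" using mexp0_bounds by linarith
  have m0': "(\<integral>\<omega>. exp (l * X \<omega>) \<partial>M) = mexp 0 l" by (simp add: mexp_def)
  note I = integral_tilt_law[OF X _ integrable_exp[OF l l1], of _ "tmean l" c, unfolded m0']
  have 1: "(\<integral>y. y \<partial>?T) = 0"
  proof -
    have e: "exp (l * X \<omega>) *\<^sub>R ((X \<omega> - tmean l) / c) = (X \<omega> ^ 1 * exp (l * X \<omega>) - tmean l * (X \<omega> ^ 0 * exp (l * X \<omega>))) / c" for \<omega>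
      by (simp add: algebra_simps diff_divide_distrib)
    have "(\<integral>y. y \<partial>?T) = (\<integral>\<omega>. (X \<omega> ^ 1 * exp (l * X \<omega>) - tmean l * (X \<omega> ^ 0 * exp (l * X \<omega>))) / c \<partial>M) /\<^sub>R mexp 0 l"
      by (subst I) (simp_all only: e, measurable)
    also have "(\<integral>\<omega>. (X \<omega> ^ 1 * exp (l * X \<omega>) - tmean l * (X \<omega> ^ 0 * exp (l * X \<omega>))) / c \<partial>M) = (mexp 1 l - tmean l * mexp 0 l) / c"
      using integrable_power_exp[OF l l1, of 1] integrable_power_exp[OF l l1, of 0] unfolding mexp_def by simp
    finally have "(\<integral>y. y \<partial>?T) = ((mexp 1 l - tmean l * mexp 0 l) / c) /\<^sub>R mexp 0 l" .
    then show ?thesis using m0 by (simp add: tmean_def)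
  qed
  have 2: "(\<integral>y. y\<^sup>2 \<partial>?T) = tvar l / c\<^sup>2"
  proof -
    have e: "exp (l * X \<omega>) *\<^sub>R ((X \<omega> - tmean l) / c)\<^sup>2 = (X \<omega> ^ 2 * exp (l * X \<omega>) - 2 * tmean l * (X \<omega> ^ 1 * exp (l * X \<omega>)) + (tmean l)\<^sup>2 * (X \<omega> ^ 0 * exp (l * X \<omega>))) / c\<^sup>2" for \<omega>
      by (simp add: power_divide power2_diff algebra_simps)
    have "(\<integral>y. y\<^sup>2 \<partial>?T) = (\<integral>\<omega>. (X \<omega> ^ 2 * exp (l * X \<omega>) - 2 * tmean l * (X \<omega> ^ 1 * exp (l * X \<omega>)) + (tmean l)\<^sup>2 * (X \<omega> ^ 0 * exp (l * X \<omega>))) / c\<^sup>2 \<partial>M) /\<^sub>R mexp 0 l"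
      by (subst I) (simp_all only: e, measurable)
    also have "(\<integral>\<omega>. (X \<omega> ^ 2 * exp (l * X \<omega>) - 2 * tmean l * (X \<omega> ^ 1 * exp (l * X \<omega>)) + (tmean l)\<^sup>2 * (X \<omega> ^ 0 * exp (l * X \<omega>))) / c\<^sup>2 \<partial>M) = (mexp 2 l - 2 * tmean l * mexp 1 l + (tmean l)\<^sup>2 * mexp 0 l) / c\<^sup>2"
      using integrable_power_exp[OF l l1, of 2] integrable_power_exp[OF l l1, of 1] integrable_power_exp[OF l l1, of 0] unfolding mexp_def by simp
    also have "\<dots> /\<^sub>R mexp 0 l = ((mexp 2 l - 2 * tmean l * mexp 1 l + (tmean l)\<^sup>2 * mexp 0 l) / mexp 0 l) / c\<^sup>2" by (simp add: divide_inverse mult_ac)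
    also have "(mexp 2 l - 2 * tmean l * mexp 1 l + (tmean l)\<^sup>2 * mexp 0 l) / mexp 0 l = tvar l"
      using m0 by (simp add: tvar_def tmean_def power2_eq_square field_simps)
    finally show ?thesis .
  qed
  have e4: "exp (l * X \<omega>) *\<^sub>R ((X \<omega> - tmean l) / c) ^ 4 = exp (l * X \<omega>) * (X \<omega> - tmean l) ^ 4 / c ^ 4" for \<omega>
    by (simp add: power_divide)
  have i4: "integrable ?T (\<lambda>y. y ^ 4)"
    by (subst integrable_tilt_law[OF X _ integrable_exp[OF l l1]]) (use integrable_centred4 in \<open>simp_all only: e4 integrable_divide, auto\<close>)
  have "(\<integral>y. y ^ 4 \<partial>?T) = (\<integral>\<omega>. exp (l * X \<omega>) * (X \<omega> - tmean l) ^ 4 / c ^ 4 \<partial>M) /\<^sub>R mexp 0 l"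
    by (subst I) (simp_all only: e4, measurable)
  also have "\<dots> = (\<integral>\<omega>. exp (l * X \<omega>) * (X \<omega> - tmean l) ^ 4 \<partial>M) / mexp 0 l / c ^ 4"
    by (simp add: inverse_eq_divide)
  also have "\<dots> \<le> 12 * \<epsilon>\<^sup>2 * (1 + 575/10 * (l * \<epsilon>)) * s2 / c ^ 4"
    by (intro divide_right_mono centred4_le) auto
  also have "\<dots> \<le> 12 * \<epsilon>\<^sup>2 * ((1 - 56/10 * (l * \<epsilon>)) * (1 + 57 * (l * \<epsilon>)))\<^sup>2 * s2 / c ^ 4"
    using fourth_variance_numeric[OF t] s2_nonneg by (intro divide_right_mono mult_right_mono mult_left_mono) auto
  also have "\<dots> = 12 * \<epsilon>\<^sup>2 * (1 + 57 * (l * \<epsilon>))\<^sup>2 * (1 - 56/10 * (l * \<epsilon>)) * (s2 * (1 - 56/10 * (l * \<epsilon>))) / c ^ 4"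
    by (simp add: power2_eq_square mult_ac)
  also have "\<dots> \<le> 12 * \<epsilon>\<^sup>2 * (1 + 57 * (l * \<epsilon>))\<^sup>2 * (1 - 56/10 * (l * \<epsilon>)) * tvar l / c ^ 4"
    using t by (intro divide_right_mono mult_left_mono tvar_lower) auto
  also have "\<dots> = 12 * \<epsilon>\<^sup>2 * (1 + 57 * (l * \<epsilon>))\<^sup>2 * (1 - 56/10 * (l * \<epsilon>)) / c\<^sup>2 * (tvar l / c\<^sup>2)"
    by (simp add: power2_eq_square power4_eq_xxxx)
  also have "12 * \<epsilon>\<^sup>2 * (1 + 57 * (l * \<epsilon>))\<^sup>2 * (1 - 56/10 * (l * \<epsilon>)) / c\<^sup>2
    = (sqrt 12 * \<epsilon> * (1 + 57 * (l * \<epsilon>)) * sqrt (1 - 56/10 * (l * \<epsilon>)) / c)\<^sup>2"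
    using t by (simp add: power_mult_distrib power_divide)
  finally show ?thesis
    using 1 2 i4 c t \<epsilon>_pos by unfold_locales (auto intro!: divide_pos_pos mult_pos_pos)
qed

end

end

section \<open>Sums of independent Bernstein variables\<close>

text \<open>The slope 17/2 is the exact derivative of \<open>R\<close> at 0. The term
  \<open>6 * \<tau>^2\<close> of the numerator is dropped, the square root of
  \<open>1 - 3 * \<tau>\<close> is bounded by its tangent, and each factor
  \<open>1 / (1 - a)\<close> by \<open>1 + a\<close>.\<close>

lemma Rfun_lower:
  assumes "0 \<le> \<tau>" "\<tau> < 1/3"
  shows "1 + 17/2 * \<tau> + 57/2 * \<tau>\<^sup>2 \<le> real_of_ereal (Rfun \<tau>)"
proof -
  have inv: "1 + a \<le> 1 / (1 - a)" if "a < 1" for a :: real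
  proof -
    have "(1 + a) * (1 - a) \<le> 1" by (simp add: algebra_simps)
    then show ?thesis using that by (simp add: pos_le_divide_eq)
  qed
  have y: "0 < 1 - 3 * \<tau>" using assms by simp
  have "sqrt (1 - 3 * \<tau>) \<le> 1 - 3/2 * \<tau>"
    using assms by (intro real_le_lsqrt) (auto simp: power2_eq_square algebra_simps)
  moreover have "(1 - 3 * \<tau>) powr (3/2) = (1 - 3 * \<tau>) * sqrt (1 - 3 * \<tau>)"
    using y powr_add[of "1 - 3 * \<tau>" 1 "1/2"] by (simp add: powr_half_sqrt)
  ultimately have p: "(1 - 3 * \<tau>) powr (3/2) \<le> (1 - 3 * \<tau>) * (1 - 3/2 * \<tau>)" "0 < (1 - 3 * \<tau>) powr (3/2)"
    using y by (auto intro!: mult_left_mono)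
  have "1 + 17/2 * \<tau> + 57/2 * \<tau>\<^sup>2 \<le> (1 + 3 * \<tau>) * (1 + 3/2 * \<tau>) * (1 + \<tau>) ^ 4"
  proof -
    have "(1 + 3 * \<tau>) * (1 + 3/2 * \<tau>) * (1 + \<tau>) ^ 4 - (1 + 17/2 * \<tau> + 57/2 * \<tau>\<^sup>2)
      = \<tau> ^ 3 * (49 + 46 * \<tau> + 45/2 * \<tau>\<^sup>2 + 9/2 * \<tau> ^ 3)"
      by (simp add: field_simps eval_nat_numeral)
    moreover have "0 \<le> \<tau> ^ 3 * (49 + 46 * \<tau> + 45/2 * \<tau>\<^sup>2 + 9/2 * \<tau> ^ 3)" using assms by simp
    ultimately show ?thesis by linarith
  qed
  also have "\<dots> \<le> (1 / (1 - 3 * \<tau>)) * (1 / (1 - 3/2 * \<tau>)) * (1 / (1 - \<tau>)) ^ 4"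
    using assms by (intro mult_mono power_mono inv) auto
  also have "\<dots> = 1 / ((1 - 3 * \<tau>) * (1 - 3/2 * \<tau>) * (1 - \<tau>) ^ 4)"
    by (simp add: power_divide)
  also have "\<dots> \<le> 1 / ((1 - 3 * \<tau>) powr (3/2) * (1 - \<tau>) ^ 4)"
    using assms p by (intro divide_left_mono mult_right_mono mult_pos_pos) auto
  also have "\<dots> = (1 - \<tau>) ^ 3 / ((1 - 3 * \<tau>) powr (3/2) * (1 - \<tau>) ^ 7)"
    using assms power_add[of "1 - \<tau>" 3 4] by (simp add: divide_simps)
  also have "\<dots> \<le> (1 - \<tau> + 6 * \<tau>\<^sup>2) ^ 3 / ((1 - 3 * \<tau>) powr (3/2) * (1 - \<tau>) ^ 7)"
    using assms p by (intro divide_right_mono power_mono) auto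
  finally show ?thesis using assms by (simp add: Rfun_def)
qed

text \<open>Here \<open>s\<close> is a lower bound for \<open>x * \<epsilon> / \<sigma>\<close>, and
  \<open>34 = 4 * 17/2\<close>, \<open>456 = 16 * 57/2\<close> come from \<open>Rfun_lower\<close>
  at \<open>4 * s\<close>. On the left, 24/5 is twice the Berry-Esseen constant, 21/10 the cost of
  changing the argument of \<open>Mills\<close>, and 6 corresponds to the requirement
  \<open>d \<le> 1/6\<close>.\<close>

lemma error_numeric:
  fixes t s :: real
  assumes t: "0 \<le> t" "t \<le> 11/100" and s: "s = t * (1 - 21/10 * t)"
  shows "24/5 * (sqrt 12 * (1 + 57 * t)) + 21/10 * (1 + 146/10 * t) \<le> 2799/100 * (1 + 34 * s + 456 * s\<^sup>2)"
    and "6 * (sqrt 12 * (1 + 57 * t)) \<le> 2799/100 * (1 + 34 * s + 456 * s\<^sup>2)"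
proof -
  have q: "sqrt 12 \<le> 34642/10000" by (rule real_le_lsqrt) (auto simp: power2_eq_square)
  have "sqrt 12 * (1 + 57 * t) \<le> 34642/10000 * (1 + 57 * t)"
    using q t by (intro mult_right_mono) auto
  moreover have "t\<^sup>2 * (59/100) \<le> s\<^sup>2"
  proof -
    have "59/100 \<le> (1 - 21/10 * (11/100 :: real))\<^sup>2" by (simp add: power2_eq_square)
    also have "\<dots> \<le> (1 - 21/10 * t)\<^sup>2" using t by (intro power_mono) auto
    finally show ?thesis unfolding s power_mult_distrib by (intro mult_left_mono) auto
  qed
  moreover have "s = t - 21/10 * t\<^sup>2" by (simp add: s algebra_simps power2_eq_square)
  \<comment> \<open>Tangent to the parabola at 2/100. With \<open>A\<close>, \<open>B\<close>,
    \<open>q\<close> abstracted below, the goal becomes linear real arithmetic.\<close>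
  moreover have "4 / 100 * t - 4 / 10000 \<le> t\<^sup>2"
    using sum_squares_ge_zero[of "t - 2/100" 0] by (simp add: power2_eq_square algebra_simps)
  moreover have "24/5 * A + 21/10 * (1 + 146/10 * t) \<le> 2799/100 * (1 + 34 * s + 456 * B)"
    "6 * A \<le> 2799/100 * (1 + 34 * s + 456 * B)"
    if A: "A \<le> 34642/10000 * (1 + 57 * t)" and q: "q * (59/100) \<le> B" "s = t - 21/10 * q" "4/100 * t - 4/10000 \<le> q"
    for A B q :: real
  proof -
    show "24/5 * A + 21/10 * (1 + 146/10 * t) \<le> 2799/100 * (1 + 34 * s + 456 * B)"
      using A q t by argo
    show "6 * A \<le> 2799/100 * (1 + 34 * s + 456 * B)"
      using A q t by argo
  qed
  ultimately show "24/5 * (sqrt 12 * (1 + 57 * t)) + 21/10 * (1 + 146/10 * t) \<le> 2799/100 * (1 + 34 * s + 456 * s\<^sup>2)"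
    "6 * (sqrt 12 * (1 + 57 * t)) \<le> 2799/100 * (1 + 34 * s + 456 * s\<^sup>2)"
    by blast+
qed

lemma (in bernstein_variable) continuous_on_mexp:
  "continuous_on {0..11/100/\<epsilon>} (mexp p)"
proof (rule continuous_on_sequentiallyI)
  fix u :: "nat \<Rightarrow> real" and a
  assume u: "\<forall>n. u n \<in> {0..11/100/\<epsilon>}" and a: "a \<in> {0..11/100/\<epsilon>}" and lim: "u \<longlonglongrightarrow> a"
  have L: "0 \<le> 11/100/\<epsilon>" "11/100/\<epsilon> * \<epsilon> < 1" using \<epsilon>_pos by auto
  show "(\<lambda>n. mexp p (u n)) \<longlonglongrightarrow> mexp p a"
    unfolding mexp_def
  proof (rule integral_dominated_convergence[OF _ _ integrable_abs_power_exp[OF L, of p]])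
    show "AE \<omega> in M. (\<lambda>n. X \<omega> ^ p * exp (u n * X \<omega>)) \<longlonglongrightarrow> X \<omega> ^ p * exp (a * X \<omega>)"
      by (intro AE_I2 tendsto_intros lim)
    fix n
    have "u n * X \<omega> \<le> 11/100/\<epsilon> * \<bar>X \<omega>\<bar>" for \<omega>
    proof -
      have "u n * X \<omega> \<le> u n * \<bar>X \<omega>\<bar>" using u by (intro mult_left_mono) auto
      also have "\<dots> \<le> 11/100/\<epsilon> * \<bar>X \<omega>\<bar>" using u by (intro mult_right_mono) auto
      finally show ?thesis .
    qed
    then show "AE \<omega> in M. norm (X \<omega> ^ p * exp (u n * X \<omega>)) \<le> \<bar>X \<omega>\<bar> ^ p * exp (11/100/\<epsilon> * \<bar>X \<omega>\<bar>)"
      by (intro AE_I2) (simp add: abs_mult power_abs mult_left_mono)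
  qed auto
qed

locale bernstein_sum = prob_space +
  fixes \<xi> :: "nat \<Rightarrow> 'a \<Rightarrow> real" and n :: nat and \<epsilon> :: real
  assumes indep: "indep_vars (\<lambda>_. borel) \<xi> {..<n}" and \<epsilon>_pos: "0 < \<epsilon>"
    and bernstein: "\<And>i. i < n \<Longrightarrow> bernstein_cond M (\<xi> i) \<epsilon>"
    and mean_zero: "\<And>i. i < n \<Longrightarrow> (\<integral>\<omega>. \<xi> i \<omega> \<partial>M) = 0"
    and var_pos: "0 < (\<Sum>i<n. \<integral>\<omega>. (\<xi> i \<omega>)\<^sup>2 \<partial>M)"
begin

lemma \<xi>_measurable: "i < n \<Longrightarrow> \<xi> i \<in> borel_measurable M"
  using indep by (auto simp: indep_vars_def)

lemma summand: "i < n \<Longrightarrow> bernstein_variable M (\<xi> i) \<epsilon>"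
  by unfold_locales (auto simp: \<xi>_measurable \<epsilon>_pos bernstein mean_zero)

abbreviation "mx i p l \<equiv> bernstein_variable.mexp M (\<xi> i) p l"
abbreviation "sq i \<equiv> bernstein_variable.s2 M (\<xi> i)"
abbreviation "tm i l \<equiv> bernstein_variable.tmean M (\<xi> i) l"
abbreviation "tv i l \<equiv> bernstein_variable.tvar M (\<xi> i) l"

definition S where "S \<omega> = (\<Sum>i<n. \<xi> i \<omega>)"
definition \<sigma> where "\<sigma> = sqrt (\<Sum>i<n. \<integral>\<omega>. (\<xi> i \<omega>)\<^sup>2 \<partial>M)"

lemma S_measurable [measurable]: "S \<in> borel_measurable M"
  unfolding S_def[abs_def] using \<xi>_measurable by (intro borel_measurable_sum) auto

lemma sq_eq: "i < n \<Longrightarrow> sq i = (\<integral>\<omega>. (\<xi> i \<omega>)\<^sup>2 \<partial>M)"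
  using bernstein_variable.s2_def[OF summand] .

lemma sum_sq: "(\<Sum>i<n. sq i) = \<sigma>\<^sup>2" and \<sigma>_pos: "0 < \<sigma>"
  using var_pos by (simp_all add: \<sigma>_def sq_eq)

context
  fixes l :: real assumes l: "0 \<le> l" and l1: "l * \<epsilon> < 1"
begin

lemma mx_pos: "i < n \<Longrightarrow> 0 < mx i 0 l"
  using bernstein_variable.mexp0_ge[OF summand l l1] by force

lemma exp_S: "exp (l * S \<omega>) = (\<Prod>i<n. exp (l * \<xi> i \<omega>))"
  by (simp add: S_def sum_distrib_left exp_sum)

lemma integrable_exp_S: "integrable M (\<lambda>\<omega>. exp (l * S \<omega>))"
  and mgf_S: "(\<integral>\<omega>. exp (l * S \<omega>) \<partial>M) = (\<Prod>i<n. mx i 0 l)"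
proof -
  have ind: "indep_vars (\<lambda>_. borel) (\<lambda>i \<omega>. exp (l * \<xi> i \<omega>)) {..<n}"
    by (rule indep_vars_compose2[OF indep]) auto
  have int: "integrable M (\<lambda>\<omega>. exp (l * \<xi> i \<omega>))" if "i \<in> {..<n}" for i
    using bernstein_variable.integrable_exp[OF summand l l1] that by auto
  show "integrable M (\<lambda>\<omega>. exp (l * S \<omega>))"
    unfolding exp_S by (rule indep_vars_integrable[OF _ ind int]) auto
  show "(\<integral>\<omega>. exp (l * S \<omega>) \<partial>M) = (\<Prod>i<n. mx i 0 l)"
    unfolding exp_S by (subst indep_vars_lebesgue_integral[OF _ ind int])
      (auto intro!: prod.cong simp: bernstein_variable.mexp_def[OF summand])
qed

lemma integrable_S_exp_S: "integrable M (\<lambda>\<omega>. exp (l * S \<omega>) * S \<omega>)"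
  and mean_S: "(\<integral>\<omega>. exp (l * S \<omega>) * S \<omega> \<partial>M) = (\<Prod>i<n. mx i 0 l) * (\<Sum>i<n. tm i l)"
proof -
  \<comment> \<open>Placing the factor \<open>x\<close> at the single index \<open>j\<close> writes
    \<open>exp (l * S)\<close> times the \<open>j\<close>-th summand as a product of independent
    functions; summation over \<open>j\<close> restores the factor \<open>S\<close>.\<close>
  define f where "f j i x = (if i = j then x * exp (l * x) else exp (l * x))" for j i :: nat and x :: real
  have prod_f: "(\<Prod>i<n. f j i (\<xi> i \<omega>)) = exp (l * S \<omega>) * \<xi> j \<omega>" if "j < n" for j \<omega>
  proof -
    have "(\<Prod>i<n. f j i (\<xi> i \<omega>)) = (\<Prod>i<n. (if i = j then \<xi> j \<omega> else 1) * exp (l * \<xi> i \<omega>))"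
      by (intro prod.cong) (auto simp: f_def)
    then show ?thesis using that by (simp add: prod.distrib exp_S mult.commute)
  qed
  have [measurable]: "f j i \<in> borel_measurable borel" for j i
    unfolding f_def[abs_def] by measurable
  have ind: "indep_vars (\<lambda>_. borel) (\<lambda>i \<omega>. f j i (\<xi> i \<omega>)) {..<n}" for j
    by (rule indep_vars_compose2[OF indep]) auto
  have int: "integrable M (\<lambda>\<omega>. f j i (\<xi> i \<omega>))" if "i \<in> {..<n}" for i j
    using bernstein_variable.integrable_power_exp[OF summand l l1, of i 1] bernstein_variable.integrable_exp[OF summand l l1, of i] that
    by (cases "i = j") (auto simp: f_def)
  have I: "integrable M (\<lambda>\<omega>. exp (l * S \<omega>) * \<xi> j \<omega>)" if "j < n" for j
    using indep_vars_integrable[OF finite_lessThan ind[of j] int[of _ j]] prod_f[OF that] by simp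
  have E: "(\<integral>\<omega>. exp (l * S \<omega>) * \<xi> j \<omega> \<partial>M) = (\<Prod>i<n. mx i 0 l) * tm j l" if "j < n" for j
  proof -
    have "(\<integral>\<omega>. exp (l * S \<omega>) * \<xi> j \<omega> \<partial>M) = (\<Prod>i<n. \<integral>\<omega>. f j i (\<xi> i \<omega>) \<partial>M)"
      using indep_vars_lebesgue_integral[OF finite_lessThan ind[of j] int[of _ j]] prod_f[OF that] by simp
    also have "\<dots> = (\<Prod>i<n. (if i = j then tm j l else 1) * mx i 0 l)"
    proof (intro prod.cong refl)
      fix i assume "i \<in> {..<n}"
      then have i: "i < n" by simp
      show "(\<integral>\<omega>. f j i (\<xi> i \<omega>) \<partial>M) = (if i = j then tm j l else 1) * mx i 0 l"
        using mx_pos[OF i] bernstein_variable.tmean_def[OF summand[OF i], of l]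
          bernstein_variable.mexp_def[OF summand[OF i], of 1 l] bernstein_variable.mexp_def[OF summand[OF i], of 0 l]
        by (auto simp: f_def)
    qed
    finally show ?thesis using that by (simp add: prod.distrib mult.commute)
  qed
  have eq: "exp (l * S \<omega>) * S \<omega> = (\<Sum>j<n. exp (l * S \<omega>) * \<xi> j \<omega>)" for \<omega>
    by (simp add: S_def sum_distrib_left)
  show "integrable M (\<lambda>\<omega>. exp (l * S \<omega>) * S \<omega>)"
    unfolding eq using I by (intro Bochner_Integration.integrable_sum) auto
  show "(\<integral>\<omega>. exp (l * S \<omega>) * S \<omega> \<partial>M) = (\<Prod>i<n. mx i 0 l) * (\<Sum>i<n. tm i l)"
    unfolding eq using I E by (subst Bochner_Integration.integral_sum) (auto simp: sum_distrib_left)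
qed

text \<open>The exponential weight factorises over the independent summands, and by the saddle point
  equation their individual centrings add up to \<open>y\<close>. Thus the tilted sum behaves like a
  sum of independent tilted summands, with no product measure constructed.\<close>

lemma char_tilt_S:
  assumes "(\<Sum>i<n. tm i l) = y"
  shows "char (tilt_law M S l y c) u = (\<Prod>i<n. char (tilt_law M (\<xi> i) l (tm i l) c) u)"
proof -
  let ?g = "\<lambda>i x. exp (l * x) *\<^sub>R iexp (u * ((x - tm i l) / c))"
  have ind: "indep_vars (\<lambda>_. borel) (\<lambda>i \<omega>. ?g i (\<xi> i \<omega>)) {..<n}"
    by (rule indep_vars_compose2[OF indep]) auto
  have int: "integrable M (\<lambda>\<omega>. ?g i (\<xi> i \<omega>))" if "i \<in> {..<n}" for i
  proof (rule Bochner_Integration.integrable_bound)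
    show "integrable M (\<lambda>\<omega>. exp (l * \<xi> i \<omega>))"
      using bernstein_variable.integrable_exp[OF summand l l1] that by auto
    have [measurable]: "\<xi> i \<in> borel_measurable M" using \<xi>_measurable that by auto
    show "(\<lambda>\<omega>. ?g i (\<xi> i \<omega>)) \<in> borel_measurable M" by measurable
  qed (auto intro!: AE_I2)
  have g: "(\<Prod>i<n. ?g i (\<xi> i \<omega>)) = exp (l * S \<omega>) *\<^sub>R iexp (u * ((S \<omega> - y) / c))" for \<omega>
  proof -
    have "(\<Sum>i<n. u * ((\<xi> i \<omega> - tm i l) / c)) = u * ((\<Sum>i<n. \<xi> i \<omega> - tm i l) / c)"
      by (simp add: sum_distrib_left sum_divide_distrib)
    then have "(\<Sum>i<n. u * ((\<xi> i \<omega> - tm i l) / c)) = u * ((S \<omega> - y) / c)"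
      by (simp add: S_def assms[symmetric] sum_subtractf)
    then have "(\<Prod>i<n. iexp (u * ((\<xi> i \<omega> - tm i l) / c))) = iexp (u * ((S \<omega> - y) / c))"
      by (simp only: exp_sum[symmetric] finite_lessThan sum_distrib_left[symmetric] of_real_sum[symmetric])
    then show ?thesis by (simp only: scaleR_conv_of_real prod.distrib of_real_prod[symmetric] exp_S)
  qed
  have "char (tilt_law M S l y c) u = (\<integral>\<omega>. exp (l * S \<omega>) *\<^sub>R iexp (u * ((S \<omega> - y) / c)) \<partial>M) /\<^sub>R (\<Prod>i<n. mx i 0 l)"
    unfolding char_def mgf_S[symmetric] by (rule integral_tilt_law[OF S_measurable _ integrable_exp_S]) simp
  also have "(\<integral>\<omega>. exp (l * S \<omega>) *\<^sub>R iexp (u * ((S \<omega> - y) / c)) \<partial>M) = (\<Prod>i<n. \<integral>\<omega>. ?g i (\<xi> i \<omega>) \<partial>M)"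
    unfolding g[symmetric] by (rule indep_vars_lebesgue_integral[OF _ ind int]) auto
  also have "\<dots> /\<^sub>R (\<Prod>i<n. mx i 0 l) = (\<Prod>i<n. (\<integral>\<omega>. ?g i (\<xi> i \<omega>) \<partial>M) /\<^sub>R mx i 0 l)"
    using prod_inversef[of "\<lambda>i. complex_of_real (mx i 0 l)" "{..<n}"]
    by (simp add: scaleR_conv_of_real prod.distrib comp_def)
  also have "\<dots> = (\<Prod>i<n. char (tilt_law M (\<xi> i) l (tm i l) c) u)"
  proof (intro prod.cong refl)
    fix i assume "i \<in> {..<n}"
    then have i: "i < n" by simp
    have "mx i 0 l = (\<integral>\<omega>. exp (l * \<xi> i \<omega>) \<partial>M)"
      by (simp add: bernstein_variable.mexp_def[OF summand[OF i]])
    then show "(\<integral>\<omega>. ?g i (\<xi> i \<omega>) \<partial>M) /\<^sub>R mx i 0 l = char (tilt_law M (\<xi> i) l (tm i l) c) u"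
      unfolding char_def
      using integral_tilt_law[OF \<xi>_measurable[OF i] _ bernstein_variable.integrable_exp[OF summand[OF i] l l1], of "\<lambda>x. iexp (u * x)" "tm i l" c]
      by simp
  qed
  finally show ?thesis .
qed

lemma integral_exp_shift: "(\<integral>\<omega>. exp (l * (S \<omega> - y)) \<partial>M) = exp (- (l * y)) * (\<Prod>i<n. mx i 0 l)"
  and integrable_exp_shift: "integrable M (\<lambda>\<omega>. exp (l * (S \<omega> - y)))"
proof -
  have e: "exp (l * (S \<omega> - y)) = exp (- (l * y)) * exp (l * S \<omega>)" for \<omega>
    by (simp add: algebra_simps flip: exp_add)
  show "(\<integral>\<omega>. exp (l * (S \<omega> - y)) \<partial>M) = exp (- (l * y)) * (\<Prod>i<n. mx i 0 l)" unfolding e by (simp add: mgf_S)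
  show "integrable M (\<lambda>\<omega>. exp (l * (S \<omega> - y)))" unfolding e using integrable_exp_S by simp
qed

lemma chernoff_inf_le: "chernoff_inf M S y \<le> exp (- (l * y)) * (\<Prod>i<n. mx i 0 l)"
proof -
  have "(\<integral>\<^sup>+ \<omega>. ennreal (exp (l * (S \<omega> - y))) \<partial>M) = ennreal (exp (- (l * y)) * (\<Prod>i<n. mx i 0 l))"
    unfolding integral_exp_shift[symmetric] by (rule nn_integral_eq_integral[OF integrable_exp_shift]) auto
  then have "(INF l\<in>{0..}. \<integral>\<^sup>+ \<omega>. ennreal (exp (l * (S \<omega> - y))) \<partial>M) \<le> ennreal (exp (- (l * y)) * (\<Prod>i<n. mx i 0 l))"
    using l by (intro INF_lower2[of l]) auto
  moreover have "0 < (\<Prod>i<n. mx i 0 l)" using mx_pos by (intro prod_pos) auto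
  ultimately show ?thesis unfolding chernoff_inf_def by (intro enn2real_leI) auto
qed

text \<open>The tangent inequality \<open>exp (k * z) \<ge> exp (l * z) * (1 + (k - l) * z)\<close>
  at \<open>z = S - y\<close> is integrated; its linear term has mean zero exactly at the saddle
  point. No derivative of the moment generating function is taken.\<close>

lemma chernoff_inf_eq:
  assumes y: "(\<Sum>i<n. tm i l) = y"
  shows "chernoff_inf M S y = exp (- (l * y)) * (\<Prod>i<n. mx i 0 l)"
proof (rule antisym[OF chernoff_inf_le])
  let ?C = "exp (- (l * y)) * (\<Prod>i<n. mx i 0 l)"
  have C: "0 \<le> ?C" using mx_pos by (intro mult_nonneg_nonneg prod_nonneg) (auto intro: less_imp_le)
  have lower: "ennreal ?C \<le> (\<integral>\<^sup>+ \<omega>. ennreal (exp (k * (S \<omega> - y))) \<partial>M)" for k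
  proof (cases "integrable M (\<lambda>\<omega>. exp (k * (S \<omega> - y)))")
    case True
    have e: "exp (l * (S \<omega> - y)) * (1 + (k - l) * (S \<omega> - y)) =
        exp (l * (S \<omega> - y)) + (k - l) * exp (- (l * y)) * (exp (l * S \<omega>) * S \<omega> - y * exp (l * S \<omega>))" for \<omega>
    proof -
      have "exp (l * (S \<omega> - y)) = exp (- (l * y)) * exp (l * S \<omega>)"
        by (simp add: algebra_simps flip: exp_add)
      then show ?thesis by (simp add: algebra_simps)
    qed
    have "?C = (\<integral>\<omega>. exp (l * (S \<omega> - y)) * (1 + (k - l) * (S \<omega> - y)) \<partial>M)"
      unfolding e using integrable_exp_shift integrable_S_exp_S integrable_exp_S
      by (simp add: integral_exp_shift mean_S mgf_S y)
    also have "\<dots> \<le> (\<integral>\<omega>. exp (k * (S \<omega> - y)) \<partial>M)"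
    proof (rule integral_mono[OF _ True])
      show "integrable M (\<lambda>\<omega>. exp (l * (S \<omega> - y)) * (1 + (k - l) * (S \<omega> - y)))"
        unfolding e using integrable_exp_shift integrable_S_exp_S integrable_exp_S by simp
      show "exp (l * (S \<omega> - y)) * (1 + (k - l) * (S \<omega> - y)) \<le> exp (k * (S \<omega> - y))" for \<omega>
      proof -
        have "exp (l * (S \<omega> - y)) * (1 + (k - l) * (S \<omega> - y)) \<le> exp (l * (S \<omega> - y)) * exp ((k - l) * (S \<omega> - y))"
          by (intro mult_left_mono exp_ge_add_one_self) auto
        also have "\<dots> = exp (k * (S \<omega> - y))" by (simp add: algebra_simps flip: exp_add)
        finally show ?thesis .
      qed
    qed
    finally show ?thesis
      using nn_integral_eq_integral[OF True] by (simp add: ennreal_leI)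
  next
    \<comment> \<open>A non-integrable exponential has integral infinity in the extended reals and
      cannot lower the infimum.\<close>
    case False
    have "(\<integral>\<^sup>+ \<omega>. ennreal (exp (k * (S \<omega> - y))) \<partial>M) = \<infinity>"
    proof (rule ccontr)
      assume "(\<integral>\<^sup>+ \<omega>. ennreal (exp (k * (S \<omega> - y))) \<partial>M) \<noteq> \<infinity>"
      then have "(\<integral>\<^sup>+ \<omega>. ennreal (exp (k * (S \<omega> - y))) \<partial>M) < \<infinity>"
        by (simp only: infinity_ennreal_def less_top)
      then have "integrable M (\<lambda>\<omega>. exp (k * (S \<omega> - y)))"
        by (intro integrableI_nonneg) simp_all
      then show False using False by contradiction
    qed
    then show ?thesis by simp
  qed
  have "ennreal ?C \<le> (INF l\<in>{0..}. \<integral>\<^sup>+ \<omega>. ennreal (exp (l * (S \<omega> - y))) \<partial>M)"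
    using lower by (intro INF_greatest) auto
  moreover have "(INF l\<in>{0..}. \<integral>\<^sup>+ \<omega>. ennreal (exp (l * (S \<omega> - y))) \<partial>M) \<le> (\<integral>\<^sup>+ \<omega>. ennreal (exp (l * (S \<omega> - y))) \<partial>M)"
    using l by (intro INF_lower) auto
  moreover have "(\<integral>\<^sup>+ \<omega>. ennreal (exp (l * (S \<omega> - y))) \<partial>M) < top"
    using nn_integral_eq_integral[OF integrable_exp_shift] by simp
  ultimately have "enn2real (ennreal ?C) \<le> chernoff_inf M S y"
    unfolding chernoff_inf_def by (intro enn2real_mono) auto
  then show "?C \<le> chernoff_inf M S y" using C by simp
qed

lemma tail_prob_eq:
  assumes y: "(\<Sum>i<n. tm i l) = y" and c: "0 < c"
  shows "measure M {\<omega>\<in>space M. S \<omega> > y} =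
    chernoff_inf M S y * (\<integral>z. indicator {0<..} z * exp (- ((l * c) * z)) \<partial>tilt_law M S l y c)"
proof -
  have P: "0 < (\<Prod>i<n. mx i 0 l)" using mx_pos by (intro prod_pos) auto
  have exp_cancel: "exp (- (l * y)) * K * ((exp (l * y) * p) /\<^sub>R K) = p" if "0 < K" for p K :: real
    using that by (simp add: exp_minus field_simps)
  have e: "exp (l * S \<omega>) *\<^sub>R (indicator {0<..} ((S \<omega> - y) / c) * exp (- ((l * c) * ((S \<omega> - y) / c))))
    = exp (l * y) * indicator {\<omega>. S \<omega> > y} \<omega>" for \<omega>
  proof (cases "S \<omega> > y")
    case True
    have "(l * c) * ((S \<omega> - y) / c) = l * (S \<omega> - y)" using c by simp
    moreover have "exp (l * S \<omega>) * exp (- (l * (S \<omega> - y))) = exp (l * y)"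
      unfolding exp_add[symmetric] by (simp add: algebra_simps)
    ultimately show ?thesis using True c by simp
  next
    case False
    then show ?thesis using c by (simp add: zero_less_divide_iff)
  qed
  have "(\<integral>z. indicator {0<..} z * exp (- ((l * c) * z)) \<partial>tilt_law M S l y c)
    = (\<integral>\<omega>. exp (l * y) * indicator {\<omega>. S \<omega> > y} \<omega> \<partial>M) /\<^sub>R (\<Prod>i<n. mx i 0 l)"
    unfolding mgf_S[symmetric] e[symmetric] by (rule integral_tilt_law[OF S_measurable _ integrable_exp_S]) simp
  also have "(\<integral>\<omega>. exp (l * y) * indicator {\<omega>. S \<omega> > y} \<omega> \<partial>M) = exp (l * y) * measure M ({\<omega>. S \<omega> > y} \<inter> space M)"
    by simp
  also have "{\<omega>. S \<omega> > y} \<inter> space M = {\<omega>\<in>space M. S \<omega> > y}" by auto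
  finally show ?thesis
    unfolding chernoff_inf_eq[OF y] by (simp only: exp_cancel[OF P])
qed

end

end

section \<open>The expansion\<close>

text \<open>A crude constant suffices, since it is absorbed by the O-term; raising the exponent from
  3/2 to 2 lowers the denominator because the base is at most 1.\<close>

lemma Rfun_upper:
  assumes "0 \<le> \<tau>" "\<tau> \<le> 1/6"
  shows "real_of_ereal (Rfun \<tau>) \<le> 4096"
proof -
  have "(1/2)\<^sup>2 \<le> (1 - 3 * \<tau>)\<^sup>2" using assms by (intro power_mono) auto
  also have "\<dots> = (1 - 3 * \<tau>) powr 2" using assms by (simp add: powr_numeral)
  also have "\<dots> \<le> (1 - 3 * \<tau>) powr (3/2)" using assms by (intro powr_mono') auto
  finally have 1: "(1/2)\<^sup>2 \<le> (1 - 3 * \<tau>) powr (3/2)" .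
  have 2: "(1/2) ^ 7 \<le> (1 - \<tau>) ^ 7" using assms by (intro power_mono) auto
  have "\<tau> * \<tau> \<le> 1/6 * \<tau>" using assms by (intro mult_right_mono) auto
  then have "1 - \<tau> + 6 * \<tau>\<^sup>2 \<le> 2" by (simp add: power2_eq_square)
  moreover have "0 \<le> 1 - \<tau> + 6 * \<tau>\<^sup>2" using assms by simp
  ultimately have 3: "(1 - \<tau> + 6 * \<tau>\<^sup>2) ^ 3 \<le> 2 ^ 3" by (intro power_mono)
  have "(1 - \<tau> + 6 * \<tau>\<^sup>2) ^ 3 / ((1 - 3 * \<tau>) powr (3/2) * (1 - \<tau>) ^ 7) \<le> 2 ^ 3 / ((1/2)\<^sup>2 * (1/2) ^ 7)"
    using 1 2 3 by (intro frac_le mult_mono) auto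
  also have "\<dots> = 4096" by (simp add: eval_nat_numeral)
  finally show ?thesis using assms by (simp add: Rfun_def power2_eq_square)
qed

section \<open>Chernoff bound, saddle point and comparison with the Gaussian tail\<close>

context bernstein_sum
begin

lemma chernoff_inf_le_Bfun:
  assumes x: "0 \<le> x" shows "chernoff_inf M S (x * \<sigma>) \<le> Bfun x (\<epsilon> / \<sigma>)"
proof -
  define r where "r = \<epsilon> / \<sigma>"
  define q where "q = sqrt (1 + 2 * x * r)"
  \<comment> \<open>The minimiser of Bernstein's exponent \<open>l^2 * \<sigma>^2 / (2 * (1 - l *
    \<epsilon>)) - l * x * \<sigma>\<close>: its derivative vanishes when
    \<open>1 / (1 - l * \<epsilon>)^2 = 1 + 2 * x * r\<close>.\<close>
  define l where "l = (1 - 1 / q) / \<epsilon>"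
  have r: "0 < r" using \<epsilon>_pos \<sigma>_pos by (simp add: r_def)
  have q: "1 \<le> q" using x r by (simp add: q_def)
  have q2: "q\<^sup>2 = 1 + 2 * x * r" using x r by (simp add: q_def)
  have xq: "x = (q - 1) * (q + 1) / (2 * r)"
    using q2 r by (simp add: field_simps power2_eq_square)
  have l: "0 \<le> l" "l * \<epsilon> < 1" "1 - l * \<epsilon> = 1 / q" using q \<epsilon>_pos by (auto simp: l_def)
  have ls: "l * \<sigma> = (1 - 1 / q) / r" using \<sigma>_pos \<epsilon>_pos by (simp add: l_def r_def)
  have "(\<Prod>i<n. mx i 0 l) \<le> (\<Prod>i<n. exp (l\<^sup>2 * sq i / (2 * (1 - l * \<epsilon>))))"
  proof (rule prod_mono, intro conjI)
    fix i assume "i \<in> {..<n}"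
    then interpret X: bernstein_variable M "\<xi> i" \<epsilon> by (intro summand) simp
    show "0 \<le> mx i 0 l" using X.mexp0_ge[OF l(1,2)] by linarith
    show "mx i 0 l \<le> exp (l\<^sup>2 * sq i / (2 * (1 - l * \<epsilon>)))"
      by (rule order_trans[OF X.mexp0_le[OF l(1,2)] exp_ge_add_one_self])
  qed
  also have "\<dots> = exp (\<Sum>i<n. l\<^sup>2 * sq i / (2 * (1 - l * \<epsilon>)))" by (simp add: exp_sum)
  also have "(\<Sum>i<n. l\<^sup>2 * sq i / (2 * (1 - l * \<epsilon>))) = l\<^sup>2 * \<sigma>\<^sup>2 / (2 * (1 - l * \<epsilon>))"
    by (simp add: sum_sq[symmetric] sum_distrib_left sum_divide_distrib)
  also have "\<dots> = (l * \<sigma>)\<^sup>2 * q / 2"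
    unfolding l(3) by (simp add: power_mult_distrib)
  finally have P: "(\<Prod>i<n. mx i 0 l) \<le> exp ((l * \<sigma>)\<^sup>2 * q / 2)" .
  have "chernoff_inf M S (x * \<sigma>) \<le> exp (- (l * (x * \<sigma>))) * exp ((l * \<sigma>)\<^sup>2 * q / 2)"
    by (rule order_trans[OF chernoff_inf_le[OF l(1,2)]]) (intro mult_left_mono P, simp)
  also have "\<dots> = exp ((l * \<sigma>)\<^sup>2 * q / 2 - x * (l * \<sigma>))"
    by (simp add: mult_exp_exp mult_ac)
  also have "(l * \<sigma>)\<^sup>2 * q / 2 - x * (l * \<sigma>) = - ((q - 1) / r)\<^sup>2 / 2"
  proof -
    have a: "1 - 1 / q = (q - 1) / q" using q by (simp add: field_simps)
    have "((q - 1) / q / r)\<^sup>2 * q / 2 = ((q - 1) / r)\<^sup>2 * (1 / (2 * q))"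
      using q r by (simp add: power2_eq_square)
    moreover have "x * ((q - 1) / q / r) = ((q - 1) / r)\<^sup>2 * ((q + 1) / (2 * q))"
      unfolding xq by (simp add: power2_eq_square mult_ac)
    moreover have "1 / (2 * q) - (q + 1) / (2 * q) = - 1 / 2"
      using q by (simp add: field_simps)
    ultimately have "((q - 1) / q / r)\<^sup>2 * q / 2 - x * ((q - 1) / q / r) = ((q - 1) / r)\<^sup>2 * (- 1 / 2)"
      by (simp only: right_diff_distrib[symmetric])
    then show ?thesis unfolding ls a by simp
  qed
  \<comment> \<open>Rationalising with \<open>(q - 1) * (q + 1) = 2 * x * r\<close> produces the
    quantity inside \<open>Bfun\<close>.\<close>
  also have "(q - 1) / r = 2 * x / (1 + q)"
  proof -
    have "2 * x = (q - 1) / r * (1 + q)" unfolding xq using r by (simp add: field_simps)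
    then show ?thesis using q by simp
  qed
  finally show ?thesis by (simp add: Bfun_def q_def r_def)
qed

lemma saddle_point_exists:
  assumes x: "0 \<le> x" "x < 1/12 * \<sigma> / \<epsilon>"
  obtains l where "0 \<le> l" "l * \<epsilon> \<le> 11/100" "(\<Sum>i<n. tm i l) = x * \<sigma>"
proof -
  define L where "L = 11/100/\<epsilon>"
  have L: "0 \<le> L" "L * \<epsilon> = 11/100" using \<epsilon>_pos by (auto simp: L_def)
  have pos: "0 < mx i 0 l" if "i < n" "l \<in> {0..L}" for i l
  proof -
    have "l * \<epsilon> \<le> L * \<epsilon>" using that \<epsilon>_pos by (intro mult_right_mono) auto
    then show ?thesis using mx_pos[of l i] that L by auto
  qed
  have cont: "continuous_on {0..L} (\<lambda>l. \<Sum>i<n. tm i l)"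
  proof (intro continuous_on_sum)
    fix i assume "i \<in> {..<n}"
    then have i: "i < n" by simp
    interpret X: bernstein_variable M "\<xi> i" \<epsilon> by (rule summand[OF i])
    show "continuous_on {0..L} (\<lambda>l. tm i l)"
      unfolding X.tmean_def L_def using pos[OF i] X.continuous_on_mexp
      by (intro continuous_on_divide) (auto simp: L_def less_imp_neq[symmetric])
  qed
  have "(\<Sum>i<n. tm i 0) = (\<Sum>i<n. 0)"
  proof (intro sum.cong refl)
    fix i assume "i \<in> {..<n}"
    then interpret X: bernstein_variable M "\<xi> i" \<epsilon> by (intro summand) simp
    show "tm i 0 = 0" using X.mean_zero by (simp add: X.tmean_def X.mexp_def)
  qed
  then have low: "(\<Sum>i<n. tm i 0) \<le> x * \<sigma>" using x \<sigma>_pos by simp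
  have "x * \<sigma> \<le> 1/12 * \<sigma> / \<epsilon> * \<sigma>" using x \<sigma>_pos by (intro mult_right_mono) auto
  also have "\<dots> = (1/12 / \<epsilon>) * \<sigma>\<^sup>2" by (simp add: power2_eq_square)
  \<comment> \<open>Here \<open>11/100 * (1 - 21/10 * 11/100) = 0.08459\<close> exceeds 1/12, so the
    tilt range reaches every admissible \<open>x\<close>.\<close>
  also have "\<dots> \<le> L * (1 - 21/10 * (11/100)) * \<sigma>\<^sup>2"
    using \<epsilon>_pos by (intro mult_right_mono) (auto simp: L_def field_simps)
  also have "\<dots> = (\<Sum>i<n. L * sq i * (1 - 21/10 * (L * \<epsilon>)))"
    unfolding L by (simp add: sum_sq[symmetric] sum_distrib_left sum_distrib_right mult_ac)
  also have "\<dots> \<le> (\<Sum>i<n. tm i L)"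
  proof (rule sum_mono)
    fix i assume "i \<in> {..<n}"
    then interpret X: bernstein_variable M "\<xi> i" \<epsilon> by (intro summand) simp
    show "L * sq i * (1 - 21/10 * (L * \<epsilon>)) \<le> tm i L" using L by (intro X.tmean_lower) auto
  qed
  finally have high: "x * \<sigma> \<le> (\<Sum>i<n. tm i L)" .
  obtain l where "0 \<le> l" "l \<le> L" "(\<Sum>i<n. tm i l) = x * \<sigma>"
    using IVT'[OF low high L(1) cont] by blast
  moreover from this have "l * \<epsilon> \<le> 11/100" using mult_right_mono[of l L \<epsilon>] \<epsilon>_pos L by simp
  ultimately show ?thesis using that by blast
qed

lemma tilted_tail_approx:
  assumes x: "0 \<le> x" "x < 1/12 * \<sigma> / \<epsilon>"
    and l: "0 \<le> l" "l * \<epsilon> \<le> 11/100" and sum_tm: "(\<Sum>i<n. tm i l) = x * \<sigma>"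
    and c: "c = sqrt (\<Sum>i<n. tv i l)"
  shows "0 < c" "\<bar>(\<integral>z. indicator {0<..} z * exp (- ((l * c) * z)) \<partial>tilt_law M S l (x * \<sigma>) c) - Mills x\<bar>
    \<le> 2799/100 * real_of_ereal (Rfun (4 * x * \<epsilon> / \<sigma>)) * (\<epsilon> / \<sigma>)"
proof -
  define r t where "r = \<epsilon> / \<sigma>" and "t = l * \<epsilon>"
  define w where "w = l * \<sigma>"
  define V where "V = 1 - 56/10 * t"
  define s where "s = t * (1 - 21/10 * t)"
  define R where "R = real_of_ereal (Rfun (4 * x * \<epsilon> / \<sigma>))"
  define P where "P = 1 + 34 * s + 456 * s\<^sup>2"
  have r: "0 < r" using \<epsilon>_pos \<sigma>_pos by (simp add: r_def)
  have t: "0 \<le> t" "t \<le> 11/100" using l \<epsilon>_pos by (auto simp: t_def)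
  have l1: "l * \<epsilon> < 1" using l by simp
  have wr: "w * r = t" using \<sigma>_pos by (simp add: w_def r_def t_def)
  have w0: "0 \<le> w" using l \<sigma>_pos by (simp add: w_def)
  have V: "0 < V" using t by (simp add: V_def)
  have X: "bernstein_variable M (\<xi> i) \<epsilon>" if "i < n" for i by (rule summand[OF that])
  have sum_tv_low: "\<sigma>\<^sup>2 * V \<le> (\<Sum>i<n. tv i l)"
    unfolding sum_sq[symmetric] sum_distrib_right V_def t_def
    using bernstein_variable.tvar_lower[OF X l] by (intro sum_mono) auto
  have sum_tv_up: "(\<Sum>i<n. tv i l) \<le> \<sigma>\<^sup>2 * (1 + 176/100 * t)\<^sup>2"
    unfolding sum_sq[symmetric] sum_distrib_right t_def
    using bernstein_variable.tvar_upper[OF X l] by (intro sum_mono) auto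
  have tv_pos: "0 < (\<Sum>i<n. tv i l)"
    by (rule less_le_trans[OF _ sum_tv_low]) (use V \<sigma>_pos in simp)
  then show c0: "0 < c" by (simp add: c)
  have c2: "c\<^sup>2 = (\<Sum>i<n. tv i l)" using tv_pos by (simp add: c)
  have c_low: "\<sigma> * sqrt V \<le> c"
    unfolding c using sum_tv_low \<sigma>_pos V by (intro real_le_rsqrt) (simp add: power_mult_distrib)
  have c_up: "c \<le> \<sigma> * (1 + 176/100 * t)"
    unfolding c using sum_tv_up \<sigma>_pos t by (intro real_le_lsqrt) (auto simp: power_mult_distrib less_imp_le[OF tv_pos])
  have x_low: "w * (1 - 21/10 * t) \<le> x"
  proof -
    have "\<sigma> * (w * (1 - 21/10 * t)) = (\<Sum>i<n. l * sq i * (1 - 21/10 * (l * \<epsilon>)))"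
      by (simp add: w_def t_def sum_distrib_left[symmetric] sum_distrib_right[symmetric] sum_sq power2_eq_square)
    also have "\<dots> \<le> x * \<sigma>"
      unfolding sum_tm[symmetric] using bernstein_variable.tmean_lower[OF X l] by (intro sum_mono) auto
    finally have "\<sigma> * (w * (1 - 21/10 * t)) \<le> \<sigma> * x" by (simp add: mult.commute)
    then show ?thesis using \<sigma>_pos by simp
  qed
  have x_up: "x \<le> w * (1 + 176/100 * t)"
  proof -
    have "x * \<sigma> \<le> (\<Sum>i<n. l * sq i * (1 + 176/100 * (l * \<epsilon>)))"
      unfolding sum_tm[symmetric] using bernstein_variable.tmean_upper[OF X l] by (intro sum_mono) auto
    also have "\<dots> = \<sigma> * (w * (1 + 176/100 * t))"
      by (simp add: w_def t_def sum_distrib_left[symmetric] sum_distrib_right[symmetric] sum_sq power2_eq_square)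
    finally have "\<sigma> * x \<le> \<sigma> * (w * (1 + 176/100 * t))" by (simp add: mult.commute)
    then show ?thesis using \<sigma>_pos by simp
  qed
  have PR: "P \<le> R"
  proof -
    have s0: "0 \<le> s" using t by (simp add: s_def)
    \<comment> \<open>Multiplying \<open>x_low\<close> by \<open>r\<close> bounds the unknown
      \<open>x * \<epsilon> / \<sigma>\<close> from below in terms of \<open>t\<close>
      alone.\<close>
    have "s = w * (1 - 21/10 * t) * r" using wr by (simp add: s_def mult_ac)
    also have "\<dots> \<le> x * r" using x_low r by (intro mult_right_mono) auto
    finally have "4 * s \<le> 4 * x * \<epsilon> / \<sigma>" by (simp add: r_def)
    \<comment> \<open>The hypothesis on \<open>x\<close> is precisely what keeps the argument of
      \<open>R\<close> in its finite range.\<close>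
    moreover have "4 * x * \<epsilon> / \<sigma> < 1/3"
      using x(2) \<epsilon>_pos \<sigma>_pos by (simp add: field_simps)
    ultimately have "1 + 17/2 * (4 * s) + 57/2 * (4 * s)\<^sup>2 \<le> R"
      unfolding R_def using s0 by (intro order_trans[OF _ Rfun_lower] add_mono mult_left_mono power_mono) auto
    then show ?thesis by (simp add: P_def power_mult_distrib)
  qed
  note num = error_numeric[OF t s_def, folded P_def]
  let ?T = "tilt_law M S l (x * \<sigma>) c"
  let ?E = "\<integral>z. indicator {0<..} z * exp (- ((l * c) * z)) \<partial>?T"
  have T: "real_distribution ?T"
    by (rule real_distribution_tilt_law[OF S_measurable integrable_exp_S[OF l(1) l1]])
  have lc: "0 \<le> l * c" using l c0 by simp
  \<comment> \<open>If the claimed error is at least 1 there is nothing to prove; otherwise \<open>r\<close> is so small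
    that the Berry-Esseen bound applies.\<close>
  have "\<bar>?E - Mills x\<bar> \<le> 2799/100 * R * r"
  proof (cases "1 \<le> 2799/100 * R * r")
    case True
    then show ?thesis
      using real_distribution.exp_tail_integral_bounds[OF T lc] Mills_bounds[OF x(1)] by linarith
  next
    case False
    define d d' where "d = sqrt 12 * \<epsilon> * (1 + 57 * (l * \<epsilon>)) * sqrt (1 - 56/10 * (l * \<epsilon>)) / c"
      and "d' = sqrt 12 * (1 + 57 * t) * r"
    have d0: "0 < d" using c0 \<epsilon>_pos t V by (auto simp: d_def V_def t_def intro!: divide_pos_pos mult_pos_pos)
    \<comment> \<open>The factor \<open>sqrt V\<close> built into \<open>d\<close> cancels against
      \<open>c_low\<close>, leaving \<open>d'\<close>, which is free of \<open>c\<close>.\<close>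
    have "d * (\<sigma> * sqrt V) \<le> d * c" using c_low d0 by (intro mult_left_mono) auto
    also have "d * c = d' * \<sigma> * sqrt V" using c0 \<sigma>_pos by (simp add: d_def d'_def t_def V_def r_def)
    finally have dd': "d \<le> d'" using \<sigma>_pos V by (simp add: mult.assoc[symmetric])
    have "6 * d' \<le> 2799/100 * P * r"
      using mult_right_mono[OF num(2), of r] r by (simp add: d'_def mult_ac)
    also have "\<dots> \<le> 2799/100 * R * r" using PR r by (intro mult_right_mono mult_left_mono) auto
    finally have d16: "d \<le> 1/6" using False dd' by linarith
    have iT: "integrable ?T (\<lambda>x. x)"
    proof -
      have "exp (l * S \<omega>) *\<^sub>R ((S \<omega> - x * \<sigma>) / c) = (exp (l * S \<omega>) * S \<omega> - x * \<sigma> * exp (l * S \<omega>)) / c" for \<omega>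
        by (simp add: algebra_simps diff_divide_distrib)
      then show ?thesis
        using integrable_S_exp_S[OF l(1) l1] integrable_exp_S[OF l(1) l1]
        by (subst integrable_tilt_law) auto
    qed
    have BE: "\<bar>cdf ?T z - cdf std_normal_distribution z\<bar> \<le> 12/5 * d" for z
    proof (rule Berry_Esseen_small_summands[OF T iT finite_lessThan[of n] _ char_tilt_S[OF l(1) l1 sum_tm] _ d0 d16])
      show "small_summand (tilt_law M (\<xi> j) l (tm j l) c) (tv j l / c\<^sup>2) d" if "j \<in> {..<n}" for j
        unfolding d_def using bernstein_variable.small_summand_tilt[OF X l c0] that by auto
      show "(\<Sum>j<n. tv j l / c\<^sup>2) = 1"
        unfolding sum_divide_distrib[symmetric] c2 using tv_pos by simp
    qed
    have 1: "\<bar>?E - Mills (l * c)\<bar> \<le> 24/5 * (sqrt 12 * (1 + 57 * t)) * r"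
      using exp_tail_diff_le[OF T real_dist_normal_dist BE lc] dd'
      unfolding Mills_eq_integral d'_def by simp
    have 2: "\<bar>Mills (l * c) - Mills x\<bar> \<le> 21/10 * (1 + 146/10 * t) * r"
    proof (cases "l = 0")
      case True
      \<comment> \<open>At zero tilt both arguments of \<open>Mills\<close> vanish;
        \<open>Mills_diff_le\<close> requires a positive lower bound for them.\<close>
      then have "x = 0" using x_up x(1) by (simp add: w_def)
      then show ?thesis using True r t by simp
    next
      case False
      then have w: "0 < w" using l \<sigma>_pos by (simp add: w_def)
      have lcw: "w * sqrt V \<le> l * c" "l * c \<le> w * (1 + 176/100 * t)"
        using mult_left_mono[OF c_low l(1)] mult_left_mono[OF c_up l(1)] by (simp_all add: w_def mult_ac)
      have "sqrt V \<le> 1 - 21/10 * t"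
        using t by (intro real_le_lsqrt) (auto simp: V_def power2_eq_square algebra_simps)
      then have xw: "w * sqrt V \<le> x"
        using x_low mult_left_mono[of "sqrt V" "1 - 21/10 * t" w] w by linarith
      have sV: "1 - 35/10 * t \<le> sqrt V" unfolding V_def by (rule sqrt_variance_numeric[OF t])
      \<comment> \<open>Both numbers lie between \<open>w * (1 - 3.5 * t)\<close> and
        \<open>w * (1 + 1.76 * t)\<close>, and \<open>5.26 = 3.5 + 1.76\<close>.\<close>
      have "\<bar>l * c - x\<bar> \<le> w * (526/100 * t)"
      proof -
        have "w * (1 - 35/10 * t) \<le> w * sqrt V" using sV w by (intro mult_left_mono) auto
        moreover have "w * (1 - 35/10 * t) \<le> w * (1 - 21/10 * t)" using w t by (intro mult_left_mono) auto
        ultimately have "w * (1 - 35/10 * t) \<le> l * c" "w * (1 - 35/10 * t) \<le> x" using lcw x_low by auto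
        moreover have "w * (1 + 176/100 * t) = w * (1 - 35/10 * t) + w * (526/100 * t)" by (simp add: field_simps)
        ultimately show ?thesis using lcw(2) x_up unfolding abs_le_iff by linarith
      qed
      then have "399/1000 * \<bar>l * c - x\<bar> / (w * sqrt V)\<^sup>2 \<le> 399/1000 * (w * (526/100 * t)) / (w * sqrt V)\<^sup>2"
        by (intro divide_right_mono mult_left_mono) auto
      \<comment> \<open>By \<open>t = w * r\<close> the two powers of \<open>w\<close> in the
        denominator cancel and one factor \<open>r\<close> remains. The product
        \<open>0.399 * 5.26\<close> is just below 21/10, and \<open>1 + 146/10 * t\<close>
        compensates \<open>1 / V\<close>.\<close>
      also have "\<dots> = 399/1000 * (526/100) * r / V"
        using w V wr[symmetric] by (simp add: power_mult_distrib power2_eq_square)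
      also have "\<dots> \<le> 21/10 * (1 + 146/10 * t) * r"
      proof -
        have "0 \<le> t * (9 - 8176/100 * t)" using t by (intro mult_nonneg_nonneg) auto
        moreover have "(1 + 146/10 * t) * V = 1 + t * (9 - 8176/100 * t)"
          by (simp add: V_def field_simps)
        ultimately have "399/1000 * (526/100) \<le> 21/10 * ((1 + 146/10 * t) * V)" by linarith
        then have "399/1000 * (526/100) * r \<le> 21/10 * ((1 + 146/10 * t) * V) * r" using r by (intro mult_right_mono) auto
        then show ?thesis using V by (simp add: pos_divide_le_eq mult_ac)
      qed
      finally show ?thesis
        using Mills_diff_le[OF _ lcw(1) xw] w V by simp
    qed
    have "\<bar>?E - Mills x\<bar> \<le> (24/5 * (sqrt 12 * (1 + 57 * t)) + 21/10 * (1 + 146/10 * t)) * r"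
      unfolding distrib_right using 1 2 by linarith
    also have "\<dots> \<le> 2799/100 * P * r" using num(1) r by (intro mult_right_mono) auto
    also have "\<dots> \<le> 2799/100 * R * r" using PR r by (intro mult_right_mono mult_left_mono) auto
    finally show ?thesis .
  qed
  then show "\<bar>?E - Mills x\<bar> \<le> 2799/100 * real_of_ereal (Rfun (4 * x * \<epsilon> / \<sigma>)) * (\<epsilon> / \<sigma>)"
    by (simp only: R_def r_def)
qed

theorem large_deviation_expansion:
  assumes x: "0 \<le> x" "x < 1/12 * \<sigma> / \<epsilon>"
  shows "\<exists>\<theta>. \<bar>\<theta>\<bar> \<le> 1 \<and> measure M {\<omega>\<in>space M. S \<omega> > x * \<sigma>} =
    chernoff_inf M S (x * \<sigma>) * (Mills x + 27.99 * \<theta> * real_of_ereal (Rfun (4 * x * \<epsilon> / \<sigma>)) * (\<epsilon> / \<sigma>))"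
proof -
  obtain l where l: "0 \<le> l" "l * \<epsilon> \<le> 11/100" and sum_tm: "(\<Sum>i<n. tm i l) = x * \<sigma>"
    by (rule saddle_point_exists[OF x])
  define c where "c = sqrt (\<Sum>i<n. tv i l)"
  define E where "E = (\<integral>z. indicator {0<..} z * exp (- ((l * c) * z)) \<partial>tilt_law M S l (x * \<sigma>) c)"
  define Q where "Q = 2799/100 * real_of_ereal (Rfun (4 * x * \<epsilon> / \<sigma>)) * (\<epsilon> / \<sigma>)"
  have E: "\<bar>E - Mills x\<bar> \<le> Q" and c: "0 < c"
    using tilted_tail_approx[OF x l sum_tm c_def] by (simp_all only: E_def Q_def)
  have "1 \<le> real_of_ereal (Rfun (4 * x * \<epsilon> / \<sigma>))"
    by (rule order_trans[OF _ Rfun_lower]) (use x \<epsilon>_pos \<sigma>_pos in \<open>auto simp: field_simps\<close>)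
  then have Q: "0 < Q" using \<epsilon>_pos \<sigma>_pos by (auto simp: Q_def intro!: mult_pos_pos divide_pos_pos)
  have \<theta>: "\<bar>(E - Mills x) / Q\<bar> \<le> 1" using E Q by simp
  have tail: "measure M {\<omega>\<in>space M. S \<omega> > x * \<sigma>} = chernoff_inf M S (x * \<sigma>) * E"
    unfolding E_def using l by (intro tail_prob_eq[OF _ _ sum_tm c]) auto
  have "E = Mills x + 27.99 * ((E - Mills x) / Q) * real_of_ereal (Rfun (4 * x * \<epsilon> / \<sigma>)) * (\<epsilon> / \<sigma>)"
  proof -
    have "27.99 * ((E - Mills x) / Q) * real_of_ereal (Rfun (4 * x * \<epsilon> / \<sigma>)) * (\<epsilon> / \<sigma>) = (E - Mills x) / Q * Q"
      by (simp add: Q_def)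
    then show ?thesis using Q by simp
  qed
  from arg_cong[OF this, of "\<lambda>u. chernoff_inf M S (x * \<sigma>) * u"] show ?thesis
    using \<theta> by (intro exI[of _ "(E - Mills x) / Q"] conjI) (simp_all only: tail)
qed

end

section \<open>The case of identically distributed summands\<close>

lemma bernstein_cond_distr_cong:
  assumes [measurable]: "X \<in> borel_measurable M" "Y \<in> borel_measurable M"
    and eq: "distr M borel X = distr M borel Y"
  shows "(\<integral>\<omega>. X \<omega> ^ k \<partial>M) = (\<integral>\<omega>. Y \<omega> ^ k \<partial>M :: real)" "bernstein_cond M X \<epsilon> \<longleftrightarrow> bernstein_cond M Y \<epsilon>"
proof -
  have I: "(\<integral>\<omega>. X \<omega> ^ k \<partial>M) = (\<integral>\<omega>. Y \<omega> ^ k \<partial>M)" for k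
    using integral_distr[of X M borel "\<lambda>x. x ^ k"] integral_distr[of Y M borel "\<lambda>x. x ^ k"] eq by simp
  have "integrable M (\<lambda>\<omega>. X \<omega> ^ k) \<longleftrightarrow> integrable M (\<lambda>\<omega>. Y \<omega> ^ k)" for k
    using integrable_distr_eq[of X M borel "\<lambda>x. x ^ k"] integrable_distr_eq[of Y M borel "\<lambda>x. x ^ k"] eq by simp
  then show "bernstein_cond M X \<epsilon> \<longleftrightarrow> bernstein_cond M Y \<epsilon>"
    unfolding bernstein_cond_def I by simp
  show "(\<integral>\<omega>. X \<omega> ^ k \<partial>M) = (\<integral>\<omega>. Y \<omega> ^ k \<partial>M)" by (rule I)
qed

lemma iid_expansion:
  fixes M :: "'a measure" and \<xi> :: "nat \<Rightarrow> 'a \<Rightarrow> real" and x :: "nat \<Rightarrow> real"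
  assumes "prob_space M" and indep: "prob_space.indep_vars M (\<lambda>_. borel) \<xi> UNIV"
    and distr: "\<And>i. distr M borel (\<xi> i) = distr M borel (\<xi> 0)" and \<epsilon>: "\<epsilon> > 0"
    and bernstein: "bernstein_cond M (\<xi> 0) \<epsilon>" and mean: "(\<integral>\<omega>. \<xi> 0 \<omega> \<partial>M) = 0"
    and var: "(\<integral>\<omega>. (\<xi> 0 \<omega>)\<^sup>2 \<partial>M) > 0" and x0: "\<And>n. 0 \<le> x n" and xo: "x \<in> o(\<lambda>n. sqrt (real n))"
  shows "(\<lambda>n. let S = (\<lambda>\<omega>. \<Sum>i<n. \<xi> i \<omega>);
               \<sigma> = sqrt (\<Sum>i<n. \<integral>\<omega>. (\<xi> i \<omega>)\<^sup>2 \<partial>M) in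
           \<bar>measure M {\<omega>\<in>space M. S \<omega> > x n * \<sigma>} - Mills (x n) * chernoff_inf M S (x n * \<sigma>)\<bar>)
        \<in> O(\<lambda>n. 1 / sqrt (real n) * Bfun (x n) (\<epsilon> / sqrt (\<Sum>i<n. \<integral>\<omega>. (\<xi> i \<omega>)\<^sup>2 \<partial>M)))"
proof -
  interpret prob_space M by fact
  define \<tau> where "\<tau> = sqrt (\<integral>\<omega>. (\<xi> 0 \<omega>)\<^sup>2 \<partial>M)"
  have \<tau>: "0 < \<tau>" using var by (simp add: \<tau>_def)
  have meas: "\<xi> i \<in> borel_measurable M" for i
    using indep by (auto simp: indep_vars_def)
  note cong = bernstein_cond_distr_cong[OF meas meas distr]
  have sq: "(\<integral>\<omega>. (\<xi> i \<omega>)\<^sup>2 \<partial>M) = \<tau>\<^sup>2" for i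
    using cong(1)[of i 2] var by (simp add: \<tau>_def)
  have sum: "sqrt (\<Sum>i<n. \<integral>\<omega>. (\<xi> i \<omega>)\<^sup>2 \<partial>M) = sqrt (real n) * \<tau>" for n
    unfolding sq using \<tau> by (simp add: real_sqrt_mult)
  have "\<forall>\<^sub>F n in sequentially. norm (x n) \<le> \<tau> / (24 * \<epsilon>) * norm (sqrt (real n))"
    using xo \<tau> \<epsilon> by (intro landau_o.smallD) auto
  \<comment> \<open>The factor 24 gives \<open>x n * \<epsilon> / \<sigma> \<le> 1/24\<close>:
    inside the range below 1/12, and with \<open>4 * x n * \<epsilon> / \<sigma> \<le> 1/6\<close>,
    where \<open>Rfun_upper\<close> applies.\<close>
  then have ev: "\<forall>\<^sub>F n in sequentially. n > 0 \<and> x n \<le> \<tau> / (24 * \<epsilon>) * sqrt (real n)"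
    using eventually_gt_at_top[of 0] by eventually_elim auto
  show ?thesis
  proof (rule bigoI[of _ "2799/100 * 4096 * \<epsilon> / \<tau>"], rule eventually_mono[OF ev])
    fix n assume n: "n > 0 \<and> x n \<le> \<tau> / (24 * \<epsilon>) * sqrt (real n)"
    interpret B: bernstein_sum M \<xi> n \<epsilon>
    proof
      show "indep_vars (\<lambda>_. borel) \<xi> {..<n}" by (rule indep_vars_subset[OF indep]) simp
      show "0 < \<epsilon>" by fact
      show "bernstein_cond M (\<xi> i) \<epsilon>" for i using cong(2) bernstein by blast
      show "(\<integral>\<omega>. \<xi> i \<omega> \<partial>M) = 0" for i using cong(1)[of i 1] mean by simp
      show "0 < (\<Sum>i<n. \<integral>\<omega>. (\<xi> i \<omega>)\<^sup>2 \<partial>M)" unfolding sq using \<tau> n by simp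
    qed
    have S: "B.S = (\<lambda>\<omega>. \<Sum>i<n. \<xi> i \<omega>)" by (simp add: B.S_def fun_eq_iff)
    have \<sigma>: "B.\<sigma> = sqrt (real n) * \<tau>" using sum by (simp add: B.\<sigma>_def)
    let ?r = "\<epsilon> / B.\<sigma>"
    have xr: "x n * ?r \<le> 1/24"
      using n \<epsilon> \<tau> by (simp add: \<sigma> field_simps)
    have xn: "x n < 1/12 * B.\<sigma> / \<epsilon>"
    proof -
      have "x n * \<epsilon> \<le> 1/24 * B.\<sigma>" using xr B.\<sigma>_pos by (simp add: field_simps)
      then show ?thesis using B.\<sigma>_pos \<epsilon> by (simp add: field_simps)
    qed
    have \<tau>': "0 \<le> 4 * x n * \<epsilon> / B.\<sigma>" "4 * x n * \<epsilon> / B.\<sigma> \<le> 1/6"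
      using xr x0[of n] \<epsilon> B.\<sigma>_pos by (auto simp: field_simps)
    obtain \<theta> where \<theta>: "\<bar>\<theta>\<bar> \<le> 1" and eq: "measure M {\<omega>\<in>space M. B.S \<omega> > x n * B.\<sigma>} =
      chernoff_inf M B.S (x n * B.\<sigma>) * (Mills (x n) + 27.99 * \<theta> * real_of_ereal (Rfun (4 * x n * \<epsilon> / B.\<sigma>)) * ?r)"
      using B.large_deviation_expansion[OF x0 xn] by blast
    define C where "C = chernoff_inf M B.S (x n * B.\<sigma>)"
    define R where "R = real_of_ereal (Rfun (4 * x n * \<epsilon> / B.\<sigma>))"
    have C: "0 \<le> C" "C \<le> Bfun (x n) ?r"
      using B.chernoff_inf_le_Bfun[OF x0] by (simp_all add: C_def chernoff_inf_def)
    have "0 \<le> 1 + 17/2 * (4 * x n * \<epsilon> / B.\<sigma>) + 57/2 * (4 * x n * \<epsilon> / B.\<sigma>)\<^sup>2"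
      using \<tau>'(1) by (intro add_nonneg_nonneg mult_nonneg_nonneg) auto
    also have "\<dots> \<le> R"
      unfolding R_def by (rule Rfun_lower[OF \<tau>'(1)]) (rule le_less_trans[OF \<tau>'(2)], simp)
    finally have R: "0 \<le> R" "R \<le> 4096"
      using Rfun_upper[OF \<tau>'] by (simp_all add: R_def)
    have r: "0 < ?r" using \<epsilon> B.\<sigma>_pos by simp
    have "measure M {\<omega>\<in>space M. B.S \<omega> > x n * B.\<sigma>} - Mills (x n) * C = C * (2799/100 * \<theta> * R * ?r)"
      unfolding eq C_def[symmetric] R_def[symmetric] by (simp add: algebra_simps)
    also have "\<bar>\<dots>\<bar> = C * (2799/100 * \<bar>\<theta>\<bar> * R * ?r)"
      using C R \<epsilon> B.\<sigma>_pos by (simp add: abs_mult)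
    also have "\<dots> \<le> Bfun (x n) ?r * (2799/100 * 1 * 4096 * ?r)"
      using C R r \<theta> by (intro mult_mono mult_nonneg_nonneg) auto
    also have "\<dots> = 2799/100 * 4096 * \<epsilon> / \<tau> * (1 / sqrt (real n) * Bfun (x n) ?r)"
      by (simp add: \<sigma> mult_ac)
    finally show "norm (let S = (\<lambda>\<omega>. \<Sum>i<n. \<xi> i \<omega>);
               \<sigma> = sqrt (\<Sum>i<n. \<integral>\<omega>. (\<xi> i \<omega>)\<^sup>2 \<partial>M) in
           \<bar>measure M {\<omega>\<in>space M. S \<omega> > x n * \<sigma>} - Mills (x n) * chernoff_inf M S (x n * \<sigma>)\<bar>)
        \<le> 2799/100 * 4096 * \<epsilon> / \<tau> * norm (1 / sqrt (real n) * Bfun (x n) (\<epsilon> / sqrt (\<Sum>i<n. \<integral>\<omega>. (\<xi> i \<omega>)\<^sup>2 \<partial>M)))"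
      unfolding Let_def C_def S \<sigma> sum by (simp add: Bfun_def)
  qed
qed

theorem theorem4:
  shows
  "(\<forall>(M::'a measure) (\<xi>::nat \<Rightarrow> 'a \<Rightarrow> real) (n::nat) (\<epsilon>::real).
      prob_space M \<and> prob_space.indep_vars M (\<lambda>_. borel) \<xi> {..<n} \<and> \<epsilon> > 0 \<and>
      (\<forall>i<n. bernstein_cond M (\<xi> i) \<epsilon> \<and> (\<integral>\<omega>. \<xi> i \<omega> \<partial>M) = 0) \<and>
      (\<Sum>i<n. \<integral>\<omega>. (\<xi> i \<omega>)\<^sup>2 \<partial>M) > 0 \<longrightarrow>
      (let S = (\<lambda>\<omega>. \<Sum>i<n. \<xi> i \<omega>);
           \<sigma> = sqrt (\<Sum>i<n. \<integral>\<omega>. (\<xi> i \<omega>)\<^sup>2 \<partial>M) in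
       \<forall>x::real. 0 \<le> x \<and> x < 1/12 * \<sigma> / \<epsilon> \<longrightarrow>
         (\<exists>\<theta>::real. \<bar>\<theta>\<bar> \<le> 1 \<and>
            measure M {\<omega>\<in>space M. S \<omega> > x * \<sigma>} =
              chernoff_inf M S (x * \<sigma>) *
              (Mills x + 27.99 * \<theta> * real_of_ereal (Rfun (4 * x * \<epsilon> / \<sigma>)) * (\<epsilon> / \<sigma>))) \<and>
         chernoff_inf M S (x * \<sigma>) \<le> Bfun x (\<epsilon> / \<sigma>)))
   \<and>
   (\<forall>(M::'a measure) (\<xi>::nat \<Rightarrow> 'a \<Rightarrow> real) (\<epsilon>::real) (x::nat \<Rightarrow> real).
      prob_space M \<and> prob_space.indep_vars M (\<lambda>_. borel) \<xi> UNIV \<and>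
      (\<forall>i. distr M borel (\<xi> i) = distr M borel (\<xi> 0)) \<and> \<epsilon> > 0 \<and>
      bernstein_cond M (\<xi> 0) \<epsilon> \<and> (\<integral>\<omega>. \<xi> 0 \<omega> \<partial>M) = 0 \<and>
      (\<integral>\<omega>. (\<xi> 0 \<omega>)\<^sup>2 \<partial>M) > 0 \<and>
      (\<forall>n. 0 \<le> x n) \<and> x \<in> o(\<lambda>n. sqrt (real n)) \<longrightarrow>
      (\<lambda>n. let S = (\<lambda>\<omega>. \<Sum>i<n. \<xi> i \<omega>);
               \<sigma> = sqrt (\<Sum>i<n. \<integral>\<omega>. (\<xi> i \<omega>)\<^sup>2 \<partial>M) in
           \<bar>measure M {\<omega>\<in>space M. S \<omega> > x n * \<sigma>} - Mills (x n) * chernoff_inf M S (x n * \<sigma>)\<bar>)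
        \<in> O(\<lambda>n. 1 / sqrt (real n) * Bfun (x n) (\<epsilon> / sqrt (\<Sum>i<n. \<integral>\<omega>. (\<xi> i \<omega>)\<^sup>2 \<partial>M))))"
proof (intro conjI allI impI, goal_cases)
  case (1 M \<xi> n \<epsilon>)
  interpret prob_space M using 1 by blast
  interpret B: bernstein_sum M \<xi> n \<epsilon> using 1 by unfold_locales auto
  have S: "B.S = (\<lambda>\<omega>. \<Sum>i<n. \<xi> i \<omega>)" by (simp add: B.S_def fun_eq_iff)
  show ?case
    unfolding Let_def S[symmetric] B.\<sigma>_def[symmetric]
    using B.large_deviation_expansion B.chernoff_inf_le_Bfun by blast
next
  case (2 M \<xi> \<epsilon> x)
  then show ?case by (intro iid_expansion) blast+
qed

end
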